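(* Let $\alpha>-1$. Let $u$ be an $\alpha$-harmonic function in $\mathbb{H}$ which is of temperate growth at infinity. Assume that $\lim_{y\to0+}u(\cdot+iy)=0$ in $\mathcal{D}'(\mathbb{R})$. Then $u\in\mathcal{V}_\alpha$.
   Context: $\mathbb{H}=\{z\in\mathbb{C}:\operatorname{Im} z>0\}$ is the open upper half-plane. Functions are complex-valued. $\partial_z$ and $\bar\partial_z$ are the usual complex partial derivatives, $\partial_z=\frac12(\partial_x-i\partial_y)$, $\bar\partial_z=\frac12(\partial_x+i\partial_y)$ for $z=x+iy$. For $\alpha>-1$, a function $u\in C^2(\mathbb{H})$ is called $\alpha$-harmonic in $\mathbb{H}$ if $\partial_z\big((\operatorname{Im} z)^{-\alpha}\,\bar\partial_z u(z)\big)=0$ for all $z\in\mathbb{H}$. A function $u$ in $\mathbb{H}$ is of temperate growth at infinity if there are positive constants $C,R,N$ such that $|u(z)|\leq C\,(|z|^2/\operatorname{Im} z)^N$ for all $z\in\mathbb{H}$ with $|z|>R$. $\lim_{y\to0+}u(\cdot+iy)=0$ in $\mathcal{D}'(\mathbb{R})$ means that $\lim_{y\to0+}\int_{-\infty}^\infty u(x+iy)\psi(x)\,dx=0$ for every $\psi\in C_0^\infty(\mathbb{R})$ (smooth compactly supported test functions). Pochhammer symbols: $(a)_0=1$ and $(a)_k=\prod_{j=0}^{k-1}(a+j)$ for $k\geq1$. For $k\in\mathbb{N}=\{0,1,2,\dots\}$ set $$p_{k,\alpha}(z)=\sum_{j=0}^k\frac{(\alpha+1)_j}{j!}\,z^{k-j}\bar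 z^{\,j}.$$ $\mathcal{V}_\alpha$ is the set of all functions on $\mathbb{H}$ of the form $u(z)=\sum_{k=0}^n c_k(\operatorname{Im} z)^{\alpha+1}p_{k,\alpha}(z)$, $z\in\mathbb{H}$, for some $n\in\mathbb{N}$ and $c_0,\dots,c_n\in\mathbb{C}$. *)

theory Defs
  imports "HOL-Analysis.Analysis"
begin

text \<open>
  Functions on the upper half-plane are represented by total functions on the complex plane.
  The half-plane is open, so the notions below depend only on the values taken there.
\<close>

definition upper_half_plane :: "complex set" where
  "upper_half_plane = {z. Im z > 0}"

definition partial_x :: "(complex \<Rightarrow> complex) \<Rightarrow> complex \<Rightarrow> complex" where
  "partial_x u z = vector_derivative (\<lambda>t::real. u (z + of_real t)) (at 0)"

definition partial_y :: "(complex \<Rightarrow> complex) \<Rightarrow> complex \<Rightarrow> complex" where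
  "partial_y u z = vector_derivative (\<lambda>t::real. u (z + \<i> * of_real t)) (at 0)"

definition del_z :: "(complex \<Rightarrow> complex) \<Rightarrow> complex \<Rightarrow> complex" where
  "del_z u z = (partial_x u z - \<i> * partial_y u z) / 2"

definition delbar_z :: "(complex \<Rightarrow> complex) \<Rightarrow> complex \<Rightarrow> complex" where
  "delbar_z u z = (partial_x u z + \<i> * partial_y u z) / 2"

text \<open>
  In the next two definitions, differentiability is real (Frechet) differentiability, and
  the set \<open>S\<close> is meant to be open.
\<close>

definition C1_on :: "complex set \<Rightarrow> (complex \<Rightarrow> complex) \<Rightarrow> bool" where
  "C1_on S u \<longleftrightarrow>
     (\<forall>z\<in>S. u differentiable (at z)) \<and>
     continuous_on S (partial_x u) \<and> continuous_on S (partial_y u)"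

definition C2_on :: "complex set \<Rightarrow> (complex \<Rightarrow> complex) \<Rightarrow> bool" where
  "C2_on S u \<longleftrightarrow> C1_on S u \<and> C1_on S (partial_x u) \<and> C1_on S (partial_y u)"

definition alpha_harmonic :: "real \<Rightarrow> (complex \<Rightarrow> complex) \<Rightarrow> bool" where
  "alpha_harmonic \<alpha> u \<longleftrightarrow>
     C2_on upper_half_plane u \<and>
     (\<forall>z\<in>upper_half_plane.
        del_z (\<lambda>w. of_real (Im w powr (- \<alpha>)) * delbar_z u w) z = 0)"

definition temperate_growth_at_infinity :: "(complex \<Rightarrow> complex) \<Rightarrow> bool" where
  "temperate_growth_at_infinity u \<longleftrightarrow>
     (\<exists>C>0. \<exists>R>0. \<exists>N>0. \<forall>z\<in>upper_half_plane.
        norm z > R \<longrightarrow> norm (u z) \<le> C * ((norm z)\<^sup>2 / Im z) powr N)"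

text \<open>Every iterated derivative exists on the whole line, and the support is compact.\<close>

definition test_function :: "(real \<Rightarrow> complex) \<Rightarrow> bool" where
  "test_function \<psi> \<longleftrightarrow>
     (\<forall>n x. ((\<lambda>f t. vector_derivative f (at t)) ^^ n) \<psi> differentiable (at x)) \<and>
     compact (closure {x. \<psi> x \<noteq> 0})"

definition zero_distributional_boundary_value :: "(complex \<Rightarrow> complex) \<Rightarrow> bool" where
  "zero_distributional_boundary_value u \<longleftrightarrow>
     (\<forall>\<psi>. test_function \<psi> \<longrightarrow>
        ((\<lambda>y. \<integral>x. u (Complex x y) * \<psi> x \<partial>lborel) \<longlongrightarrow> 0) (at_right 0))"

definition p_poly :: "nat \<Rightarrow> real \<Rightarrow> complex \<Rightarrow> complex" where
  "p_poly k \<alpha> z =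
     (\<Sum>j\<le>k. of_real (pochhammer (\<alpha> + 1) j / fact j) * z ^ (k - j) * cnj z ^ j)"

definition V_space :: "real \<Rightarrow> (complex \<Rightarrow> complex) set" where
  "V_space \<alpha> =
     {u. \<exists>(n::nat) (c::nat \<Rightarrow> complex). \<forall>z\<in>upper_half_plane.
           u z = (\<Sum>k\<le>n. c k * of_real (Im z powr (\<alpha> + 1)) * p_poly k \<alpha> z)}"

end

theory Submission
  imports Defs "HOL-Complex_Analysis.Complex_Analysis"
begin

text \<open>
  Write \<open>y = Im z\<close>. The flux \<open>w = y^(-\<alpha>) delbar u\<close> is antiholomorphic, \<open>w z = G (cnj z)\<close> with \<open>G\<close>
  holomorphic in the lower half-plane, and the point is that \<open>G\<close> is a polynomial. Mollify \<open>u\<close> in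
  the horizontal direction. By uniform boundedness the mollified functions stay bounded at the
  boundary over compact sets; far out, temperate growth and an ordinary differential equation in \<open>y\<close>,
  whose coefficients involve only horizontal derivatives (that is, other mollifiers), remove all
  negative powers of \<open>y\<close>, so that \<open>\<bar>u z\<bar> \<le> C (1 + \<bar>z\<bar>)^P\<close> and \<open>u\<close> tends to \<open>0\<close> boundedly.

  For \<open>Im a < 0\<close> and large integral \<open>k\<close>, pair with the holomorphic kernel
  \<open>(z - a)^(-\<alpha>-1-k)\<close>. Green's formula gives \<open>\<integral> t^\<alpha> (\<integral> (x + \<i>t - a)^(-\<alpha>-1-k) w (x + \<i>t) dx) dt = 0\<close>.
  Shifting contours and integrating first in \<open>t\<close> turns the kernel into a multiple of \<open>(x - a)^(-k)\<close>: the
  choice of the exponent makes it a pole, and Cauchy's formula says that the derivative of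
  order \<open>k - 1\<close> of \<open>G\<close> vanishes at \<open>a\<close>. Subtracting a member of \<open>V_space\<close> with
  the same flux leaves a holomorphic function with zero boundary value, which vanishes by
  Schwarz reflection.
\<close>

section \<open>Test functions\<close>

text \<open>The boundary value exists only in the sense of distributions, so \<open>u\<close> itself
  offers neither bounds near the axis nor dominated convergence. Since y^\<alpha> is constant on
  horizontal lines, convolution in x commutes with the equation, and every horizontal derivative of
  the result is \<open>u\<close> convolved with another test function. A bound valid for every
  mollifier is thus a bound for all horizontal derivatives at once. The growth exponents do not
  depend on the mollifier, so one order of differentiation annihilates all mollifications of G,
  hence G. The kernel exponent comes from homogeneity. In the variable \<zeta> = x - \<i>t, in which
  the flux is holomorphic, the kernel reads (\<zeta> - a + 2\<i>t)^(-\<alpha>-1-k). Once the line of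
  integration is fixed, G no longer depends on t, and the integral of t^\<alpha> (\<tau> +
  2\<i>t)^(-\<alpha>-1-k) over t > 0 has degree -k in \<tau> = \<zeta> - a.\<close>

definition test_tower :: "real \<Rightarrow> (nat \<Rightarrow> real \<Rightarrow> complex) \<Rightarrow> bool" where
  "test_tower A D \<longleftrightarrow> A > 0 \<and> (\<forall>n t. (D n has_vector_derivative D (Suc n) t) (at t)) \<and>
     (\<forall>n t. A \<le> \<bar>t\<bar> \<longrightarrow> D n t = 0)"

lemma test_towerD:
  assumes "test_tower A D"
  shows "A > 0" "(D n has_vector_derivative D (Suc n) t) (at t)" "A \<le> \<bar>t\<bar> \<Longrightarrow> D n t = 0"
  using assms unfolding test_tower_def by auto

lemma test_tower_continuous:
  assumes "test_tower A D"
  shows "continuous_on S (D n)"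
  using test_towerD(2)[OF assms, of n]
  by (meson continuous_at_imp_continuous_on has_vector_derivative_continuous)

lemma test_tower_shift: "test_tower A D \<Longrightarrow> test_tower A (\<lambda>n. D (k + n))"
  unfolding test_tower_def by auto

text \<open>\<open>test_function\<close> speaks of iterates of \<open>vector_derivative\<close>; a
  sequence of successive derivatives must agree with them, so smoothness can be shown by exhibiting
  the sequence.\<close>

lemma test_function_if_derivatives:
  assumes D: "\<And>n t. (D n has_vector_derivative D (Suc n) t) (at t)"
    and supp: "\<And>t. A < \<bar>t\<bar> \<Longrightarrow> D 0 t = 0"
  shows "test_function (D 0)"
proof -
  have it: "((\<lambda>f t. vector_derivative f (at t)) ^^ n) (D 0) = D n" for n
  proof (induction n)
    case (Suc n)
    have "((\<lambda>f t. vector_derivative f (at t)) ^^ Suc n) (D 0) = (\<lambda>t. vector_derivative (D n) (at t))"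
      using Suc by simp
    then show ?case by (simp add: vector_derivative_at[OF D])
  qed simp
  have "D n differentiable at t" for n t
    using D differentiableI_vector by blast
  moreover have "{x. D 0 x \<noteq> 0} \<subseteq> {-A..A}"
  proof
    fix x assume "x \<in> {x. D 0 x \<noteq> 0}"
    then have "\<bar>x\<bar> \<le> A" using supp[of x] by force
    then show "x \<in> {-A..A}" by auto
  qed
  then have "compact (closure {x. D 0 x \<noteq> 0})"
    by (meson bounded_closed_interval bounded_subset compact_closure)
  ultimately show ?thesis
    unfolding test_function_def it by auto
qed

lemma test_function_if_tower: "test_tower A D \<Longrightarrow> test_function (D n)"
  using test_function_if_derivatives[of "\<lambda>m. D (n + m)" A] by (auto simp: test_tower_def)

lemma test_function_tower:
  assumes "test_function \<psi>"
  obtains A D where "test_tower A D" "D 0 = \<psi>"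
proof -
  define D where "D n = ((\<lambda>f t. vector_derivative f (at t)) ^^ n) \<psi>" for n
  have D: "(D n has_vector_derivative D (Suc n) t) (at t)" for n t
    using assms unfolding test_function_def D_def
    by (auto simp: vector_derivative_works[symmetric])
  have "bounded {x. \<psi> x \<noteq> 0}"
    using assms unfolding test_function_def
    by (meson bounded_subset closure_subset compact_imp_bounded)
  then obtain A where A: "A > 0" "\<And>x. \<psi> x \<noteq> 0 \<Longrightarrow> \<bar>x\<bar> \<le> A"
    unfolding bounded_pos by auto
  have zero: "A < \<bar>t\<bar> \<Longrightarrow> D n t = 0" for n t
  proof (induction n arbitrary: t)
    case 0
    then show ?case using A(2)[of t] by (auto simp: D_def)
  next
    case (Suc n)
    \<comment> \<open>The strict inequality gives an open set on which the previous derivative is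
      identically 0, so the next one vanishes there as well.\<close>
    have "open {t. A < \<bar>t\<bar>}" by (intro open_Collect_less continuous_intros)
    then have "(D n has_vector_derivative 0) (at t)"
      by (rule has_vector_derivative_transform_within_open[OF has_vector_derivative_const])
         (use Suc in auto)
    then show ?case using D vector_derivative_unique_at by blast
  qed
  \<comment> \<open>A tower has to vanish already at distance A, so that integration by parts over
    [-A, A] has no boundary terms; hence the larger radius.\<close>
  have "test_tower (A + 1) D"
    unfolding test_tower_def using D zero A(1) by auto
  then show thesis using that[of "A + 1" D] by (auto simp: D_def)
qed

text \<open>Coinduction for smoothness: it suffices to exhibit a class of functions closed under
  differentiation.\<close>

lemma test_tower_coinduct:
  assumes C: "\<And>f. f \<in> C \<Longrightarrow> \<exists>f'\<in>C. \<forall>t. (f has_vector_derivative f' t) (at t)"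
    and supp: "\<And>f t. f \<in> C \<Longrightarrow> A \<le> \<bar>t\<bar> \<Longrightarrow> f t = 0" and "A > 0" "f \<in> C"
  obtains D where "test_tower A D" "D 0 = f"
proof -
  obtain d where d: "\<And>f. f \<in> C \<Longrightarrow> d f \<in> C"
    "\<And>f t. f \<in> C \<Longrightarrow> (f has_vector_derivative d f t) (at t)"
    using C by metis
  define D where "D n = (d ^^ n) f" for n
  have "D n \<in> C" for n
    by (induction n) (use \<open>f \<in> C\<close> d in \<open>auto simp: D_def\<close>)
  then have "test_tower A D"
    unfolding test_tower_def using d supp \<open>A > 0\<close> by (auto simp: D_def)
  then show thesis using that[of D] by (auto simp: D_def)
qed

text \<open>These are x^(-n) exp(-1/x) continued by 0. Differentiation raises n by 1 or 2 with
  constant coefficients, so all derivatives of the standard flat function lie in the span of this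
  one family.\<close>

definition flat :: "nat \<Rightarrow> real \<Rightarrow> real" where
  "flat n x = (if x > 0 then (1 / x) ^ n * exp (- (1 / x)) else 0)"

lemma flat_tendsto_0: "(flat n \<longlongrightarrow> 0) (at 0)"
proof -
  have "((\<lambda>x. (inverse x) ^ n / exp (inverse x)) \<longlongrightarrow> (0::real)) (at_right 0)"
    using filterlim_compose[OF tendsto_power_div_exp_0 filterlim_inverse_at_top_right] .
  then have "(flat n \<longlongrightarrow> 0) (at_right 0)"
    by (rule Lim_transform_eventually)
       (auto simp: eventually_at_filter flat_def exp_minus field_simps)
  moreover have "(flat n \<longlongrightarrow> 0) (at_left 0)"
    by (rule Lim_transform_eventually[OF tendsto_const])
       (auto simp: eventually_at_filter flat_def)
  ultimately show ?thesis using filterlim_at_split by blast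
qed

lemma has_real_derivative_flat:
  "(flat n has_real_derivative (flat (n + 2) x - real n * flat (n + 1) x)) (at x)"
proof -
  consider "x > 0" | "x < 0" | "x = 0" by linarith
  then show ?thesis
  proof cases
    case 1
    have "((\<lambda>x. (1 / x) ^ n * exp (- (1 / x))) has_real_derivative
       (flat (n + 2) x - real n * flat (n + 1) x)) (at x)"
      using 1 by (auto intro!: derivative_eq_intros simp: flat_def)
        (cases n; simp add: field_simps power2_eq_square)
    then show ?thesis
      by (rule DERIV_cong_ev[THEN iffD1, OF refl _ refl, rotated])
         (use 1 eventually_nhds_in_open[of "{0<..}" x] in
           \<open>auto elim!: eventually_mono simp: flat_def\<close>)
  next
    case 2
    have "((\<lambda>x. 0) has_real_derivative (flat (n + 2) x - real n * flat (n + 1) x)) (at x)"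
      using 2 by (auto simp: flat_def)
    then show ?thesis
      by (rule DERIV_cong_ev[THEN iffD1, OF refl _ refl, rotated])
         (use 2 eventually_nhds_in_open[of "{..<0}" x] in
           \<open>auto elim!: eventually_mono simp: flat_def\<close>)
  next
    case 3
    \<comment> \<open>For h \<noteq> 0 the difference quotient of \<open>flat n\<close> at 0 is
      exactly \<open>flat (Suc n) h\<close>, whose limit is already known.\<close>
    have "((\<lambda>h. (flat n (0 + h) - flat n 0) / h) \<longlongrightarrow> 0) (at 0)"
      by (rule Lim_transform_eventually[OF flat_tendsto_0[of "Suc n"]])
         (auto simp: eventually_at_filter flat_def)
    then show ?thesis
      using 3 by (simp add: DERIV_def flat_def)
  qed
qed

text \<open>Each generator vanishes unless |t| < 1, and by the product rule its derivative is a real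
  combination of generators. This makes the class a candidate for
  \<open>test_tower_coinduct\<close>.\<close>

inductive_set bump_class :: "(real \<Rightarrow> complex) set" where
  base: "(\<lambda>t. of_real (flat m (1 + t) * flat n (1 - t))) \<in> bump_class"
| add: "f \<in> bump_class \<Longrightarrow> g \<in> bump_class \<Longrightarrow> (\<lambda>t. f t + g t) \<in> bump_class"
| scale: "f \<in> bump_class \<Longrightarrow> (\<lambda>t. of_real c * f t) \<in> bump_class"

lemma bump_tower:
  obtains D where "test_tower 1 D"
    "D 0 = (\<lambda>t. of_real (flat 0 (1 + t) * flat 0 (1 - t)))"
proof (rule test_tower_coinduct[of bump_class 1])
  fix f assume "f \<in> bump_class"
  then show "\<exists>f'\<in>bump_class. \<forall>t. (f has_vector_derivative f' t) (at t)"
  proof induction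
    case (base m n)
    let ?b = "\<lambda>m n t. complex_of_real (flat m (1 + t) * flat n (1 - t))"
    let ?f = "\<lambda>t. (?b (m+2) n t + of_real (- real m) * ?b (m+1) n t)
       + (of_real (-1) * ?b m (n + 2) t + of_real (real n) * ?b m (n + 1) t)"
    have "?f \<in> bump_class" by (intro bump_class.intros)
    moreover have "(?b m n has_vector_derivative ?f t) (at t)" for t
    proof -
      have 1: "((\<lambda>t. flat m (1 + t)) has_real_derivative
         (flat (m + 2) (1 + t) - real m * flat (m + 1) (1 + t)) * (0 + 1)) (at t)"
        by (rule DERIV_chain2[OF has_real_derivative_flat]) (auto intro!: derivative_eq_intros)
      have 2: "((\<lambda>t. flat n (1 - t)) has_real_derivative
         (flat (n + 2) (1 - t) - real n * flat (n + 1) (1 - t)) * (0 - 1)) (at t)"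
        by (rule DERIV_chain2[OF has_real_derivative_flat]) (auto intro!: derivative_eq_intros)
      have "(?b m n has_vector_derivative of_real
         ((flat (m + 2) (1 + t) - real m * flat (m + 1) (1 + t)) * (0 + 1) * flat n (1 - t) +
          (flat (n + 2) (1 - t) - real n * flat (n + 1) (1 - t)) * (0 - 1) * flat m (1 + t))) (at t)"
        by (rule has_vector_derivative_of_real[OF DERIV_mult[OF 1 2]])
      also have "of_real
         ((flat (m + 2) (1 + t) - real m * flat (m + 1) (1 + t)) * (0 + 1) * flat n (1 - t) +
          (flat (n + 2) (1 - t) - real n * flat (n + 1) (1 - t)) * (0 - 1) * flat m (1 + t)) = ?f t"
        unfolding of_real_mult of_real_add of_real_diff of_real_minus of_real_0 of_real_1 by algebra
      finally show ?thesis .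
    qed
    ultimately show ?case by (intro bexI[of _ ?f] allI)
  next
    case (add f g)
    then obtain f' g' where "f' \<in> bump_class" "g' \<in> bump_class"
      "\<And>t. (f has_vector_derivative f' t) (at t)" "\<And>t. (g has_vector_derivative g' t) (at t)"
      by blast
    then show ?case
      by (intro bexI[of _ "\<lambda>t. f' t + g' t"]) (auto intro: bump_class.intros has_vector_derivative_add)
  next
    case (scale f c)
    then obtain f' where "f' \<in> bump_class" "\<And>t. (f has_vector_derivative f' t) (at t)"
      by blast
    then show ?case
      by (intro bexI[of _ "\<lambda>t. of_real c * f' t"])
        (auto intro: bump_class.intros has_vector_derivative_mult_right)
  qed
next
  fix f t assume "f \<in> bump_class" "(1::real) \<le> \<bar>t\<bar>"
  then show "f t = 0"
    by induction (auto simp: flat_def abs_if split: if_splits)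
next
  show "(\<lambda>t. of_real (flat 0 (1 + t) * flat 0 (1 - t))) \<in> bump_class"
    by (rule bump_class.intros)
qed (use that in auto)

section \<open>Rescaled and normalised bumps\<close>

lemma has_vector_derivative_rescale:
  fixes f :: "real \<Rightarrow> complex"
  assumes "(f has_vector_derivative f') (at (c * t))"
  shows "((\<lambda>t. f (c * t)) has_vector_derivative (of_real c * f')) (at (t::real))"
proof -
  have "((\<lambda>t. c * t) has_real_derivative c) (at t)"
    by (auto intro!: derivative_eq_intros)
  from vector_diff_chain_at[OF this[unfolded has_real_derivative_iff_has_vector_derivative] assms]
  show ?thesis by (simp add: o_def scaleR_conv_of_real)
qed

lemma test_tower_rescale:
  assumes "test_tower A D" "c > 0"
  shows "test_tower (A / c) (\<lambda>n t. of_real (b * c ^ n) * D n (c * t))"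
  unfolding test_tower_def
proof (intro conjI allI impI)
  show "A / c > 0" using assms by (auto simp: test_tower_def)
  show "((\<lambda>t. of_real (b * c ^ n) * D n (c * t)) has_vector_derivative
      of_real (b * c ^ Suc n) * D (Suc n) (c * t)) (at t)" for n t
    using has_vector_derivative_mult_right[OF has_vector_derivative_rescale[OF test_towerD(2)[OF assms(1)]],
        of "of_real (b * c ^ n)" n c t] by (simp add: algebra_simps)
  show "of_real (b * c ^ n) * D n (c * t) = 0" if "A / c \<le> \<bar>t\<bar>" for n t
    using that assms by (subst test_towerD(3)[OF assms(1)]) (auto simp: field_simps abs_mult)
qed

text \<open>The last clause expresses that \<open>D 0\<close> is real and nonnegative. Together with
  the integral it makes the L1 norm equal to 1, which is what an approximate identity argument
  uses.\<close>

lemma mollifier: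
  assumes "e > 0"
  obtains D where "test_tower e D" "integral {-e..e} (D 0) = 1"
    "\<And>t. D 0 t = of_real (norm (D 0 t))"
proof -
  obtain B where B: "test_tower 1 B"
    "B 0 = (\<lambda>t. of_real (flat 0 (1 + t) * flat 0 (1 - t)))"
    using bump_tower .
  define r where "r t = flat 0 (1 + t / e) * flat 0 (1 - t / e)" for t
  have r0: "r t \<ge> 0" for t by (auto simp: r_def flat_def)
  have fc: "continuous_on UNIV (flat 0)"
    by (intro continuous_at_imp_continuous_on ballI DERIV_isCont[OF has_real_derivative_flat])
  then have rc: "continuous_on {-e..e} r"
    unfolding r_def using assms
    by (auto intro!: continuous_on_mult continuous_on_compose2[OF fc] continuous_intros)
  define I where "I = integral {-e..e} r"
  have "r 0 \<noteq> 0" by (auto simp: r_def flat_def)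
  then have "I \<noteq> 0"
    unfolding I_def using integral_eq_0_iff[OF rc] r0 assms by force
  moreover have "I \<ge> 0" unfolding I_def by (rule integral_nonneg) (use rc r0 integrable_continuous_interval in auto)
  ultimately have I: "I > 0" by auto
  define D where "D n t = of_real (1 / I * (1 / e) ^ n) * B n (1 / e * t)" for n t
  have D0: "D 0 t = of_real (r t / I)" for t
    by (simp add: D_def B(2) r_def)
  have "test_tower (1 / (1 / e)) D"
    unfolding D_def using assms by (intro test_tower_rescale B) auto
  moreover have "(r has_integral I) {-e..e}"
    unfolding I_def using rc integrable_continuous_interval integrable_integral by blast
  then have "((\<lambda>t. r t / I) has_integral (I / I)) {-e..e}"
    by (rule has_integral_divide)
  then have "(D 0 has_integral 1) {-e..e}"
    using has_integral_of_real I D0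
    by (metis (no_types, lifting) div_self ext less_numeral_extra(3) of_real_1)
  moreover have "D 0 t = of_real (norm (D 0 t))" for t
    using r0[of t] I by (simp add: D0 norm_divide)
  ultimately show thesis using that[of D] assms by (auto simp: integral_unique)
qed

notation upper_half_plane ("\<H>")

section \<open>Directional derivatives and convolution in the horizontal direction\<close>

text \<open>Differentiability is taken along a line only: the mollified \<open>u\<close> is
  differentiated separately in the directions 1 and \<i>, each time under the integral sign.\<close>

definition dir_deriv :: "complex \<Rightarrow> (complex \<Rightarrow> complex) \<Rightarrow> complex \<Rightarrow> complex \<Rightarrow> bool" where
  "dir_deriv e f d z \<longleftrightarrow> ((\<lambda>s. f (z + of_real s * e)) has_vector_derivative d) (at 0)"

text \<open>Such a set is an open union of horizontal lines, so a convolution in x at a point of S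
  evaluates f on S only, whatever the support of the mollifier. The instances are the two
  half-planes and the whole plane.\<close>

definition horizontal :: "complex set \<Rightarrow> bool" where
  "horizontal S \<longleftrightarrow> open S \<and> (\<forall>z\<in>S. \<forall>t. z - complex_of_real t \<in> S)"

definition conv :: "real \<Rightarrow> (real \<Rightarrow> complex) \<Rightarrow> (complex \<Rightarrow> complex) \<Rightarrow> complex \<Rightarrow> complex" where
  "conv A \<phi> f z = integral {-A..A} (\<lambda>t. f (z - of_real t) * \<phi> t)"

lemma dir_deriv_line:
  assumes "dir_deriv e f d (z + of_real s * e)"
  shows "((\<lambda>s. f (z + of_real s * e)) has_vector_derivative d) (at s)"
proof -
  have 1: "((\<lambda>r. r - s) has_vector_derivative 1) (at s)"
    by (auto intro!: derivative_eq_intros simp: has_real_derivative_iff_has_vector_derivative[symmetric])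
  have 2: "((\<lambda>r. f (z + of_real s * e + of_real r * e)) has_vector_derivative d) (at (s - s))"
    using assms by (simp add: dir_deriv_def)
  show ?thesis
    using vector_diff_chain_at[OF 1 2] by (simp add: o_def algebra_simps)
qed

lemma horizontal_upper_half_plane: "horizontal \<H>"
  by (auto simp: horizontal_def upper_half_plane_def open_halfspace_Im_gt)

lemma conv_integrand_continuous:
  fixes f :: "complex \<Rightarrow> complex"
  assumes S: "horizontal S" and f: "continuous_on S f" and \<phi>: "continuous_on {-A..A} \<phi>"
    and z: "z \<in> S"
  shows "continuous_on {-A..A} (\<lambda>t. f (z - of_real t) * \<phi> t)"
  using S z
  by (intro continuous_on_mult[OF _ \<phi>] continuous_on_compose2[OF f] continuous_intros)
     (auto simp: horizontal_def)

lemma conv_integrable: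
  fixes f :: "complex \<Rightarrow> complex"
  assumes "horizontal S" "continuous_on S f" "continuous_on {-A..A} \<phi>" "z \<in> S"
  shows "(\<lambda>t. f (z - of_real t) * \<phi> t) integrable_on {-A..A}"
  using conv_integrand_continuous[OF assms] by (rule integrable_continuous_interval)

lemma conv_continuous:
  assumes S: "horizontal S" and f: "continuous_on S f" and \<phi>: "continuous_on {-A..A} \<phi>"
  shows "continuous_on S (conv A \<phi> f)"
proof -
  have "continuous_on (S \<times> cbox (-A) A) (\<lambda>p. f (fst p - of_real (snd p)) * \<phi> (snd p))"
    using S by (intro continuous_on_mult continuous_on_compose2[OF f]
        continuous_on_compose2[OF \<phi>] continuous_intros) (auto simp: horizontal_def)
  then show ?thesis
    using integral_continuous_on_param[of S "-A" A "\<lambda>z t. f (z - of_real t) * \<phi> t"]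
    unfolding conv_def by (simp add: case_prod_beta)
qed

lemma conv_bound:
  assumes S: "horizontal S" and f: "continuous_on S f" and \<phi>: "continuous_on {-A..A} \<phi>"
    and "z \<in> S" and b: "\<And>t. t \<in> {-A..A} \<Longrightarrow> norm (f (z - of_real t)) \<le> B"
  shows "norm (conv A \<phi> f z) \<le> B * integral {-A..A} (\<lambda>t. norm (\<phi> t))"
proof -
  have "norm (conv A \<phi> f z) \<le> integral {-A..A} (\<lambda>t. B * norm (\<phi> t))"
    unfolding conv_def
    using conv_integrable[OF S f \<phi> \<open>z \<in> S\<close>] b \<phi>
    by (intro integral_norm_bound_integral)
       (auto simp: norm_mult intro!: mult_right_mono integrable_continuous_interval continuous_intros)
  then show ?thesis by simp
qed

text \<open>The relation \<open>eq\<close> is only asked for on the horizontal line through z, so c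
  and d may be values of functions of Im z. This is how y^\<alpha> passes through the
  convolution.\<close>

lemma conv_cong_add:
  assumes "horizontal S" "continuous_on S f" "continuous_on S g" "continuous_on {-A..A} \<phi>"
    and "z \<in> S"
    and eq: "\<And>t. h (z - of_real t) = c * f (z - of_real t) + d * g (z - of_real t)"
  shows "conv A \<phi> h z = c * conv A \<phi> f z + d * conv A \<phi> g z"
proof -
  note i = conv_integrable[OF assms(1) _ assms(4,5)]
  have "conv A \<phi> h z = integral {-A..A} (\<lambda>t. c * (f (z - of_real t) * \<phi> t) + d * (g (z - of_real t) * \<phi> t))"
    unfolding conv_def by (simp add: eq algebra_simps)
  also have "\<dots> = c * conv A \<phi> f z + d * conv A \<phi> g z"
    unfolding conv_def using i[OF assms(2)] i[OF assms(3)]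
    by (subst integral_add) (auto intro!: integrable_on_mult_right)
  finally show ?thesis .
qed

text \<open>The boundary terms vanish because a tower is 0 at -A and A. A horizontal derivative of f
  is traded for the next test function of the tower, so estimates of f against all test functions
  cover its horizontal derivatives too.\<close>

lemma conv_by_parts:
  assumes T: "test_tower A D" and S: "horizontal S"
    and f: "continuous_on S f" and f': "continuous_on S f'"
    and d: "\<And>w. w \<in> S \<Longrightarrow> dir_deriv 1 f (f' w) w" and z: "z \<in> S"
  shows "conv A (D n) f' z = conv A (D (Suc n)) f z"
proof -
  have A: "A > 0" using T by (auto simp: test_tower_def)
  have df: "((\<lambda>t. f (z - of_real t)) has_vector_derivative - f' (z - of_real t)) (at t)" for t
  proof -
    have 1: "((\<lambda>t. - t) has_vector_derivative -1) (at t)"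
      by (auto intro!: derivative_eq_intros simp: has_real_derivative_iff_has_vector_derivative[symmetric])
    have "dir_deriv 1 f (f' (z - of_real t)) (z - of_real t)"
      using S z by (intro d) (simp add: horizontal_def)
    then have "((\<lambda>s. f (z + of_real s * 1)) has_vector_derivative f' (z - of_real t)) (at (- t))"
      by (intro dir_deriv_line) simp
    from vector_diff_chain_at[OF 1 this] show ?thesis by (simp add: o_def)
  qed
  have "((\<lambda>t. f (z - of_real t) * D (Suc n) t + (- f' (z - of_real t)) * D n t) has_integral
      f (z - of_real A) * D n A - f (z - of_real (- A)) * D n (- A)) {-A..A}"
    using A by (intro fundamental_theorem_of_calculus has_vector_derivative_mult
        has_vector_derivative_at_within[OF df] has_vector_derivative_at_within[OF test_towerD(2)[OF T]]) auto
  then have "integral {-A..A} (\<lambda>t. f (z - of_real t) * D (Suc n) t - f' (z - of_real t) * D n t) = 0"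
    using test_towerD(3)[OF T] A by (simp add: integral_unique)
  then show ?thesis
    unfolding conv_def
    using conv_integrable[OF S f test_tower_continuous[OF T] z, of "Suc n"]
      conv_integrable[OF S f' test_tower_continuous[OF T] z, of n]
    by (simp add: integral_diff)
qed

lemma conv_dir_deriv:
  assumes S: "horizontal S" and f: "continuous_on S f" and f': "continuous_on S f'"
    and \<phi>: "continuous_on {-A..A} \<phi>"
    and d: "\<And>w. w \<in> S \<Longrightarrow> dir_deriv e f (f' w) w" and z: "z \<in> S"
  shows "dir_deriv e (conv A \<phi> f) (conv A \<phi> f' z) z"
proof -
  \<comment> \<open>In direction \<i> the line through z may leave S, so the parameter s is confined
    to a ball on which it stays inside.\<close>
  have "open ((\<lambda>s. z + of_real s * e) -` S)"
    using S by (intro open_vimage continuous_intros) (auto simp: horizontal_def)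
  then obtain r where r: "r > 0" "ball 0 r \<subseteq> (\<lambda>s. z + of_real s * e) -` S"
    using z by (force simp: open_contains_ball)
  define U where "U = ball (0::real) r"
  have inS: "z + of_real s * e - of_real t \<in> S" if "s \<in> U" for s t
    using r that S unfolding U_def horizontal_def by auto
  have sh: "dir_deriv e (\<lambda>z. f (z - of_real t)) d w" if "dir_deriv e f d (w - of_real t)" for d w t
    using that unfolding dir_deriv_def by (simp add: algebra_simps)
  have "((\<lambda>s. integral (cbox (-A) A) (\<lambda>t. f (z + of_real s * e - of_real t) * \<phi> t))
     has_vector_derivative integral (cbox (-A) A) (\<lambda>t. f' (z + of_real 0 * e - of_real t) * \<phi> t)) (at 0 within U)"
  proof (rule leibniz_rule_vector_derivative)
    show "((\<lambda>s. f (z + of_real s * e - of_real t) * \<phi> t) has_vector_derivative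
        f' (z + of_real s * e - of_real t) * \<phi> t) (at s within U)" if "s \<in> U" for s t
    proof -
      have "dir_deriv e (\<lambda>z. f (z - of_real t)) (f' (z + of_real s * e - of_real t)) (z + of_real s * e)"
        by (rule sh[OF d[OF inS[OF that]]])
      from dir_deriv_line[OF this] show ?thesis
        by (rule has_vector_derivative_mult_left[OF has_vector_derivative_at_within])
    qed
    show "(\<lambda>t. f (z + of_real s * e - of_real t) * \<phi> t) integrable_on cbox (-A) A" if "s \<in> U" for s
      using conv_integrable[OF S f \<phi>, of "z + of_real s * e"] inS[OF that, of 0] by simp
    have "continuous_on (U \<times> cbox (-A) A) (\<lambda>p. f' (z + of_real (fst p) * e - of_real (snd p)) * \<phi> (snd p))"
      using inS by (intro continuous_on_mult continuous_on_compose2[OF f']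
        continuous_on_compose2[OF \<phi>] continuous_intros) auto
    then show "continuous_on (U \<times> cbox (-A) A)
      (\<lambda>(s, t). f' (z + of_real s * e - of_real t) * \<phi> t)"
      by (simp add: case_prod_beta)
  qed (use r in \<open>auto simp: U_def\<close>)
  then show ?thesis
    using r at_within_open[of "0::real" U] unfolding dir_deriv_def conv_def U_def by simp
qed

section \<open>Convolution as a pairing with translated test functions\<close>

lemma test_tower_bounded:
  assumes "test_tower A D"
  obtains M where "M > 0" "\<And>t. norm (D n t) \<le> M"
proof -
  have "compact (D n ` {-A..A})"
    by (intro compact_continuous_image test_tower_continuous[OF assms]) auto
  then have "bounded (D n ` {-A..A})" by (rule compact_imp_bounded)
  then obtain M where M: "M > 0" "\<And>t. t \<in> {-A..A} \<Longrightarrow> norm (D n t) \<le> M"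
    unfolding bounded_pos by auto
  have "norm (D n t) \<le> M" for t
  proof (cases "A \<le> \<bar>t\<bar>")
    case True
    then have "D n t = 0" by (rule test_towerD(3)[OF assms])
    then show ?thesis using M(1) by simp
  next
    case False
    then show ?thesis by (intro M(2)) auto
  qed
  then show thesis by (rule that[OF M(1)])
qed

text \<open>The substitution s = x - t connects the Lebesgue integral over the whole line, in which
  the boundary value is phrased, with the integral over the support that \<open>conv\<close>
  uses.\<close>

lemma pairing_eq_conv:
  assumes T: "test_tower A D" and u: "continuous_on \<H> u" and "y > 0"
  shows "integrable lborel (\<lambda>s. u (Complex s y) * D 0 (x - s))"
    "(\<integral>s. u (Complex s y) * D 0 (x - s) \<partial>lborel) = conv A (D 0) u (Complex x y)"
proof -
  define g where "g t = u (Complex (x - t) y) * D 0 t" for t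
  have g: "g t = u (Complex x y - of_real t) * D 0 t" for t
    by (simp add: g_def complex_of_real_def complex_diff)
  have gc: "continuous_on {-A..A} g"
    unfolding g using T u \<open>y > 0\<close>
    by (intro conv_integrand_continuous[OF horizontal_upper_half_plane])
       (auto simp: upper_half_plane_def intro: test_tower_continuous)
  have ind: "indicator {-A..A} t *\<^sub>R g t = g t" for t
  proof (cases "t \<in> {-A..A}")
    case False
    then have "A \<le> \<bar>t\<bar>" by auto
    then have "D 0 t = 0" by (rule test_towerD(3)[OF T])
    then show ?thesis by (simp add: g_def)
  qed simp
  have si: "set_integrable lborel {-A..A} g"
    using gc by (intro borel_integrable_atLeastAtMost')
  have gi: "integrable lborel g"
    using si unfolding set_integrable_def ind .
  have "(LINT t:{-A..A}|lborel. g t) = integral {-A..A} g"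
    by (rule set_borel_integral_eq_integral[OF si])
  then have gI: "(\<integral>t. g t \<partial>lborel) = conv A (D 0) u (Complex x y)"
    unfolding set_lebesgue_integral_def ind conv_def g[symmetric] .
  have eq: "(\<lambda>s. u (Complex s y) * D 0 (x - s)) = (\<lambda>s. g (x + (-1) * s))"
    by (simp add: g_def)
  show "integrable lborel (\<lambda>s. u (Complex s y) * D 0 (x - s))"
    unfolding eq by (rule lborel_integrable_real_affine[OF gi]) simp
  show "(\<integral>s. u (Complex s y) * D 0 (x - s) \<partial>lborel) = conv A (D 0) u (Complex x y)"
  proof -
    have "(\<integral>t. g t \<partial>lborel) = \<bar>- 1\<bar> *\<^sub>R (\<integral>s. g (x + (- 1) * s) \<partial>lborel)"
      by (rule lborel_integral_real_affine) simp
    then show ?thesis unfolding eq gI by simp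
  qed
qed

text \<open>The function s \<mapsto> D 0 (x - s) is what \<open>u\<close> on the line of height y is
  paired with to give the convolution at x + \<i>y. Each differentiation of it contributes a
  sign.\<close>

lemma test_tower_reflect:
  assumes "test_tower A D"
  shows "test_tower (A + \<bar>x\<bar>) (\<lambda>n s. (-1) ^ n * D n (x - s))"
proof -
  have "((\<lambda>s. D n (x - s)) has_vector_derivative - D (Suc n) (x - s)) (at s)" for n s
  proof -
    have 1: "((\<lambda>s. x - s) has_vector_derivative -1) (at s)"
      by (auto intro!: derivative_eq_intros simp: has_real_derivative_iff_has_vector_derivative[symmetric])
    from vector_diff_chain_at[OF 1 test_towerD(2)[OF assms]] show ?thesis by (simp add: o_def)
  qed
  then have "((\<lambda>s. (-1) ^ n * D n (x - s)) has_vector_derivative (-1) ^ n * - D (Suc n) (x - s)) (at s)" for n s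
    by (rule has_vector_derivative_mult_right)
  then show ?thesis
    using assms by (auto simp: test_tower_def)
qed

lemma conv_tendsto_0:
  assumes "test_tower A D" "continuous_on \<H> u" "zero_distributional_boundary_value u"
  shows "((\<lambda>y. conv A (D 0) u (Complex x y)) \<longlongrightarrow> 0) (at_right 0)"
proof -
  have "test_function (\<lambda>s. D 0 (x - s))"
    using test_function_if_tower[OF test_tower_reflect[OF assms(1)], of 0] by simp
  then have "((\<lambda>y. \<integral>s. u (Complex s y) * D 0 (x - s) \<partial>lborel) \<longlongrightarrow> 0) (at_right 0)"
    using assms(3) unfolding zero_distributional_boundary_value_def by blast
  then show ?thesis
    by (rule Lim_transform_eventually)
      (auto simp: eventually_at_filter pairing_eq_conv[OF assms(1,2)])
qed

section \<open>A uniform boundedness principle\<close>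

lemma has_vector_derivative_series:
  fixes f f' :: "nat \<Rightarrow> real \<Rightarrow> complex"
  assumes d: "\<And>n x. (f n has_vector_derivative f' n x) (at x)"
    and b: "\<And>n x. norm (f n x) \<le> K n" "\<And>n x. norm (f' n x) \<le> K n" and K: "summable K"
  shows "((\<lambda>x. \<Sum>n. f n x) has_vector_derivative (\<Sum>n. f' n x)) (at x)"
proof -
  have ul: "uniform_limit UNIV (\<lambda>n x. \<Sum>i<n. f' i x) (\<lambda>x. \<Sum>i. f' i x) sequentially"
    by (rule Weierstrass_m_test[OF _ K]) (use b in auto)
  have "\<exists>g. \<forall>x\<in>UNIV. (\<lambda>n. f n x) sums g x \<and>
      (g has_derivative (\<lambda>h. h *\<^sub>R (\<Sum>i. f' i x))) (at x within UNIV)"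
  proof (rule has_derivative_series[where f' = "\<lambda>n x h. h *\<^sub>R f' n x"])
    show "(f n has_derivative (\<lambda>h. h *\<^sub>R f' n x)) (at x within UNIV)" for n x
      using d[of n x] by (simp add: has_vector_derivative_def)
    show "\<forall>\<^sub>F n in sequentially. \<forall>x\<in>UNIV. \<forall>h.
        norm ((\<Sum>i<n. h *\<^sub>R f' i x) - h *\<^sub>R (\<Sum>i. f' i x)) \<le> e * norm h" if "e > 0" for e
      using uniform_limitD[OF ul that]
    proof (rule eventually_mono, intro ballI allI)
      fix n x h assume "\<forall>x\<in>UNIV. dist (\<Sum>i<n. f' i x) (\<Sum>i. f' i x) < e"
      then have "norm ((\<Sum>i<n. f' i x) - (\<Sum>i. f' i x)) \<le> e"
        by (auto simp: dist_norm intro: less_imp_le)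
      then have "\<bar>h\<bar> * norm ((\<Sum>i<n. f' i x) - (\<Sum>i. f' i x)) \<le> e * norm h"
        by (subst mult.commute[of e]) (simp add: mult_left_mono)
      then show "norm ((\<Sum>i<n. h *\<^sub>R f' i x) - h *\<^sub>R (\<Sum>i. f' i x)) \<le> e * norm h"
        by (simp add: scaleR_sum_right[symmetric] scaleR_diff_right[symmetric] del: scaleR_conv_of_real)
    qed
    show "(\<lambda>n. f n 0) sums (\<Sum>n. f n 0)"
      by (rule summable_sums[OF summable_comparison_test'[OF K, of 0]]) (use b in auto)
  qed auto
  then obtain g where g: "\<And>x. (\<lambda>n. f n x) sums g x"
    "\<And>x. (g has_derivative (\<lambda>h. h *\<^sub>R (\<Sum>i. f' i x))) (at x)"
    by auto
  have "g = (\<lambda>x. \<Sum>n. f n x)"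
    using sums_unique[OF g(1)] by auto
  then show ?thesis using g(2) by (simp add: has_vector_derivative_def)
qed

text \<open>In the uniform boundedness argument this takes the part of completeness of the space of
  test functions. Bounded centres keep the support bounded, and summable coefficients allow termwise
  differentiation to every order because each \<open>D k\<close> is bounded.\<close>

lemma test_function_superposition:
  assumes T: "test_tower A D" and c: "summable (\<lambda>n. \<bar>c n\<bar>)" and x: "\<And>n. \<bar>x n\<bar> \<le> R"
  shows "test_function (\<lambda>s. \<Sum>n. of_real (c n) * D 0 (x n - s))"
proof -
  define E where "E k s = (\<Sum>n. of_real (c n) * ((-1) ^ k * D k (x n - s)))" for k s
  have Tn: "test_tower (A + \<bar>x n\<bar>) (\<lambda>k s. (-1) ^ k * D k (x n - s))" for n
    by (rule test_tower_reflect[OF T])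
  have "(E k has_vector_derivative E (Suc k) s) (at s)" for k s
  proof -
    obtain M1 where M1: "M1 > 0" "\<And>t. norm (D k t) \<le> M1" using test_tower_bounded[OF T] by blast
    obtain M2 where M2: "M2 > 0" "\<And>t. norm (D (Suc k) t) \<le> M2" using test_tower_bounded[OF T] by blast
    have "((\<lambda>s. of_real (c n) * ((-1) ^ k * D k (x n - s))) has_vector_derivative
        of_real (c n) * ((-1) ^ Suc k * D (Suc k) (x n - s))) (at s)" for n s
      by (rule has_vector_derivative_mult_right[OF test_towerD(2)[OF Tn]])
    then show ?thesis unfolding E_def
    proof (rule has_vector_derivative_series)
      show "norm (of_real (c n) * ((-1) ^ k * D k (x n - s))) \<le> \<bar>c n\<bar> * (M1 + M2)" for n s
        using M1(2)[of "x n - s"] M2(1) by (auto simp: norm_mult norm_power intro!: mult_left_mono)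
      show "norm (of_real (c n) * ((-1) ^ Suc k * D (Suc k) (x n - s))) \<le> \<bar>c n\<bar> * (M1 + M2)" for n s
        using M2(2)[of "x n - s"] M1(1) by (auto simp: norm_mult norm_power intro!: mult_left_mono)
      show "summable (\<lambda>n. \<bar>c n\<bar> * (M1 + M2))" using c by (rule summable_mult2)
    qed
  qed
  moreover have "E 0 s = 0" if "A + R < \<bar>s\<bar>" for s
  proof -
    have "D 0 (x n - s) = 0" for n
      by (rule test_towerD(3)[OF T]) (use x[of n] that in linarith)
    then show ?thesis by (simp add: E_def)
  qed
  ultimately have "test_function (E 0)"
    by (rule test_function_if_derivatives)
  moreover have "E 0 = (\<lambda>s. \<Sum>n. of_real (c n) * D 0 (x n - s))" by (simp add: E_def fun_eq_iff)
  ultimately show ?thesis by simp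
qed

text \<open>At a fixed height y > 0 the function \<open>u\<close> is bounded by some K on the common
  support, so the coefficients dominate the series and sum and integral may be exchanged.\<close>

lemma pairing_superposition:
  assumes T: "test_tower A D" and c: "summable (\<lambda>n. \<bar>c n\<bar>)" and x: "\<And>n. \<bar>x n\<bar> \<le> R"
    and u: "continuous_on \<H> u" and y: "y > 0"
  shows "(\<integral>s. u (Complex s y) * (\<Sum>n. of_real (c n) * D 0 (x n - s)) \<partial>lborel) =
     (\<Sum>n. of_real (c n) * conv A (D 0) u (Complex (x n) y))"
proof -
  define g where "g n s = of_real (c n) * (u (Complex s y) * D 0 (x n - s))" for n s
  obtain M where M: "M > 0" "\<And>t. norm (D 0 t) \<le> M" using test_tower_bounded[OF T] by blast
  have A: "A > 0" using T by (simp add: test_tower_def)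
  have R: "R \<ge> 0" using x[of 0] by linarith
  define B where "B = A + R"
  have "continuous_on {-B..B} (\<lambda>s. u (Complex s y))"
    by (rule continuous_on_compose2[OF u])
      (use y in \<open>auto simp: upper_half_plane_def Complex_eq intro!: continuous_intros\<close>)
  then have "bounded ((\<lambda>s. u (Complex s y)) ` {-B..B})"
    by (intro compact_imp_bounded compact_continuous_image) auto
  then obtain K where K: "K > 0" "\<And>s. s \<in> {-B..B} \<Longrightarrow> norm (u (Complex s y)) \<le> K"
    unfolding bounded_pos by auto
  have gi: "integrable lborel (g n)" for n
    unfolding g_def by (intro integrable_mult_right pairing_eq_conv(1)[OF T u y])
  have gI: "(\<integral>s. g n s \<partial>lborel) = of_real (c n) * conv A (D 0) u (Complex (x n) y)" for n
    unfolding g_def by (simp add: pairing_eq_conv(2)[OF T u y] pairing_eq_conv(1)[OF T u y])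
  have gb: "norm (g n s) \<le> \<bar>c n\<bar> * (K * M) * indicator {-B..B} s" for n s
  proof (cases "s \<in> {-B..B}")
    case True
    have "norm (u (Complex s y)) * norm (D 0 (x n - s)) \<le> K * M"
      by (intro mult_mono K(2) M(2) True) (use K in auto)
    then show ?thesis using True by (simp add: g_def norm_mult mult_left_mono)
  next
    case False
    have "D 0 (x n - s) = 0"
      by (rule test_towerD(3)[OF T]) (use x[of n] False in \<open>auto simp: B_def\<close>)
    then show ?thesis using False by (simp add: g_def)
  qed
  have ii: "integrable lborel (indicator {-B..B} :: real \<Rightarrow> real)"
    by (rule integrable_real_indicator) (auto simp: emeasure_lborel_Icc_eq)
  have "(\<integral>s. norm (g n s) \<partial>lborel) \<le> (\<integral>s. \<bar>c n\<bar> * (K * M) * indicator {-B..B} s \<partial>lborel)" for n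
    by (intro integral_mono integrable_norm gi gb integrable_mult_right ii)
  then have gn: "(\<integral>s. norm (g n s) \<partial>lborel) \<le> \<bar>c n\<bar> * (K * M * (2 * B))" for n
    using A R by (simp add: B_def mult.assoc)
  have "(\<integral>s. (\<Sum>n. g n s) \<partial>lborel) = (\<Sum>n. \<integral>s. g n s \<partial>lborel)"
  proof (rule integral_suminf[OF gi])
    show "AE s in lborel. summable (\<lambda>n. norm (g n s))"
    proof (rule AE_I2)
      fix s
      show "summable (\<lambda>n. norm (g n s))"
        by (rule summable_comparison_test'[of "\<lambda>n. \<bar>c n\<bar> * (K * M) * indicator {-B..B} s" 0])
          (auto intro!: summable_mult2 c simp: gb)
    qed
    show "summable (\<lambda>n. \<integral>s. norm (g n s) \<partial>lborel)"
      by (rule summable_comparison_test'[of "\<lambda>n. \<bar>c n\<bar> * (K * M * (2 * B))" 0])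
        (auto intro!: summable_mult2 c simp: gn integral_nonneg_AE)
  qed
  moreover have "(\<Sum>n. g n s) = u (Complex s y) * (\<Sum>n. of_real (c n) * D 0 (x n - s))" for s
  proof -
    have "summable (\<lambda>n. of_real (c n) * D 0 (x n - s))"
      by (rule summable_comparison_test'[of "\<lambda>n. \<bar>c n\<bar> * M" 0])
          (auto intro!: summable_mult2 c mult_left_mono M simp: norm_mult)
    then show ?thesis
      by (subst suminf_mult[symmetric]) (auto simp: g_def algebra_simps)
  qed
  ultimately show ?thesis by (simp add: gI)
qed

text \<open>Sokal's elementary proof of the Banach--Steinhaus theorem: of \<open>S + h\<close> and \<open>S - h\<close>, one has
  norm at least \<open>norm h\<close>.\<close>

lemma sign_choice:
  fixes h :: "nat \<Rightarrow> 'a \<Rightarrow> complex"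
  obtains \<sigma> :: "nat \<Rightarrow> real" where "\<And>n. \<bar>\<sigma> n\<bar> = 1"
    "\<And>n. norm (h n (y n)) \<le> norm (\<Sum>i\<le>n. of_real (\<sigma> i) * h i (y n))"
proof -
  define P where "P n S \<longleftrightarrow> (n = 0 \<longrightarrow> S = (\<lambda>_. 0))" for n :: nat and S :: "'a \<Rightarrow> complex"
  define Q where "Q n S S' \<longleftrightarrow> (\<exists>\<sigma>::real. \<bar>\<sigma>\<bar> = 1 \<and> S' = (\<lambda>z. S z + of_real \<sigma> * h n z) \<and>
    norm (h n (y n)) \<le> norm (S' (y n)))" for n :: nat and S S' :: "'a \<Rightarrow> complex"
  have ex: "\<exists>\<sigma>::real. \<bar>\<sigma>\<bar> = 1 \<and> norm b \<le> norm (a + of_real \<sigma> * b)" for a b :: complex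
  proof (rule ccontr)
    assume *: "\<not> ?thesis"
    have "norm (a + b) < norm b" "norm (a - b) < norm b"
      using *[unfolded not_ex, rule_format, of 1] *[unfolded not_ex, rule_format, of "-1"] by auto
    then have "norm ((a + b) - (a - b)) < 2 * norm b"
      using norm_triangle_ineq4[of "a + b" "a - b"] by linarith
    moreover have "(a + b) - (a - b) = 2 * b" by simp
    ultimately show False by (simp add: norm_mult)
  qed
  have "\<exists>S'. P (Suc n) S' \<and> Q n S S'" for n S
  proof -
    obtain \<sigma> :: real where "\<bar>\<sigma>\<bar> = 1" "norm (h n (y n)) \<le> norm (S (y n) + of_real \<sigma> * h n (y n))"
      using ex by blast
    then show ?thesis
      by (intro exI[of _ "\<lambda>z. S z + of_real \<sigma> * h n z"]) (auto simp: P_def Q_def)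
  qed
  then obtain S where S: "\<And>n. P n (S n)" "\<And>n. Q n (S n) (S (Suc n))"
    using dependent_nat_choice[of P Q] by (auto simp: P_def)
  then obtain \<sigma> :: "nat \<Rightarrow> real" where \<sigma>: "\<And>n. \<bar>\<sigma> n\<bar> = 1"
    "\<And>n. S (Suc n) = (\<lambda>z. S n z + of_real (\<sigma> n) * h n z)"
    "\<And>n. norm (h n (y n)) \<le> norm (S (Suc n) (y n))"
    unfolding Q_def by metis
  have "S (Suc n) z = (\<Sum>i\<le>n. of_real (\<sigma> i) * h i z)" for n z
    by (induction n) (use S(1)[of 0] in \<open>simp_all add: \<sigma>(2) P_def\<close>)
  then show thesis using that[of \<sigma>] \<sigma> by simp
qed

text \<open>A gliding hump. If the convolutions were unbounded, pick points x n + \<i> y n with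
  values above 4^n and superpose the corresponding test functions with coefficients of modulus
  3^(-n). With suitable signs the pairing L of \<open>u\<close> with the superposition has size at
  least (4/3)^n / 2 at height y n. But L tends to 0 at the axis and is bounded on [\<delta>, Y] by
  compactness, so it is bounded on (0, Y]; the heights y n may lie anywhere in it.\<close>

lemma boundary_bounded:
  assumes T: "test_tower A D" and u: "continuous_on \<H> u"
    and z: "zero_distributional_boundary_value u"
  obtains C where "\<And>x y. \<bar>x\<bar> \<le> R \<Longrightarrow> 0 < y \<Longrightarrow> y \<le> Y \<Longrightarrow> norm (conv A (D 0) u (Complex x y)) \<le> C"
proof (cases "R \<ge> 0 \<and> Y > 0")
  case False
  show thesis
  proof (rule that[of 0])
    fix x y assume "\<bar>x\<bar> \<le> R" "0 < y" "y \<le> Y"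
    with False show "norm (conv A (D 0) u (Complex x y)) \<le> 0" by linarith
  qed
next
  case RY: True
  define U where "U x y = conv A (D 0) u (Complex x y)" for x y
  have contU: "continuous_on \<H> (conv A (D 0) u)"
    by (rule conv_continuous[OF horizontal_upper_half_plane u test_tower_continuous[OF T]])
  have contx: "continuous_on {-R..R} (\<lambda>x. norm (U x y))" if "y > 0" for y
    unfolding U_def by (intro continuous_on_norm continuous_on_compose2[OF contU])
      (use that in \<open>auto simp: upper_half_plane_def Complex_eq intro!: continuous_intros\<close>)
  \<comment> \<open>Choosing x n as a maximiser at its height bounds the tail terms of the series at
    height y n, whose centres differ from x n, by the n-th value.\<close>
  have top: "\<exists>x. \<bar>x\<bar> \<le> R \<and> (\<forall>x'. \<bar>x'\<bar> \<le> R \<longrightarrow> norm (U x' y) \<le> norm (U x y))" if "y > 0" for y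
  proof -
    have "compact {-R..R}" "{-R..R} \<noteq> {}" using RY by auto
    from continuous_attains_sup[OF this contx[OF that]] show ?thesis
      by (metis abs_le_iff atLeastAtMost_iff minus_le_iff)
  qed
  have "\<exists>C. \<forall>x y. \<bar>x\<bar> \<le> R \<longrightarrow> 0 < y \<longrightarrow> y \<le> Y \<longrightarrow> norm (U x y) \<le> C"
  proof (rule ccontr)
    assume "\<not> ?thesis"
    then have unb: "\<exists>x y. \<bar>x\<bar> \<le> R \<and> 0 < y \<and> y \<le> Y \<and> norm (U x y) > C" for C
      by (auto simp: not_le)
    have "\<exists>x y. \<bar>x\<bar> \<le> R \<and> 0 < y \<and> y \<le> Y \<and> norm (U x y) > 4 ^ n \<and>
       (\<forall>x'. \<bar>x'\<bar> \<le> R \<longrightarrow> norm (U x' y) \<le> norm (U x y))" for n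
      using unb[of "4 ^ n"] top by (metis order_less_le_trans)
    then obtain x y where xy: "\<And>n. \<bar>x n\<bar> \<le> R" "\<And>n. 0 < y n" "\<And>n. y n \<le> Y"
        "\<And>n::nat. norm (U (x n) (y n)) > 4 ^ n"
        "\<And>n x'. \<bar>x'\<bar> \<le> R \<Longrightarrow> norm (U x' (y n)) \<le> norm (U (x n) (y n))"
      by metis
    obtain \<sigma> :: "nat \<Rightarrow> real" where \<sigma>: "\<And>n. \<bar>\<sigma> n\<bar> = 1"
      "\<And>n. norm (of_real ((1/3) ^ n) * U (x n) (y n)) \<le>
         norm (\<Sum>i\<le>n. of_real (\<sigma> i) * (of_real ((1/3) ^ i) * U (x i) (y n)))"
      by (rule sign_choice[of "\<lambda>n y. of_real ((1/3) ^ n) * U (x n) y" y]) (rule that)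
    define c where "c n = \<sigma> n * (1/3) ^ n" for n
    have ac: "\<bar>c n\<bar> = (1/3) ^ n" for n by (simp add: c_def abs_mult \<sigma>(1))
    have c: "summable (\<lambda>n. \<bar>c n\<bar>)" unfolding ac by (rule summable_geometric) simp
    define L where "L y = (\<Sum>n. of_real (c n) * U (x n) y)" for y
    have "((\<lambda>y. \<integral>s. u (Complex s y) * (\<Sum>n. of_real (c n) * D 0 (x n - s)) \<partial>lborel) \<longlongrightarrow> 0) (at_right 0)"
      by (rule z[unfolded zero_distributional_boundary_value_def, rule_format,
            OF test_function_superposition[OF T c xy(1)]])
    then have L0: "(L \<longlongrightarrow> 0) (at_right 0)"
      by (rule Lim_transform_eventually)
        (auto simp: eventually_at_filter pairing_superposition[OF T c xy(1) u] L_def U_def)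
    then have "\<forall>\<^sub>F y in at_right 0. norm (L y) < 1"
      using tendstoD[OF L0, of 1] by simp
    then obtain \<delta> where \<delta>: "\<delta> > 0" "\<And>y. 0 < y \<Longrightarrow> y < \<delta> \<Longrightarrow> norm (L y) < 1"
      unfolding eventually_at_right_field by auto
    have "compact (cbox (Complex (-R) \<delta>) (Complex R Y))" by auto
    moreover have "cbox (Complex (-R) \<delta>) (Complex R Y) \<subseteq> \<H>"
      using \<delta>(1) by (auto simp: upper_half_plane_def in_cbox_complex_iff)
    ultimately have "bounded (conv A (D 0) u ` cbox (Complex (-R) \<delta>) (Complex R Y))"
      using contU continuous_on_subset by (intro compact_imp_bounded compact_continuous_image) auto
    then obtain K where K: "K > 0" "\<And>w. w \<in> cbox (Complex (-R) \<delta>) (Complex R Y) \<Longrightarrow> norm (conv A (D 0) u w) \<le> K"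
      unfolding bounded_pos by auto
    have L2: "norm (L y) \<le> (3 / 2) * K" if "\<delta> \<le> y" "y \<le> Y" for y
    proof -
      have le: "norm (of_real (c n) * U (x n) y) \<le> (1/3) ^ n * K" for n
        using K(2)[of "Complex (x n) y"] xy(1)[of n] that
        by (auto simp: norm_mult ac U_def in_cbox_complex_iff abs_le_iff intro!: mult_left_mono)
      have geo: "(\<lambda>n. (1/3) ^ n * K) sums (1 / (1 - 1/3) * K)"
        by (intro sums_mult2 geometric_sums) simp
      have "norm (L y) \<le> (\<Sum>n. (1/3) ^ n * K)"
        unfolding L_def by (rule norm_suminf_le[OF le sums_summable[OF geo]])
      then show ?thesis using sums_unique[OF geo] by simp
    qed
    have L1: "norm (L (y n)) \<ge> (4/3) ^ n / 2" for n
    proof -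
      define B where "B = norm (U (x n) (y n))"
      have B: "B \<ge> 4 ^ n" using xy(4)[of n] by (simp add: B_def)
      have le: "norm (of_real (c i) * U (x i) (y n)) \<le> (1/3) ^ i * B" for i
        using xy(5)[OF xy(1)] by (auto simp: norm_mult ac B_def intro!: mult_left_mono)
      have geo: "(\<lambda>i. (1/3) ^ i * ((1/3) ^ Suc n * B)) sums (1 / (1 - 1/3) * ((1/3) ^ Suc n * B))"
        by (intro sums_mult2 geometric_sums) simp
      have sm: "summable (\<lambda>i. of_real (c i) * U (x i) (y n))"
        by (rule summable_comparison_test'[of "\<lambda>i. (1/3) ^ i * B" 0])
           (use le in \<open>auto intro!: summable_mult2 summable_geometric\<close>)
      \<comment> \<open>With ratio 1/3 the terms after n add up to at most half of (1/3)^n B, while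
        the partial sum up to n has at least this size; half of it survives.\<close>
      have "norm (\<Sum>i. of_real (c (i + Suc n)) * U (x (i + Suc n)) (y n)) \<le>
          (\<Sum>i. (1/3) ^ i * ((1/3) ^ Suc n * B))"
        using le[of "_ + Suc n"] geo by (intro norm_suminf_le) (auto simp: sums_iff power_add mult_ac)
      also have "\<dots> = (1/3) ^ n * B / 2" using geo by (simp add: sums_iff)
      finally have tail: "norm (\<Sum>i. of_real (c (i + Suc n)) * U (x (i + Suc n)) (y n)) \<le> (1/3) ^ n * B / 2" .
      have head: "norm (\<Sum>i<Suc n. of_real (c i) * U (x i) (y n)) \<ge> (1/3) ^ n * B"
        using \<sigma>(2)[of n] unfolding lessThan_Suc_atMost
        by (simp add: c_def B_def norm_mult norm_power norm_divide mult_ac)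
      have Leq: "L (y n) = (\<Sum>i. of_real (c (i + Suc n)) * U (x (i + Suc n)) (y n)) + (\<Sum>i<Suc n. of_real (c i) * U (x i) (y n))"
        unfolding L_def by (rule suminf_split_initial_segment[OF sm])
      have half: "norm (t + s) \<ge> p - p / 2" if "norm t \<le> p / 2" "norm s \<ge> p" for t s :: complex and p
        using norm_diff_ineq[of s t] that by (simp add: add.commute)
      have "norm (L (y n)) \<ge> (1/3) ^ n * B - (1/3) ^ n * B / 2"
        unfolding Leq by (rule half[OF tail head])
      moreover have "(1/3) ^ n * B \<ge> (1/3) ^ n * 4 ^ n" by (intro mult_left_mono B) auto
      moreover have "(1/3) ^ n * 4 ^ n = (4/3::real) ^ n" by (simp add: power_mult_distrib[symmetric])
      ultimately show ?thesis by linarith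
    qed
    have Lb: "norm (L (y n)) \<le> 1 + (3 / 2) * K" for n
    proof (cases "y n < \<delta>")
      case True
      then show ?thesis using \<delta>(2)[of "y n"] xy(2)[of n] K(1) by linarith
    next
      case False
      then show ?thesis using L2[of "y n"] xy(3)[of n] by linarith
    qed
    obtain n :: nat where n: "2 * (1 + (3 / 2) * K) < (4 / 3) ^ n"
      using real_arch_pow[of "4 / 3"] by auto
    have "(4 / 3) ^ n \<le> 2 * norm (L (y n))"
      using mult_left_mono[OF L1[of n], of 2] by (simp only: times_divide_eq_right) simp
    from order.strict_trans2[OF n this] show False using Lb[of n] by simp
  qed
  then obtain C where "\<And>x y. \<bar>x\<bar> \<le> R \<Longrightarrow> 0 < y \<Longrightarrow> y \<le> Y \<Longrightarrow> norm (U x y) \<le> C"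
    by auto
  then show thesis by (rule that[unfolded U_def[symmetric]])
qed

section \<open>Growth estimates for the mollified function\<close>

lemma has_vector_derivative_powr:
  assumes "t > 0"
  shows "((\<lambda>t. t powr p) has_vector_derivative p * t powr (p - 1)) (at t)"
  using has_real_derivative_powr[OF assms, of p]
  by (simp add: has_real_derivative_iff_has_vector_derivative)

text \<open>A derivative is bounded through the function and the next derivative, in the manner of
  Landau. With \<rho> frozen at a, the increment of f over the window is -2\<i> \<rho>(a) times the
  integral of t^\<alpha>, up to an error of 2 B' times this integral; dividing by it gives the
  claim. The mean value theorem writes the integral as \<xi>^\<alpha>, which postpones any case
  distinction on the sign of \<alpha>.\<close>

lemma window_estimate:
  fixes f \<rho> \<rho>' :: "real \<Rightarrow> complex"
  assumes a: "a > 0" and \<alpha>: "\<alpha> > -1"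
    and f: "\<And>t. a \<le> t \<Longrightarrow> t \<le> a + 1 \<Longrightarrow> (f has_vector_derivative - 2 * \<i> * of_real (t powr \<alpha>) * \<rho> t) (at t)"
    and \<rho>: "\<And>t. a \<le> t \<Longrightarrow> t \<le> a + 1 \<Longrightarrow> (\<rho> has_vector_derivative \<rho>' t) (at t)"
    and B: "\<And>t. a \<le> t \<Longrightarrow> t \<le> a + 1 \<Longrightarrow> norm (f t) \<le> B"
    and B': "\<And>t. a \<le> t \<Longrightarrow> t \<le> a + 1 \<Longrightarrow> norm (\<rho>' t) \<le> B'"
  obtains \<xi> where "a < \<xi>" "\<xi> < a + 1" "norm (\<rho> a) \<le> B * \<xi> powr (- \<alpha>) + B'"
proof -
  define T where "T t = t powr (\<alpha> + 1) / (\<alpha> + 1)" for t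
  have T: "(T has_vector_derivative t powr \<alpha>) (at t)" if "t > 0" for t
    using has_vector_derivative_divide[OF has_vector_derivative_powr[OF that, of "\<alpha> + 1"], of "\<alpha> + 1"] \<alpha>
    unfolding T_def by simp
  have "B' \<ge> 0" using B'[of a] norm_ge_zero[of "\<rho>' a"] by linarith
  have \<rho>b: "norm (\<rho> t - \<rho> a) \<le> B'" if t: "a < t" "t < a + 1" for t
  proof -
    have "norm (\<rho> t - \<rho> a) \<le> B' * t - B' * a"
    proof (rule differentiable_bound_general[OF t(1), where f' = \<rho>'])
      show "continuous_on {a..t} \<rho>"
        using t by (intro continuous_at_imp_continuous_on ballI has_vector_derivative_continuous[OF \<rho>]) auto
      show "((\<lambda>x. B' * x) has_vector_derivative B') (at x)" for x
        by (auto intro!: derivative_eq_intros simp: has_real_derivative_iff_has_vector_derivative[symmetric])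
    qed (use \<rho> B' t in \<open>auto intro!: continuous_intros\<close>)
    also have "\<dots> \<le> B'" using mult_left_mono[of "t - a" 1 B'] t \<open>B' \<ge> 0\<close> by (simp add: algebra_simps)
    finally show ?thesis .
  qed
  define F where "F t = f t + 2 * \<i> * \<rho> a * of_real (T t)" for t
  have dF: "(F has_vector_derivative - 2 * \<i> * of_real (t powr \<alpha>) * (\<rho> t - \<rho> a)) (at t)"
    if "a \<le> t" "t \<le> a + 1" for t
  proof -
    have "(F has_vector_derivative - 2 * \<i> * of_real (t powr \<alpha>) * \<rho> t + 2 * \<i> * \<rho> a * of_real (t powr \<alpha>)) (at t)"
      unfolding F_def
      using that a by (intro has_vector_derivative_add f has_vector_derivative_mult_right
         has_vector_derivative_of_real T[unfolded has_real_derivative_iff_has_vector_derivative[symmetric]]) auto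
    then show ?thesis by (simp add: algebra_simps)
  qed
  have "norm (F (a + 1) - F a) \<le> 2 * B' * T (a + 1) - 2 * B' * T a"
  proof (rule differentiable_bound_general[where f' = "\<lambda>t. - 2 * \<i> * of_real (t powr \<alpha>) * (\<rho> t - \<rho> a)"
        and \<phi>' = "\<lambda>t. 2 * B' * t powr \<alpha>"])
    show "continuous_on {a..a+1} F"
      by (intro continuous_at_imp_continuous_on ballI has_vector_derivative_continuous[OF dF]) auto
    show "continuous_on {a..a+1} (\<lambda>t. 2 * B' * T t)"
      using a by (intro continuous_on_mult_left continuous_at_imp_continuous_on ballI has_vector_derivative_continuous[OF T]) auto
    show "((\<lambda>t. 2 * B' * T t) has_vector_derivative 2 * B' * t powr \<alpha>) (at t)" if "a < t" "t < a + 1" for t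
      using a that by (intro has_vector_derivative_mult_right T) auto
    show "norm (- 2 * \<i> * of_real (t powr \<alpha>) * (\<rho> t - \<rho> a)) \<le> 2 * B' * t powr \<alpha>" if "a < t" "t < a + 1" for t
      using mult_right_mono[OF \<rho>b[OF that], of "2 * t powr \<alpha>"] by (simp add: norm_mult mult_ac)
  qed (use dF in auto)
  then have 1: "norm (F (a + 1) - F a) \<le> 2 * B' * (T (a + 1) - T a)" by (simp add: algebra_simps)
  have "\<exists>\<xi>>a. \<xi> < a + 1 \<and> T (a + 1) - T a = (a + 1 - a) * \<xi> powr \<alpha>"
    using a by (intro MVT2) (auto simp: has_real_derivative_iff_has_vector_derivative intro!: T)
  then obtain \<xi> where \<xi>: "a < \<xi>" "\<xi> < a + 1" "T (a + 1) - T a = \<xi> powr \<alpha>" by auto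
  have pos: "\<xi> powr \<alpha> > 0" using \<xi> a by simp
  have "2 * \<i> * \<rho> a * of_real (T (a + 1) - T a) = (F (a + 1) - F a) - f (a + 1) + f a"
    by (simp add: F_def algebra_simps)
  then have "norm (2 * \<i> * \<rho> a * of_real (T (a + 1) - T a)) \<le> norm (F (a + 1) - F a) + norm (f (a + 1)) + norm (f a)"
    by (smt (verit) norm_triangle_ineq norm_triangle_ineq4)
  also have "\<dots> \<le> 2 * B' * \<xi> powr \<alpha> + B + B"
    using 1 B[of a] B[of "a + 1"] \<xi>(3) by auto
  finally have "norm (\<rho> a) * \<xi> powr \<alpha> \<le> B' * \<xi> powr \<alpha> + B"
    unfolding \<xi>(3) by (simp add: norm_mult)
  then have "norm (\<rho> a) \<le> B * \<xi> powr (- \<alpha>) + B'"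
    using pos by (simp add: powr_minus field_simps)
  then show thesis by (rule that[OF \<xi>(1,2)])
qed

text \<open>The integration runs between y and the height 1, and the error is the integral of K
  t^(-\<gamma>). The quotient is nonnegative for \<gamma> on either side of 1; at \<gamma> = 1 a
  logarithm would appear.\<close>

lemma integrate_to_boundary:
  fixes f f' :: "real \<Rightarrow> complex"
  assumes f: "\<And>t. 0 < t \<Longrightarrow> t \<le> 1 \<Longrightarrow> (f has_vector_derivative f' t) (at t)"
    and b: "\<And>t. 0 < t \<Longrightarrow> t \<le> 1 \<Longrightarrow> norm (f' t) \<le> K * t powr (- \<gamma>)"
    and "\<gamma> \<noteq> 1" and y: "0 < y" "y \<le> 1"
  shows "norm (f y) \<le> norm (f 1) + K * ((y powr (1 - \<gamma>) - 1) / (\<gamma> - 1))"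
proof (cases "y = 1")
  case False
  then have y1: "y < 1" using y by auto
  define \<phi> where "\<phi> t = K / (1 - \<gamma>) * t powr (1 - \<gamma>)" for t
  have \<phi>: "(\<phi> has_vector_derivative K * t powr (- \<gamma>)) (at t)" if "t > 0" for t
    using has_vector_derivative_mult_right[OF has_vector_derivative_powr[OF that, of "1 - \<gamma>"], of "K / (1 - \<gamma>)"]
      \<open>\<gamma> \<noteq> 1\<close> unfolding \<phi>_def by simp
  have "norm (f 1 - f y) \<le> \<phi> 1 - \<phi> y"
  proof (rule differentiable_bound_general[OF y1, where f' = f' and \<phi>' = "\<lambda>t. K * t powr (- \<gamma>)"])
    show "continuous_on {y..1} f"
      using y by (intro continuous_at_imp_continuous_on ballI has_vector_derivative_continuous[OF f]) auto
    show "continuous_on {y..1} \<phi>"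
      using y by (intro continuous_at_imp_continuous_on ballI has_vector_derivative_continuous[OF \<phi>]) auto
  qed (use y f \<phi> b in auto)
  moreover have "\<phi> 1 - \<phi> y = K * ((y powr (1 - \<gamma>) - 1) / (\<gamma> - 1))"
    using \<open>\<gamma> \<noteq> 1\<close> by (simp add: \<phi>_def divide_simps) (simp add: algebra_simps)
  ultimately show ?thesis using norm_triangle_ineq2[of "f y" "f 1"] by (simp add: norm_minus_commute)
qed simp

text \<open>The index counts horizontal derivatives. The clause for \<open>U k\<close> in direction
  \<i> is the equation delbar U = y^\<alpha> W solved for the vertical derivative; the one for
  \<open>W k\<close> says that W is antiholomorphic.\<close>

definition harmonic_tower :: "real \<Rightarrow> (nat \<Rightarrow> complex \<Rightarrow> complex) \<Rightarrow> (nat \<Rightarrow> complex \<Rightarrow> complex) \<Rightarrow> bool" where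
  "harmonic_tower \<alpha> U W \<longleftrightarrow> (\<forall>k. continuous_on \<H> (U k) \<and> continuous_on \<H> (W k) \<and>
     (\<forall>z\<in>\<H>. dir_deriv 1 (U k) (U (Suc k) z) z \<and>
        dir_deriv \<i> (U k) (\<i> * U (Suc k) z - 2 * \<i> * of_real (Im z powr \<alpha>) * W k z) z \<and>
        dir_deriv 1 (W k) (W (Suc k) z) z \<and> dir_deriv \<i> (W k) (- \<i> * W (Suc k) z) z))"

lemma harmonic_towerD:
  assumes "harmonic_tower \<alpha> U W"
  shows "continuous_on \<H> (U k)" "continuous_on \<H> (W k)"
    "z \<in> \<H> \<Longrightarrow> dir_deriv 1 (U k) (U (Suc k) z) z"
    "z \<in> \<H> \<Longrightarrow>
      dir_deriv \<i> (U k) (\<i> * U (Suc k) z - 2 * \<i> * of_real (Im z powr \<alpha>) * W k z) z"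
    "z \<in> \<H> \<Longrightarrow> dir_deriv 1 (W k) (W (Suc k) z) z"
    "z \<in> \<H> \<Longrightarrow> dir_deriv \<i> (W k) (- \<i> * W (Suc k) z) z"
  using assms unfolding harmonic_tower_def by blast+

lemma dir_deriv_vertical:
  assumes "dir_deriv \<i> f d (Complex x y)"
  shows "((\<lambda>t. f (Complex x t)) has_vector_derivative d) (at y)"
proof -
  have eq: "Complex x t = of_real x + of_real t * \<i>" for t by (simp add: Complex_eq)
  show ?thesis using dir_deriv_line[of \<i> f d "of_real x" y] assms unfolding eq by blast
qed

lemma dir_deriv_horizontal:
  assumes "dir_deriv 1 f d (Complex x y)"
  shows "((\<lambda>s. f (Complex s y)) has_vector_derivative d) (at x)"
proof -
  have eq: "Complex s y = \<i> * of_real y + of_real s * 1" for s by (simp add: Complex_eq)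
  show ?thesis using dir_deriv_line[of 1 f d "\<i> * of_real y" x] assms unfolding eq by blast
qed

text \<open>The quantity \<open>\<rho> = W - y^(-\<alpha>) U' / 2\<close> is the multiple \<open>(\<i>/2) y^(-\<alpha>) \<partial>U/\<partial>y\<close>; its vertical
  derivative is controlled by horizontal derivatives of \<open>U\<close> alone.\<close>

definition reduced_flux ::
    "real \<Rightarrow> (nat \<Rightarrow> complex \<Rightarrow> complex) \<Rightarrow> (nat \<Rightarrow> complex \<Rightarrow> complex) \<Rightarrow> nat \<Rightarrow> complex \<Rightarrow> complex" where
  "reduced_flux \<alpha> U W k z = W k z - of_real (Im z powr (- \<alpha>) / 2) * U (Suc k) z"

abbreviation flux_rate :: "real \<Rightarrow> (nat \<Rightarrow> complex \<Rightarrow> complex) \<Rightarrow> nat \<Rightarrow> real \<Rightarrow> real \<Rightarrow> complex" where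
  "flux_rate \<alpha> U k x y \<equiv> of_real (\<alpha> / 2 * y powr (- \<alpha> - 1)) * U (Suc k) (Complex x y)
      - \<i> / 2 * of_real (y powr (- \<alpha>)) * U (Suc (Suc k)) (Complex x y)"

lemma harmonic_tower_vertical:
  assumes H: "harmonic_tower \<alpha> U W" and y: "y > 0"
  shows "((\<lambda>t. U k (Complex x t)) has_vector_derivative
      - 2 * \<i> * of_real (y powr \<alpha>) * reduced_flux \<alpha> U W k (Complex x y)) (at y)" (is ?A)
    and "((\<lambda>t. reduced_flux \<alpha> U W k (Complex x t)) has_vector_derivative
      flux_rate \<alpha> U k x y) (at y)" (is ?B)
proof -
  let ?z = "Complex x y"
  have z: "?z \<in> \<H>" using y by (simp add: upper_half_plane_def)
  have dU: "((\<lambda>t. U k (Complex x t)) has_vector_derivative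
      \<i> * U (Suc k) ?z - 2 * \<i> * of_real (y powr \<alpha>) * W k ?z) (at y)" for k
    using harmonic_towerD(4)[OF H z, of k] by (intro dir_deriv_vertical) simp
  have dW: "((\<lambda>t. W k (Complex x t)) has_vector_derivative - \<i> * W (Suc k) ?z) (at y)" for k
    by (intro dir_deriv_vertical harmonic_towerD(6)[OF H z])
  have pp: "of_real (y powr \<alpha>) * of_real (y powr - \<alpha>) = (1::complex)"
    using y by (simp add: of_real_mult[symmetric] powr_add[symmetric] del: of_real_mult)
  have "- 2 * \<i> * of_real (y powr \<alpha>) * reduced_flux \<alpha> U W k ?z
     = - 2 * \<i> * of_real (y powr \<alpha>) * W k ?z
       + \<i> * (of_real (y powr \<alpha>) * of_real (y powr - \<alpha>)) * U (Suc k) ?z"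
    by (simp add: reduced_flux_def algebra_simps)
  also have "\<dots> = \<i> * U (Suc k) ?z - 2 * \<i> * of_real (y powr \<alpha>) * W k ?z"
    unfolding pp by simp
  finally show ?A using dU by simp
  have dp: "((\<lambda>t. complex_of_real (t powr (- \<alpha>) / 2)) has_vector_derivative
      of_real (- \<alpha> * y powr (- \<alpha> - 1) / 2)) (at y)"
    using has_vector_derivative_divide[OF has_vector_derivative_powr[OF y, of "- \<alpha>"], of 2]
    by (intro has_vector_derivative_of_real) (simp add: has_real_derivative_iff_has_vector_derivative)
  have D: "((\<lambda>t. reduced_flux \<alpha> U W k (Complex x t)) has_vector_derivative
      - \<i> * W (Suc k) ?z - (of_real (y powr (- \<alpha>) / 2) * (\<i> * U (Suc (Suc k)) ?z - 2 * \<i> * of_real (y powr \<alpha>) * W (Suc k) ?z)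
        + of_real (- \<alpha> * y powr (- \<alpha> - 1) / 2) * U (Suc k) ?z)) (at y)"
    unfolding reduced_flux_def complex.sel
    by (rule has_vector_derivative_diff[OF dW has_vector_derivative_mult[OF dp dU]])
  \<comment> \<open>All terms with W collect into one with the factor y^\<alpha> y^(-\<alpha>) - 1,
    which is 0.\<close>
  have E: "- \<i> * W (Suc k) ?z - (of_real (y powr (- \<alpha>) / 2) * (\<i> * U (Suc (Suc k)) ?z - 2 * \<i> * of_real (y powr \<alpha>) * W (Suc k) ?z)
        + of_real (- \<alpha> * y powr (- \<alpha> - 1) / 2) * U (Suc k) ?z)
     = of_real (\<alpha> / 2 * y powr (- \<alpha> - 1)) * U (Suc k) ?z
      - \<i> / 2 * of_real (y powr (- \<alpha>)) * U (Suc (Suc k)) ?z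
      + \<i> * W (Suc k) ?z * (of_real (y powr \<alpha>) * of_real (y powr - \<alpha>) - 1)"
    by (simp add: algebra_simps)
  show ?B using D unfolding E pp by simp
qed

lemma reduced_flux_derivative_bound:
  assumes "y > 0" "norm (V1::complex) \<le> B" "norm (V2::complex) \<le> B"
  shows "norm (of_real (\<alpha> / 2 * y powr (- \<alpha> - 1)) * V1 - \<i> / 2 * of_real (y powr (- \<alpha>)) * V2)
    \<le> (\<bar>\<alpha>\<bar> + 1) * B * (y powr (- \<alpha> - 1) + y powr (- \<alpha>))"
proof -
  have B: "B \<ge> 0" using assms(2) norm_ge_zero order_trans by blast
  have "norm (of_real (\<alpha> / 2 * y powr (- \<alpha> - 1)) * V1 - \<i> / 2 * of_real (y powr (- \<alpha>)) * V2)
    \<le> \<bar>\<alpha>\<bar> / 2 * y powr (- \<alpha> - 1) * norm V1 + 1 / 2 * y powr (- \<alpha>) * norm V2"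
    by (rule order_trans[OF norm_triangle_ineq4]) (simp add: norm_mult abs_mult norm_divide)
  also have "\<dots> \<le> \<bar>\<alpha>\<bar> / 2 * y powr (- \<alpha> - 1) * B + 1 / 2 * y powr (- \<alpha>) * B"
    by (intro add_mono mult_left_mono assms) auto
  also have "\<dots> \<le> (\<bar>\<alpha>\<bar> + 1) * y powr (- \<alpha> - 1) * B + (\<bar>\<alpha>\<bar> + 1) * y powr (- \<alpha>) * B"
    by (intro add_mono mult_right_mono B) auto
  finally show ?thesis by (simp add: algebra_simps)
qed

lemma powr_le_growth:
  assumes "\<eta> > 0" "\<eta> \<le> (\<xi>::real)"
  shows "\<xi> powr p \<le> (1 + \<eta> powr p) * (1 + \<xi>) powr \<bar>p\<bar>"
proof (cases "p \<ge> 0")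
  case True
  have "\<xi> powr p \<le> 1 * (1 + \<xi>) powr \<bar>p\<bar>"
    using assms True by (simp add: powr_mono2)
  also have "\<dots> \<le> (1 + \<eta> powr p) * (1 + \<xi>) powr \<bar>p\<bar>"
    by (intro mult_right_mono) auto
  finally show ?thesis .
next
  case False
  have "\<xi> powr p \<le> \<eta> powr p" using assms False by (intro powr_mono2') auto
  also have "\<dots> \<le> (1 + \<eta> powr p) * 1" by simp
  also have "\<dots> \<le> (1 + \<eta> powr p) * (1 + \<xi>) powr \<bar>p\<bar>"
    using assms by (intro mult_left_mono ge_one_powr_ge_zero) (auto simp: add_nonneg_nonneg)
  finally show ?thesis .
qed

lemma powr_le_of_double:
  assumes "0 \<le> a" "(a::real) \<le> c * b" "0 \<le> b" "0 \<le> c" "P \<ge> 0"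
  shows "a powr P \<le> c powr P * b powr P"
  using powr_mono2[OF assms(5,1,2)] assms by (simp add: powr_mult)

text \<open>A bootstrap in the power of 1/y for y \<le> 1. If all \<open>U k\<close> are
  O(y^(-\<beta>)), then \<open>flux_rate\<close> is O(y^(-\<beta>-\<alpha>-1)), integration down
  from height 1 makes the reduced flux O(y^(-\<beta>-\<alpha>)), so the vertical derivative of
  \<open>U k\<close> is O(y^(-\<beta>)), and a second integration gains one power. Once \<beta> < 1,
  that second integration gives a bounded result.\<close>

lemma harmonic_tower_growth:
  assumes H: "harmonic_tower \<alpha> U W" and \<alpha>: "\<alpha> > -1" and P: "P \<ge> 0" and N: "N \<ge> 0"
    and b: "\<And>k. \<exists>C. \<forall>z\<in>\<H>. norm (U k z) \<le> C * (1 + norm z) powr P * (1 + Im z powr (- N))"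
  shows "\<exists>C. \<forall>z\<in>\<H>. norm (U k z) \<le> C * (1 + norm z) powr P"
proof -
  \<comment> \<open>Horizontal growth is measured by x alone, so it is constant during the vertical
    integrations; for heights up to 2 this changes 1 + |z| by a factor of at most 3.\<close>
  define L where "L x = (1 + \<bar>x\<bar>) powr P" for x :: real
  have L1: "L x \<ge> 1" for x unfolding L_def using P by (intro ge_one_powr_ge_zero) auto
  \<comment> \<open>The bound is demanded for every k because each round at level k consumes the
    levels k + 1 and k + 2.\<close>
  define Bd where "Bd \<beta> \<longleftrightarrow> (\<forall>k. \<exists>C\<ge>0. \<forall>x y. 0 < y \<longrightarrow> y \<le> 1 \<longrightarrow>
      norm (U k (Complex x y)) \<le> C * L x * y powr (- \<beta>))" for \<beta>
  have b2: "\<exists>C\<ge>0. \<forall>x y. 0 < y \<longrightarrow> y \<le> 2 \<longrightarrow> norm (U k (Complex x y)) \<le> C * L x * (1 + y powr (- N))" for k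
  proof -
    obtain C where C: "\<And>z. z \<in> \<H> \<Longrightarrow> norm (U k z) \<le> C * (1 + norm z) powr P * (1 + Im z powr (- N))"
      using b[of k] by auto
    have "norm (U k (Complex x y)) \<le> \<bar>C\<bar> * 3 powr P * L x * (1 + y powr (- N))" if "0 < y" "y \<le> 2" for x y
    proof -
      have "norm (Complex x y) \<le> \<bar>x\<bar> + 2" using cmod_le[of "Complex x y"] that by simp
      then have "(1 + norm (Complex x y)) powr P \<le> 3 powr P * L x"
        unfolding L_def using P by (intro powr_le_of_double) auto
      then have "\<bar>C\<bar> * (1 + norm (Complex x y)) powr P * (1 + y powr (- N)) \<le> \<bar>C\<bar> * (3 powr P * L x) * (1 + y powr (- N))"
        by (intro mult_right_mono mult_left_mono) auto
      moreover have "C * (1 + norm (Complex x y)) powr P * (1 + y powr (- N))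
         \<le> \<bar>C\<bar> * (1 + norm (Complex x y)) powr P * (1 + y powr (- N))"
        by (intro mult_right_mono) auto
      ultimately show ?thesis using C[of "Complex x y"] that by (simp add: upper_half_plane_def mult_ac)
    qed
    then show ?thesis by (intro exI[of _ "\<bar>C\<bar> * 3 powr P"]) auto
  qed
  \<comment> \<open>The integration of the flux starts at height 1. There it is bounded by the
    estimate on the window [1, 2], where all powers of t are harmless.\<close>
  have flux1: "\<exists>C\<ge>0. \<forall>x. norm (reduced_flux \<alpha> U W k (Complex x 1)) \<le> C * L x" for k
  proof -
    obtain C0 where C0: "C0 \<ge> 0" "\<And>x y. 0 < y \<Longrightarrow> y \<le> 2 \<Longrightarrow> norm (U k (Complex x y)) \<le> C0 * L x * (1 + y powr (- N))"
      using b2[of k] by auto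
    obtain C1 where C1: "C1 \<ge> 0" "\<And>x y. 0 < y \<Longrightarrow> y \<le> 2 \<Longrightarrow> norm (U (Suc k) (Complex x y)) \<le> C1 * L x * (1 + y powr (- N))"
      using b2[of "Suc k"] by auto
    obtain C2 where C2: "C2 \<ge> 0" "\<And>x y. 0 < y \<Longrightarrow> y \<le> 2 \<Longrightarrow> norm (U (Suc (Suc k)) (Complex x y)) \<le> C2 * L x * (1 + y powr (- N))"
      using b2[of "Suc (Suc k)"] by auto
    define C where "C = 2 * (C0 + C1 + C2)"
    have small: "C' * L x * (1 + t powr (- N)) \<le> C * L x" if "1 \<le> t" "0 \<le> C'" "C' \<le> C0 + C1 + C2" for C' x t
    proof -
      have "t powr (- N) \<le> 1" using that N powr_mono[of "-N" 0 t] by simp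
      then have "(C' * L x) * (1 + t powr (- N)) \<le> (C' * L x) * 2"
        using that L1[of x] by (intro mult_left_mono) auto
      also have "\<dots> \<le> (C0 + C1 + C2) * L x * 2" using that L1[of x] by (intro mult_right_mono) auto
      finally show ?thesis by (simp only: C_def mult_ac)
    qed
    have pw: "t powr (- \<alpha> - 1) \<le> 1" "t powr (- \<alpha>) \<le> 2" if "1 \<le> t" "t \<le> 2" for t
    proof -
      show *: "t powr (- \<alpha> - 1) \<le> 1" using that \<alpha> powr_mono[of "- \<alpha> - 1" 0 t] by simp
      have "t powr (- \<alpha>) = t * t powr (- \<alpha> - 1)" using that by (simp add: powr_diff)
      also have "\<dots> \<le> 2 * 1" using that * by (intro mult_mono) auto
      finally show "t powr (- \<alpha>) \<le> 2" by simp
    qed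
    have "norm (reduced_flux \<alpha> U W k (Complex x 1)) \<le> (C * 2 + (\<bar>\<alpha>\<bar> + 1) * C * 3) * L x" for x
    proof -
      have Cp: "C * L x \<ge> 0" using C0(1) C1(1) C2(1) L1[of x] by (simp add: C_def)
      obtain \<xi> where \<xi>: "1 < \<xi>" "\<xi> < 1 + 1" "norm (reduced_flux \<alpha> U W k (Complex x 1))
          \<le> (C * L x) * \<xi> powr (- \<alpha>) + (\<bar>\<alpha>\<bar> + 1) * (C * L x) * 3"
      proof (rule window_estimate[of 1 \<alpha> "\<lambda>t. U k (Complex x t)" "\<lambda>t. reduced_flux \<alpha> U W k (Complex x t)"])
        show "norm (U k (Complex x t)) \<le> C * L x" if "1 \<le> t" "t \<le> 1 + 1" for t
          using C0(2)[of t x] small[of t C0 x] that C0(1) C1(1) C2(1) by simp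
        show "norm (flux_rate \<alpha> U k x t) \<le> (\<bar>\<alpha>\<bar> + 1) * (C * L x) * 3"
          if "1 \<le> t" "t \<le> 1 + 1" for t
        proof -
          have "norm (flux_rate \<alpha> U k x t)
            \<le> (\<bar>\<alpha>\<bar> + 1) * (C * L x) * (t powr (- \<alpha> - 1) + t powr (- \<alpha>))"
            using C1(2)[of t x] C2(2)[of t x] small[of t C1 x] small[of t C2 x] that C0(1) C1(1) C2(1)
            by (intro reduced_flux_derivative_bound) auto
          also have "\<dots> \<le> (\<bar>\<alpha>\<bar> + 1) * (C * L x) * 3"
            using pw[of t] that by (intro mult_left_mono mult_nonneg_nonneg[OF _ Cp]) auto
          finally show ?thesis .
        qed
      qed (use \<alpha> harmonic_tower_vertical[OF H] in auto)
      have "(C * L x) * \<xi> powr (- \<alpha>) \<le> (C * L x) * 2"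
        using pw(2)[of \<xi>] \<xi>(1,2) Cp by (intro mult_left_mono) auto
      then show ?thesis using \<xi>(3) by (simp add: algebra_simps)
    qed
    moreover have "C * 2 + (\<bar>\<alpha>\<bar> + 1) * C * 3 \<ge> 0"
      using C0(1) C1(1) C2(1) by (simp add: C_def)
    ultimately show ?thesis by blast
  qed
  \<comment> \<open>The outcome of the last integration is kept as a quotient, so that the same step
    serves \<beta> > 1 in the descent and \<beta> < 1 at its end. The condition \<beta> + \<alpha> >
    0 makes the first integration end in a negative power of y.\<close>
  have step: "\<exists>C\<ge>0. \<forall>x y. 0 < y \<longrightarrow> y \<le> 1 \<longrightarrow>
      norm (U k (Complex x y)) \<le> C * L x * (1 + (y powr (1 - \<beta>) - 1) / (\<beta> - 1))"
    if Bd: "Bd \<beta>" and \<beta>: "\<beta> + \<alpha> > 0" "\<beta> \<noteq> 1" for \<beta> k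
  proof -
    obtain C0 where C0: "C0 \<ge> 0" "\<And>x y. 0 < y \<Longrightarrow> y \<le> 1 \<Longrightarrow> norm (U k (Complex x y)) \<le> C0 * L x * y powr (- \<beta>)"
      using Bd unfolding Bd_def by meson
    obtain C1 where C1: "C1 \<ge> 0" "\<And>x y. 0 < y \<Longrightarrow> y \<le> 1 \<Longrightarrow> norm (U (Suc k) (Complex x y)) \<le> C1 * L x * y powr (- \<beta>)"
      using Bd unfolding Bd_def by meson
    obtain C2 where C2: "C2 \<ge> 0" "\<And>x y. 0 < y \<Longrightarrow> y \<le> 1 \<Longrightarrow> norm (U (Suc (Suc k)) (Complex x y)) \<le> C2 * L x * y powr (- \<beta>)"
      using Bd unfolding Bd_def by meson
    obtain F where F: "F \<ge> 0" "\<And>x. norm (reduced_flux \<alpha> U W k (Complex x 1)) \<le> F * L x"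
      using flux1[of k] by auto
    define C where "C = C1 + C2"
    define K where "K = (\<bar>\<alpha>\<bar> + 1) * C * 2"
    have K0: "K \<ge> 0" using C1(1) C2(1) by (simp add: K_def C_def)
    define K2 where "K2 = 2 * (F + K / (\<beta> + \<alpha>))"
    have K20: "K2 \<ge> 0" using K0 F(1) \<beta> by (simp add: K2_def)
    have flux: "norm (reduced_flux \<alpha> U W k (Complex x y)) \<le> K2 / 2 * L x * y powr (- (\<beta> + \<alpha>))"
      if y: "0 < y" "y \<le> 1" for x y
    proof -
      have "norm (reduced_flux \<alpha> U W k (Complex x y)) \<le> norm (reduced_flux \<alpha> U W k (Complex x 1))
          + K * L x * ((y powr (1 - (\<beta> + \<alpha> + 1)) - 1) / (\<beta> + \<alpha> + 1 - 1))"
      proof (rule integrate_to_boundary)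
        show "norm (flux_rate \<alpha> U k x t) \<le> K * L x * t powr (- (\<beta> + \<alpha> + 1))"
          if t: "0 < t" "t \<le> 1" for t
        proof -
          have "norm (flux_rate \<alpha> U k x t)
            \<le> (\<bar>\<alpha>\<bar> + 1) * (C * L x * t powr (- \<beta>)) * (t powr (- \<alpha> - 1) + t powr (- \<alpha>))"
          proof (intro reduced_flux_derivative_bound)
            show "norm (U (Suc k) (Complex x t)) \<le> C * L x * t powr (- \<beta>)"
              by (rule order_trans[OF C1(2)[OF t]]) (use C2(1) L1[of x] in \<open>auto simp: C_def intro!: mult_right_mono\<close>)
            show "norm (U (Suc (Suc k)) (Complex x t)) \<le> C * L x * t powr (- \<beta>)"
              by (rule order_trans[OF C2(2)[OF t]]) (use C1(1) L1[of x] in \<open>auto simp: C_def intro!: mult_right_mono\<close>)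
          qed (rule t)
          also have "\<dots> \<le> (\<bar>\<alpha>\<bar> + 1) * (C * L x * t powr (- \<beta>)) * (t powr (- \<alpha> - 1) + t powr (- \<alpha> - 1))"
            using t C1(1) C2(1) L1[of x]
            by (intro mult_left_mono add_left_mono powr_mono' mult_nonneg_nonneg) (auto simp: C_def)
          also have "\<dots> = K * L x * (t powr (- \<beta>) * t powr (- \<alpha> - 1))" by (simp add: K_def)
          also have "t powr (- \<beta>) * t powr (- \<alpha> - 1) = t powr (- (\<beta> + \<alpha> + 1))"
            unfolding powr_add[symmetric] by (rule arg_cong[where f = "\<lambda>p. t powr p"]) simp
          finally show ?thesis .
        qed
      qed (use y \<beta> harmonic_tower_vertical(2)[OF H] in auto)
      also have "\<dots> \<le> F * L x * y powr (- (\<beta> + \<alpha>)) + K * L x * (y powr (- (\<beta> + \<alpha>)) / (\<beta> + \<alpha>))"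
      proof (intro add_mono mult_left_mono)
        have "1 \<le> y powr (- (\<beta> + \<alpha>))" using y \<beta> powr_mono'[of "- (\<beta> + \<alpha>)" 0 y] by simp
        then have "F * L x * 1 \<le> F * L x * y powr (- (\<beta> + \<alpha>))"
          using F(1) L1[of x] by (intro mult_left_mono) auto
        then show "norm (reduced_flux \<alpha> U W k (Complex x 1)) \<le> F * L x * y powr (- (\<beta> + \<alpha>))"
          using F(2)[of x] by simp
        show "(y powr (1 - (\<beta> + \<alpha> + 1)) - 1) / (\<beta> + \<alpha> + 1 - 1) \<le> y powr (- (\<beta> + \<alpha>)) / (\<beta> + \<alpha>)"
          using \<beta> by (simp add: divide_right_mono)
        show "0 \<le> K * L x" using K0 L1[of x] by simp
      qed
      also have "\<dots> = K2 / 2 * L x * y powr (- (\<beta> + \<alpha>))" by (simp add: K2_def algebra_simps)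
      finally show ?thesis .
    qed
    have "norm (U k (Complex x y)) \<le> (C0 + K2) * L x * (1 + (y powr (1 - \<beta>) - 1) / (\<beta> - 1))"
      if y: "0 < y" "y \<le> 1" for x y
    proof -
      have "norm (U k (Complex x y)) \<le> norm (U k (Complex x 1)) + K2 * L x * ((y powr (1 - \<beta>) - 1) / (\<beta> - 1))"
      proof (rule integrate_to_boundary)
        show "norm (- 2 * \<i> * of_real (t powr \<alpha>) * reduced_flux \<alpha> U W k (Complex x t)) \<le> K2 * L x * t powr (- \<beta>)"
          if t: "0 < t" "t \<le> 1" for t
        proof -
          have "norm (- 2 * \<i> * of_real (t powr \<alpha>) * reduced_flux \<alpha> U W k (Complex x t))
             \<le> 2 * t powr \<alpha> * (K2 / 2 * L x * t powr (- (\<beta> + \<alpha>)))"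
            using mult_left_mono[OF flux[OF t, of x], of "2 * t powr \<alpha>"] by (simp add: norm_mult)
          also have "\<dots> = K2 * L x * (t powr \<alpha> * t powr (- (\<beta> + \<alpha>)))" by simp
          also have "t powr \<alpha> * t powr (- (\<beta> + \<alpha>)) = t powr (- \<beta>)" by (simp add: powr_add[symmetric])
          finally show ?thesis .
        qed
      qed (use y \<beta> harmonic_tower_vertical(1)[OF H] in auto)
      moreover have "norm (U k (Complex x 1)) \<le> C0 * L x" using C0(2)[of 1 x] by simp
      moreover have "0 \<le> (y powr (1 - \<beta>) - 1) / (\<beta> - 1)"
      proof (cases "\<beta> > 1")
        case True
        then show ?thesis using y powr_mono'[of "1 - \<beta>" 0 y] by simp
      next
        case False
        then show ?thesis using y \<beta> powr_mono'[of 0 "1 - \<beta>" y] by (simp add: divide_nonpos_neg)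
      qed
      then have "0 \<le> C0 * L x * ((y powr (1 - \<beta>) - 1) / (\<beta> - 1))" "0 \<le> K2 * L x"
        using C0(1) L1[of x] K20 by (auto intro!: mult_nonneg_nonneg simp del: times_divide_eq_right)
      ultimately show ?thesis by (simp add: algebra_simps del: times_divide_eq_right times_divide_eq_left)
    qed
    then show ?thesis using C0(1) K20 by (intro exI[of _ "C0 + K2"]) auto
  qed
  have stepdown: "Bd (\<beta> - 1)" if Bd\<beta>: "Bd \<beta>" and \<beta>1: "\<beta> > 1" for \<beta>
    unfolding Bd_def
  proof
    fix k
    obtain C where C: "C \<ge> 0" "\<And>x y. 0 < y \<Longrightarrow> y \<le> 1 \<Longrightarrow>
      norm (U k (Complex x y)) \<le> C * L x * (1 + (y powr (1 - \<beta>) - 1) / (\<beta> - 1))"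
      using step[OF Bd\<beta>, of k] \<beta>1 \<alpha> by auto
    have "norm (U k (Complex x y)) \<le> C * (1 + 1 / (\<beta> - 1)) * L x * y powr (- (\<beta> - 1))" if y: "0 < y" "y \<le> 1" for x y
    proof -
      have "1 \<le> y powr (- (\<beta> - 1))" using y \<open>\<beta> > 1\<close> powr_mono'[of "1 - \<beta>" 0 y] by simp
      moreover have "(y powr (1 - \<beta>) - 1) / (\<beta> - 1) \<le> y powr (- (\<beta> - 1)) / (\<beta> - 1)"
        using \<open>\<beta> > 1\<close> by (intro divide_right_mono) auto
      ultimately have "1 + (y powr (1 - \<beta>) - 1) / (\<beta> - 1) \<le> (1 + 1 / (\<beta> - 1)) * y powr (- (\<beta> - 1))"
        by (simp add: algebra_simps)
      then have "C * L x * (1 + (y powr (1 - \<beta>) - 1) / (\<beta> - 1)) \<le> C * L x * ((1 + 1 / (\<beta> - 1)) * y powr (- (\<beta> - 1)))"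
        using C(1) L1[of x] by (intro mult_left_mono) auto
      then show ?thesis using C(2)[OF y, of x] by (simp add: mult_ac)
    qed
    then show "\<exists>C\<ge>0. \<forall>x y. 0 < y \<longrightarrow> y \<le> 1 \<longrightarrow> norm (U k (Complex x y)) \<le> C * L x * y powr (- (\<beta> - 1))"
      using C(1) \<open>\<beta> > 1\<close> by (intro exI[of _ "C * (1 + 1 / (\<beta> - 1))"]) auto
  qed
  \<comment> \<open>The midpoint between max(0, -\<alpha>) and 1, where there is room because
    \<alpha> > -1. Descending from \<beta>0 + M in steps of 1, the exponent never meets the
    logarithmic case 1.\<close>
  define \<beta>0 where "\<beta>0 = (1 + max 0 (- \<alpha>)) / 2"
  have \<beta>0: "0 < \<beta>0" "\<beta>0 < 1" "\<beta>0 + \<alpha> > 0" using \<alpha> by (auto simp: \<beta>0_def max_def field_simps)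
  obtain M :: nat where M: "N \<le> M" using real_arch_simple by blast
  have "Bd (\<beta>0 + real M)"
    unfolding Bd_def
  proof
    fix k
    obtain C where C: "C \<ge> 0" "\<And>x y. 0 < y \<Longrightarrow> y \<le> 2 \<Longrightarrow> norm (U k (Complex x y)) \<le> C * L x * (1 + y powr (- N))"
      using b2[of k] by auto
    have "norm (U k (Complex x y)) \<le> 2 * C * L x * y powr (- (\<beta>0 + real M))" if y: "0 < y" "y \<le> 1" for x y
    proof -
      have "y powr (- N) \<le> y powr (- (\<beta>0 + real M))" using y M \<beta>0 by (intro powr_mono') auto
      moreover have "1 \<le> y powr (- (\<beta>0 + real M))" using y M \<beta>0 powr_mono'[of "- (\<beta>0 + real M)" 0 y] by simp
      ultimately have "C * L x * (1 + y powr (- N)) \<le> C * L x * (2 * y powr (- (\<beta>0 + real M)))"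
        using C(1) L1[of x] by (intro mult_left_mono) auto
      then show ?thesis using C(2)[of y x] y by (simp add: mult_ac)
    qed
    then show "\<exists>C\<ge>0. \<forall>x y. 0 < y \<longrightarrow> y \<le> 1 \<longrightarrow> norm (U k (Complex x y)) \<le> C * L x * y powr (- (\<beta>0 + real M))"
      using C(1) by (intro exI[of _ "2 * C"]) auto
  qed
  then have "Bd \<beta>0"
  proof (induction M)
    case (Suc M)
    then show ?case using stepdown[of "\<beta>0 + real (Suc M)"] \<beta>0 by (simp add: algebra_simps)
  qed simp
  then obtain C where C: "C \<ge> 0" "\<And>x y. 0 < y \<Longrightarrow> y \<le> 1 \<Longrightarrow>
      norm (U k (Complex x y)) \<le> C * L x * (1 + (y powr (1 - \<beta>0) - 1) / (\<beta>0 - 1))"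
    using step[of \<beta>0 k] \<beta>0 by auto
  obtain C' where C': "\<And>z. z \<in> \<H> \<Longrightarrow> norm (U k z) \<le> C' * (1 + norm z) powr P * (1 + Im z powr (- N))"
    using b[of k] by auto
  define K where "K = C * (1 + 1 / (1 - \<beta>0)) + 2 * \<bar>C'\<bar>"
  have "norm (U k z) \<le> K * (1 + norm z) powr P" if z: "z \<in> \<H>" for z
  proof (cases "Im z \<le> 1")
    case True
    have y: "0 < Im z" using z by (simp add: upper_half_plane_def)
    have "(Im z powr (1 - \<beta>0) - 1) / (\<beta>0 - 1) = (1 - Im z powr (1 - \<beta>0)) / (1 - \<beta>0)"
      by (metis minus_diff_eq minus_divide_divide)
    also have "\<dots> \<le> 1 / (1 - \<beta>0)" using \<beta>0 by (intro divide_right_mono) auto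
    finally have "C * L (Re z) * (1 + (Im z powr (1 - \<beta>0) - 1) / (\<beta>0 - 1)) \<le> C * L (Re z) * (1 + 1 / (1 - \<beta>0))"
      using C(1) L1[of "Re z"] by (intro mult_left_mono) auto
    then have "norm (U k z) \<le> C * (1 + 1 / (1 - \<beta>0)) * L (Re z)"
      using C(2)[OF y True, of "Re z"] by (simp add: mult_ac)
    also have "\<dots> \<le> C * (1 + 1 / (1 - \<beta>0)) * (1 + norm z) powr P"
      unfolding L_def using C(1) \<beta>0 P abs_Re_le_cmod[of z] by (intro mult_left_mono powr_mono2) auto
    also have "\<dots> \<le> K * (1 + norm z) powr P" by (intro mult_right_mono) (auto simp: K_def)
    finally show ?thesis .
  next
    case False
    have "Im z powr (- N) \<le> 1" using False N powr_mono[of "- N" 0 "Im z"] by simp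
    then have "\<bar>C'\<bar> * (1 + norm z) powr P * (1 + Im z powr (- N)) \<le> \<bar>C'\<bar> * (1 + norm z) powr P * 2"
      by (intro mult_left_mono) auto
    moreover have "C' * ((1 + norm z) powr P * (1 + Im z powr (- N))) \<le> \<bar>C'\<bar> * ((1 + norm z) powr P * (1 + Im z powr (- N)))"
      by (intro mult_right_mono) auto
    ultimately have "norm (U k z) \<le> 2 * \<bar>C'\<bar> * (1 + norm z) powr P" using C'[OF z] by (simp add: mult_ac)
    also have "\<dots> \<le> K * (1 + norm z) powr P" using C(1) \<beta>0 by (intro mult_right_mono) (auto simp: K_def)
    finally show ?thesis .
  qed
  then show ?thesis by blast
qed

text \<open>The window [y, y + 1] bounds the reduced flux, and adding back y^(-\<alpha>) U' / 2
  recovers W. At heights above \<eta> the powers with exponents -\<alpha> and -\<alpha> - 1 cost at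
  most a multiple of (1 + |z|)^(|\<alpha>| + 1), which accounts for the exponent.\<close>

lemma harmonic_tower_flux_growth:
  assumes H: "harmonic_tower \<alpha> U W" and \<alpha>: "\<alpha> > -1" and P: "P \<ge> 0" and \<eta>: "\<eta> > 0"
    and b: "\<And>k. \<exists>C. \<forall>z\<in>\<H>. norm (U k z) \<le> C * (1 + norm z) powr P"
  obtains C where "C \<ge> 0" "\<And>z. Im z \<ge> \<eta> \<Longrightarrow> norm (W k z) \<le> C * (1 + norm z) powr (P + \<bar>\<alpha>\<bar> + 1)"
proof -
  have "\<exists>C\<ge>0. \<forall>z\<in>\<H>. norm (U k z) \<le> C * (1 + norm z) powr P" for k
  proof -
    obtain C where C: "\<And>z. z \<in> \<H> \<Longrightarrow> norm (U k z) \<le> C * (1 + norm z) powr P"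
      using b[of k] by auto
    have "norm (U k z) \<le> \<bar>C\<bar> * (1 + norm z) powr P" if "z \<in> \<H>" for z
      by (rule order_trans[OF C[OF that]]) (auto intro!: mult_right_mono)
    then show ?thesis by (intro exI[of _ "\<bar>C\<bar>"]) auto
  qed
  then obtain c where c: "\<And>k. c k \<ge> 0" "\<And>k z. z \<in> \<H> \<Longrightarrow> norm (U k z) \<le> c k * (1 + norm z) powr P"
    by metis
  \<comment> \<open>The factor 2^P pays for moving up by at most 1 inside the window, which at most
    doubles 1 + |z|; the power of 2 in K has the same origin.\<close>
  define C where "C = (c k + c (Suc k) + c (Suc (Suc k))) * 2 powr P"
  have C0: "C \<ge> 0" using c(1) by (simp add: C_def)
  define K where "K = (1 + \<eta> powr (- \<alpha>) + \<eta> powr (- \<alpha> - 1)) * 2 powr (\<bar>\<alpha>\<bar> + 1)"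
  have K0: "K \<ge> 0" by (simp add: K_def)
  have "norm (W k z) \<le> (C * K + (\<bar>\<alpha>\<bar> + 1) * C * (2 * K) + C * K) * (1 + norm z) powr (P + \<bar>\<alpha>\<bar> + 1)"
    if z: "Im z \<ge> \<eta>" for z
  proof -
    define x y where "x = Re z" and "y = Im z"
    have zxy: "z = Complex x y" by (simp add: x_def y_def)
    have y: "y > 0" "\<eta> \<le> y" using z \<eta> by (auto simp: y_def)
    define B where "B = C * (1 + norm z) powr P"
    define E where "E = K * (1 + norm z) powr (\<bar>\<alpha>\<bar> + 1)"
    have B0: "B \<ge> 0" using C0 by (simp add: B_def)
    have E0: "E \<ge> 0" using K0 by (simp add: E_def)
    have cC: "c k * 2 powr P \<le> C" "c (Suc k) * 2 powr P \<le> C" "c (Suc (Suc k)) * 2 powr P \<le> C"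
      unfolding C_def by (intro mult_right_mono; use c(1)[of k] c(1)[of "Suc k"] c(1)[of "Suc (Suc k)"] in simp)+
    have Ub: "norm (U j (Complex x t)) \<le> B" if t: "y \<le> t" "t \<le> y + 1" and cj: "c j * 2 powr P \<le> C" for j t
    proof -
      have le1: "norm (Complex x t) \<le> norm z + 1"
      proof -
        have "Complex x t = z + Complex 0 (t - y)" by (simp add: zxy complex_eq_iff)
        then have "norm (Complex x t) \<le> norm z + norm (Complex 0 (t - y))"
          using norm_triangle_ineq by metis
        also have "norm (Complex 0 (t - y)) \<le> 1" using t by (simp add: cmod_def)
        finally show ?thesis by simp
      qed
      have "(1 + norm (Complex x t)) powr P \<le> 2 powr P * (1 + norm z) powr P"
      proof (rule powr_le_of_double[OF _ _ _ _ P])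
        show "1 + norm (Complex x t) \<le> 2 * (1 + norm z)"
          using le1 norm_ge_zero[of z] unfolding distrib_left by linarith
      qed (auto intro: add_nonneg_nonneg)
      then have "c j * (1 + norm (Complex x t)) powr P \<le> c j * (2 powr P * (1 + norm z) powr P)"
        by (intro mult_left_mono c(1))
      also have "\<dots> = c j * 2 powr P * (1 + norm z) powr P" by simp
      also have "\<dots> \<le> B" unfolding B_def by (intro mult_right_mono cj) auto
      finally show ?thesis using c(2)[of "Complex x t" j] t y by (simp add: upper_half_plane_def)
    qed
    have Eb: "t powr p \<le> E" if t: "y \<le> t" "t \<le> y + 1" and p: "p = - \<alpha> \<or> p = - \<alpha> - 1" for t p
    proof -
      have "t powr p \<le> (1 + \<eta> powr p) * (1 + t) powr \<bar>p\<bar>"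
        using \<eta> y t by (intro powr_le_growth) auto
      also have "\<dots> \<le> (1 + \<eta> powr (- \<alpha>) + \<eta> powr (- \<alpha> - 1)) * (1 + t) powr (\<bar>\<alpha>\<bar> + 1)"
        using p y t by (intro mult_mono powr_mono) auto
      also have "\<dots> \<le> (1 + \<eta> powr (- \<alpha>) + \<eta> powr (- \<alpha> - 1)) *
          (2 powr (\<bar>\<alpha>\<bar> + 1) * (1 + norm z) powr (\<bar>\<alpha>\<bar> + 1))"
        using t y abs_Im_le_cmod[of z] by (intro mult_left_mono powr_le_of_double) (auto simp: y_def)
      finally show ?thesis by (simp add: E_def K_def mult_ac)
    qed
    obtain \<xi> where \<xi>: "y < \<xi>" "\<xi> < y + 1" "norm (reduced_flux \<alpha> U W k (Complex x y))
          \<le> B * \<xi> powr (- \<alpha>) + (\<bar>\<alpha>\<bar> + 1) * B * (2 * E)"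
    proof (rule window_estimate[of y \<alpha> "\<lambda>t. U k (Complex x t)" "\<lambda>t. reduced_flux \<alpha> U W k (Complex x t)"])
      show "norm (flux_rate \<alpha> U k x t) \<le> (\<bar>\<alpha>\<bar> + 1) * B * (2 * E)"
          if "y \<le> t" "t \<le> y + 1" for t
      proof -
        have "norm (flux_rate \<alpha> U k x t)
            \<le> (\<bar>\<alpha>\<bar> + 1) * B * (t powr (- \<alpha> - 1) + t powr (- \<alpha>))"
          using that y Ub[OF that] cC by (intro reduced_flux_derivative_bound) auto
        also have "\<dots> \<le> (\<bar>\<alpha>\<bar> + 1) * B * (2 * E)"
          using Eb[OF that, of "- \<alpha>"] Eb[OF that, of "- \<alpha> - 1"] B0 by (intro mult_left_mono mult_nonneg_nonneg) auto
        finally show ?thesis .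
      qed
      show "norm (U k (Complex x t)) \<le> B" if "y \<le> t" "t \<le> y + 1" for t
        using Ub[OF that cC(1)] .
    qed (use y \<alpha> harmonic_tower_vertical[OF H] in auto)
    have "W k z = reduced_flux \<alpha> U W k z + of_real (y powr (- \<alpha>) / 2) * U (Suc k) z"
      by (simp add: reduced_flux_def y_def)
    then have "norm (W k z) \<le> norm (reduced_flux \<alpha> U W k z) + norm (of_real (y powr (- \<alpha>) / 2) * U (Suc k) z)"
      using norm_triangle_ineq by metis
    also have "norm (of_real (y powr (- \<alpha>) / 2) * U (Suc k) z) \<le> E * B"
    proof -
      have "y powr (- \<alpha>) * norm (U (Suc k) z) \<le> E * B"
        using Eb[of y "- \<alpha>"] Ub[of y "Suc k"] cC E0 by (intro mult_mono) (auto simp: zxy)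
      moreover have "0 \<le> E * B" using E0 B0 by simp
      ultimately show ?thesis by (simp add: norm_mult)
    qed
    also have "norm (reduced_flux \<alpha> U W k z) \<le> B * E + (\<bar>\<alpha>\<bar> + 1) * B * (2 * E)"
      using \<xi>(3) mult_left_mono[OF Eb[of \<xi> "- \<alpha>"] B0] \<xi>(1,2) by (simp add: zxy)
    finally have "norm (W k z) \<le> B * E + (\<bar>\<alpha>\<bar> + 1) * B * (2 * E) + E * B" by simp
    also have "\<dots> = (C * K + (\<bar>\<alpha>\<bar> + 1) * C * (2 * K) + C * K) * ((1 + norm z) powr P * (1 + norm z) powr (\<bar>\<alpha>\<bar> + 1))"
      by (simp add: B_def E_def algebra_simps)
    also have "(1 + norm z) powr P * (1 + norm z) powr (\<bar>\<alpha>\<bar> + 1) = (1 + norm z) powr (P + \<bar>\<alpha>\<bar> + 1)"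
      by (simp add: powr_add[symmetric] add.assoc)
    finally show ?thesis .
  qed
  then show thesis by (intro that[of "C * K + (\<bar>\<alpha>\<bar> + 1) * C * (2 * K) + C * K"]) (use C0 K0 in auto)
qed

section \<open>The antiholomorphic flux\<close>

definition lower_half_plane :: "complex set" ("\<L>") where
  "\<L> = {z. Im z < 0}"

lemma horizontal_lower_half_plane: "horizontal \<L>"
  by (auto simp: horizontal_def lower_half_plane_def open_halfspace_Im_lt)

lemma open_half_planes: "open \<H>" "open \<L>"
  using horizontal_upper_half_plane horizontal_lower_half_plane by (auto simp: horizontal_def)

lemma differentiable_partials:
  assumes "f differentiable (at z)"
  shows "dir_deriv 1 f (partial_x f z) z" "dir_deriv \<i> f (partial_y f z) z"
    "(f has_derivative (\<lambda>h. of_real (Re h) * partial_x f z + of_real (Im h) * partial_y f z)) (at z)"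
proof -
  obtain L where L: "(f has_derivative L) (at z)" using assms by (auto simp: differentiable_def)
  interpret L: bounded_linear L using L by (rule has_derivative_bounded_linear)
  have line: "((\<lambda>s. f (z + of_real s * e)) has_vector_derivative L e) (at 0)" for e
  proof -
    have "((\<lambda>s::real. z + of_real s * e) has_derivative (\<lambda>s. of_real s * e)) (at 0)"
      by (auto intro!: derivative_eq_intros)
    from diff_chain_at[OF this, of f L] L
    have "((\<lambda>s. f (z + of_real s * e)) has_derivative (\<lambda>s. L (of_real s * e))) (at 0)"
      by (simp add: o_def)
    moreover have "L (of_real s * e) = s *\<^sub>R L e" for s
      by (metis L.scaleR scaleR_conv_of_real)
    ultimately show ?thesis by (simp add: has_vector_derivative_def)
  qed
  have x: "partial_x f z = L 1"
    using vector_derivative_at[OF line[of 1]] by (simp add: partial_x_def)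
  have y: "partial_y f z = L \<i>"
    using vector_derivative_at[OF line[of \<i>]] by (simp add: partial_y_def mult.commute)
  show "dir_deriv 1 f (partial_x f z) z" "dir_deriv \<i> f (partial_y f z) z"
    using line[of 1] line[of \<i>] by (simp_all add: dir_deriv_def x y)
  have Leq: "L h = of_real (Re h) * L 1 + of_real (Im h) * L \<i>" for h
  proof -
    have "h = Re h *\<^sub>R 1 + Im h *\<^sub>R \<i>" by (simp add: complex_eq_iff)
    then have "L h = Re h *\<^sub>R L 1 + Im h *\<^sub>R L \<i>" by (metis L.add L.scaleR)
    then show ?thesis by (simp add: scaleR_conv_of_real)
  qed
  show "(f has_derivative (\<lambda>h. of_real (Re h) * partial_x f z + of_real (Im h) * partial_y f z)) (at z)"
    unfolding x y by (rule has_derivative_eq_rhs[OF L ext[OF Leq]])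
qed

lemma holomorphic_if_delbar_zero:
  assumes "open S" and "\<And>z. z \<in> S \<Longrightarrow> f differentiable (at z)" and "\<And>z. z \<in> S \<Longrightarrow> delbar_z f z = 0"
  shows "f holomorphic_on S"
proof -
  have "(f has_field_derivative partial_x f z) (at z)" if "z \<in> S" for z
  proof -
    have "partial_x f z = - \<i> * partial_y f z"
      using assms(3)[OF that] by (simp add: delbar_z_def add_eq_0_iff2)
    then have "partial_y f z = \<i> * partial_x f z" by simp
    then have "of_real (Re h) * partial_x f z + of_real (Im h) * partial_y f z = partial_x f z * h" for h
      by (subst (3) complex_eq[of h]) (simp add: algebra_simps)
    then show ?thesis
      using differentiable_partials(3)[OF assms(2)[OF that]] by (simp add: has_field_derivative_def mult_commute_abs)
  qed
  then show ?thesis using holomorphic_on_open[OF \<open>open S\<close>] by blast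
qed

lemma antiholomorphic_if_del_zero:
  assumes "\<And>z. z \<in> \<H> \<Longrightarrow> w differentiable (at z)"
    and "\<And>z. z \<in> \<H> \<Longrightarrow> del_z w z = 0"
  shows "(\<lambda>\<zeta>. w (cnj \<zeta>)) holomorphic_on \<L>"
proof -
  have "((\<lambda>\<zeta>. w (cnj \<zeta>)) has_field_derivative partial_x w (cnj \<zeta>)) (at \<zeta>)" if "\<zeta> \<in> \<L>" for \<zeta>
  proof -
    have c: "cnj \<zeta> \<in> \<H>" using that by (simp add: upper_half_plane_def lower_half_plane_def)
    have "partial_x w (cnj \<zeta>) = \<i> * partial_y w (cnj \<zeta>)"
      using assms(2)[OF c] by (simp add: del_z_def)
    then have y: "partial_y w (cnj \<zeta>) = - \<i> * partial_x w (cnj \<zeta>)" by simp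
    have "((\<lambda>\<zeta>. w (cnj \<zeta>)) has_derivative (\<lambda>h. of_real (Re (cnj h)) * partial_x w (cnj \<zeta>)
       + of_real (Im (cnj h)) * partial_y w (cnj \<zeta>))) (at \<zeta>)"
      by (rule diff_chain_at[OF bounded_linear_imp_has_derivative[OF bounded_linear_cnj]
          differentiable_partials(3)[OF assms(1)[OF c]], unfolded o_def])
    moreover have "of_real (Re (cnj h)) * partial_x w (cnj \<zeta>)
       + of_real (Im (cnj h)) * partial_y w (cnj \<zeta>) = partial_x w (cnj \<zeta>) * h" for h
      unfolding y by (subst (3) complex_eq[of h]) (simp add: algebra_simps)
    ultimately show ?thesis by (simp add: has_field_derivative_def mult_commute_abs)
  qed
  then show ?thesis using holomorphic_on_open[OF open_half_planes(2)] by blast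
qed

lemma alpha_harmonic_flux:
  assumes "alpha_harmonic \<alpha> u"
  obtains G where "G holomorphic_on \<L>"
    "\<And>z. z \<in> \<H> \<Longrightarrow> delbar_z u z = of_real (Im z powr \<alpha>) * G (cnj z)"
proof -
  define w where "w z = of_real (Im z powr (- \<alpha>)) * delbar_z u z" for z
  have d: "w differentiable (at z)" if z: "z \<in> \<H>" for z
  proof -
    have y: "Im z > 0" using z by (simp add: upper_half_plane_def)
    have "(\<lambda>z. Im z powr (- \<alpha>)) differentiable (at z)"
    proof -
      have "((\<lambda>z. Im z powr (- \<alpha>)) has_derivative (\<lambda>h. Im h * (- \<alpha> * Im z powr (- \<alpha> - 1)))) (at z)"
        using diff_chain_at[OF bounded_linear_imp_has_derivative[OF bounded_linear_Im]
            has_real_derivative_powr[OF y, of "- \<alpha>", unfolded has_field_derivative_def]]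
        by (simp add: o_def mult_ac)
      then show ?thesis by (auto simp: differentiable_def)
    qed
    then have 1: "(\<lambda>z. complex_of_real (Im z powr (- \<alpha>))) differentiable (at z)"
      by (auto simp: differentiable_def intro!: has_derivative_of_real)
    have "partial_x u differentiable (at z)" "partial_y u differentiable (at z)"
      using assms z by (auto simp: alpha_harmonic_def C2_on_def C1_on_def)
    then have "(\<lambda>z. (partial_x u z + \<i> * partial_y u z) * (1 / 2)) differentiable (at z)"
      by (intro differentiable_mult differentiable_add) auto
    with 1 show ?thesis unfolding w_def delbar_z_def
      by (intro differentiable_mult) auto
  qed
  show thesis
  proof (rule that[of "\<lambda>\<zeta>. w (cnj \<zeta>)"])
    show "(\<lambda>\<zeta>. w (cnj \<zeta>)) holomorphic_on \<L>"
      using assms by (intro antiholomorphic_if_del_zero d) (auto simp: alpha_harmonic_def w_def[abs_def])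
    show "delbar_z u z = of_real (Im z powr \<alpha>) * w (cnj (cnj z))" if "z \<in> \<H>" for z
    proof -
      have "of_real (Im z powr \<alpha>) * of_real (Im z powr - \<alpha>) = (1::complex)"
        using that by (simp add: upper_half_plane_def of_real_mult[symmetric] powr_add[symmetric] del: of_real_mult)
      then show ?thesis by (simp add: w_def mult.assoc[symmetric])
    qed
  qed
qed

section \<open>Mollification of the equation and of the growth condition\<close>

lemma continuous_on_compose_cnj:
  assumes "continuous_on \<L> G"
  shows "continuous_on \<H> (\<lambda>z. G (cnj z))"
  by (rule continuous_on_compose2[OF assms])
    (auto intro!: continuous_intros simp: upper_half_plane_def lower_half_plane_def)

lemma mollified_harmonic_tower:
  assumes T: "test_tower A D" and u: "C1_on \<H> u"
    and G: "G holomorphic_on \<L>"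
    and eq: "\<And>z. z \<in> \<H> \<Longrightarrow> delbar_z u z = of_real (Im z powr \<alpha>) * G (cnj z)"
  shows "harmonic_tower \<alpha> (\<lambda>k. conv A (D k) u) (\<lambda>k. conv A (D k) (\<lambda>z. G (cnj z)))"
proof -
  note hor = horizontal_upper_half_plane and Dc = test_tower_continuous[OF T]
  define w w' where "w z = G (cnj z)" and "w' z = deriv G (cnj z)" for z
  have ud: "u differentiable (at z)" if "z \<in> \<H>" for z
    using u that by (auto simp: C1_on_def)
  have uc: "continuous_on \<H> u"
    by (intro continuous_at_imp_continuous_on ballI differentiable_imp_continuous_within ud)
  have uxc: "continuous_on \<H> (partial_x u)" "continuous_on \<H> (partial_y u)"
    using u by (auto simp: C1_on_def)
  have wc: "continuous_on \<H> w"
    unfolding w_def by (rule continuous_on_compose_cnj[OF holomorphic_on_imp_continuous_on[OF G]])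
  have w'c: "continuous_on \<H> w'"
    unfolding w'_def
    by (rule continuous_on_compose_cnj[OF holomorphic_on_imp_continuous_on[OF holomorphic_deriv[OF G open_half_planes(2)]]])
  have dw: "dir_deriv e w (cnj e * w' z) z" if z: "z \<in> \<H>" for z e
  proof -
    have "cnj z \<in> \<L>" using z by (simp add: upper_half_plane_def lower_half_plane_def)
    then have 1: "(G has_field_derivative w' z) (at (cnj z))"
      unfolding w'_def using G open_half_planes(2) holomorphic_derivI by blast
    have "((\<lambda>s. cnj z + of_real s * cnj e) has_vector_derivative cnj e) (at 0)"
      by (auto intro!: derivative_eq_intros simp: has_vector_derivative_def scaleR_conv_of_real)
    from field_vector_diff_chain_at[OF this, of G "w' z"] 1
    show ?thesis by (simp add: dir_deriv_def w_def o_def)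
  qed
  \<comment> \<open>This form is a combination with coefficients that depend on Im z alone, as
    \<open>conv_cong_add\<close> requires.\<close>
  have uy: "partial_y u z = \<i> * partial_x u z - 2 * \<i> * of_real (Im z powr \<alpha>) * w z" if z: "z \<in> \<H>" for z
  proof -
    have e2: "partial_x u z + \<i> * partial_y u z = 2 * of_real (Im z powr \<alpha>) * w z"
      using eq[OF z] by (simp add: delbar_z_def w_def)
    have "partial_y u z = \<i> * partial_x u z - \<i> * (partial_x u z + \<i> * partial_y u z)"
      by (simp add: algebra_simps)
    then show ?thesis unfolding e2 by simp
  qed
  have dxu: "dir_deriv 1 u (partial_x u z) z" and dyu: "dir_deriv \<i> u (partial_y u z) z"
    if "z \<in> \<H>" for z
    using differentiable_partials[OF ud[OF that]] by blast+
  have dxw: "dir_deriv 1 w (w' z) z" and dyw: "dir_deriv \<i> w (- \<i> * w' z) z" if "z \<in> \<H>" for z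
    using dw[OF that, of 1] dw[OF that, of \<i>] by simp_all
  show ?thesis
    unfolding harmonic_tower_def w_def[symmetric]
  proof (intro allI conjI ballI)
    fix k
    show "continuous_on \<H> (conv A (D k) u)" "continuous_on \<H> (conv A (D k) w)"
      by (rule conv_continuous[OF hor uc Dc] conv_continuous[OF hor wc Dc])+
    fix z assume z: "z \<in> \<H>"
    have ux: "conv A (D k) (partial_x u) z = conv A (D (Suc k)) u z"
      by (rule conv_by_parts[OF T hor uc uxc(1) dxu z])
    have wx: "conv A (D k) w' z = conv A (D (Suc k)) w z"
      by (rule conv_by_parts[OF T hor wc w'c dxw z])
    show "dir_deriv 1 (conv A (D k) u) (conv A (D (Suc k)) u z) z"
      unfolding ux[symmetric] by (rule conv_dir_deriv[OF hor uc uxc(1) Dc dxu z])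
    show "dir_deriv 1 (conv A (D k) w) (conv A (D (Suc k)) w z) z"
      unfolding wx[symmetric] by (rule conv_dir_deriv[OF hor wc w'c Dc dxw z])
    have "conv A (D k) (partial_y u) z = \<i> * conv A (D k) (partial_x u) z
       + (- 2 * \<i> * of_real (Im z powr \<alpha>)) * conv A (D k) w z"
      using z by (intro conv_cong_add[OF hor uxc(1) wc Dc z] trans[OF uy])
         (auto simp: upper_half_plane_def)
    moreover have "dir_deriv \<i> (conv A (D k) u) (conv A (D k) (partial_y u) z) z"
      by (rule conv_dir_deriv[OF hor uc uxc(2) Dc dyu z])
    ultimately show "dir_deriv \<i> (conv A (D k) u) (\<i> * conv A (D (Suc k)) u z - 2 * \<i> * of_real (Im z powr \<alpha>) * conv A (D k) w z) z"
      using ux by simp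
    have "conv A (D k) (\<lambda>z. - \<i> * w' z) z = (- \<i>) * conv A (D k) w' z + 0 * conv A (D k) w' z"
      by (intro conv_cong_add[OF hor w'c w'c Dc z]) auto
    moreover have "dir_deriv \<i> (conv A (D k) w) (conv A (D k) (\<lambda>z. - \<i> * w' z) z) z"
      by (rule conv_dir_deriv[OF hor wc _ Dc dyw z]) (intro continuous_on_mult_left w'c)
    ultimately show "dir_deriv \<i> (conv A (D k) w) (- \<i> * conv A (D (Suc k)) w z) z"
      using wx by simp
  qed
qed

text \<open>Temperate growth gives no information for |z| \<le> R, so over the box |x| \<le> R + A,
  y \<le> R the uniform boundedness lemma supplies the estimate. The margin A ensures that off the
  box every translate z - t with |t| \<le> A has modulus above R.\<close>

lemma mollified_growth:
  assumes T: "test_tower A D" and u: "continuous_on \<H> u"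
    and z0: "zero_distributional_boundary_value u"
    and C: "C > 0" and R: "R > 0" and N: "N > 0"
    and g: "\<And>z. z \<in> \<H> \<Longrightarrow> norm z > R \<Longrightarrow> norm (u z) \<le> C * ((norm z)\<^sup>2 / Im z) powr N"
  shows "\<exists>C. \<forall>z\<in>\<H>. norm (conv A (D k) u z) \<le> C * (1 + norm z) powr (2 * N) * (1 + Im z powr (- N))"
proof -
  note hor = horizontal_upper_half_plane and Dc = test_tower_continuous[OF T]
  have A: "A > 0" using T by (simp add: test_tower_def)
  obtain C1 where C1: "\<And>x y. \<bar>x\<bar> \<le> R + A \<Longrightarrow> 0 < y \<Longrightarrow> y \<le> R \<Longrightarrow> norm (conv A (D k) u (Complex x y)) \<le> C1"
    using boundary_bounded[OF test_tower_shift[OF T, of k] u z0, of "R + A" R] by auto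
  define I where "I = integral {-A..A} (\<lambda>t. norm (D k t))"
  have I0: "I \<ge> 0" unfolding I_def
    by (rule integral_nonneg) (auto intro!: integrable_continuous_interval continuous_intros Dc)
  define C2 where "C2 = C * (1 + A) powr (2 * N) * I"
  have C20: "C2 \<ge> 0" using C I0 by (simp add: C2_def)
  have "norm (conv A (D k) u z) \<le> (\<bar>C1\<bar> + C2) * (1 + norm z) powr (2 * N) * (1 + Im z powr (- N))"
    if z: "z \<in> \<H>" for z
  proof -
    have y: "Im z > 0" using z by (simp add: upper_half_plane_def)
    have L1: "(1 + norm z) powr (2 * N) \<ge> 1" using N by (intro ge_one_powr_ge_zero) auto
    show ?thesis
    proof (cases "\<bar>Re z\<bar> \<le> R + A \<and> Im z \<le> R")
      case True
      have "norm (conv A (D k) u z) \<le> \<bar>C1\<bar> * 1 * 1" using C1[of "Re z" "Im z"] True y by simp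
      also have "\<dots> \<le> (\<bar>C1\<bar> + C2) * (1 + norm z) powr (2 * N) * (1 + Im z powr (- N))"
        using C20 L1 by (intro mult_mono mult_nonneg_nonneg) auto
      finally show ?thesis .
    next
      case False
      have "norm (u (z - of_real t)) \<le> C * (1 + A) powr (2 * N) * (1 + norm z) powr (2 * N) * Im z powr (- N)"
        if t: "t \<in> {-A..A}" for t
      proof -
        have "norm (z - of_real t) > R"
          using False abs_Re_le_cmod[of "z - of_real t"] abs_Im_le_cmod[of "z - of_real t"] t by auto
        then have "norm (u (z - of_real t)) \<le> C * ((norm (z - of_real t))\<^sup>2 / Im z) powr N"
          using g[of "z - of_real t"] z by (simp add: upper_half_plane_def)
        also have "\<dots> \<le> C * (((1 + A) * (1 + norm z))\<^sup>2 / Im z) powr N"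
        proof -
          have "norm (z - of_real t) \<le> norm z + A"
            using norm_triangle_ineq4[of z "of_real t"] t by auto
          also have "\<dots> \<le> (1 + A) * (1 + norm z)" using A by (simp add: algebra_simps)
          finally show ?thesis using y C N
            by (intro mult_left_mono powr_mono2 divide_right_mono power_mono) auto
        qed
        also have "(((1 + A) * (1 + norm z))\<^sup>2 / Im z) powr N
            = (1 + A) powr (2 * N) * (1 + norm z) powr (2 * N) * Im z powr (- N)"
        proof -
          have "(a\<^sup>2) powr N = a powr (2 * N)" if "a \<ge> 0" for a
            using that unfolding power2_eq_square mult_2 powr_add by (simp add: powr_mult)
          then have "(((1 + A) * (1 + norm z))\<^sup>2) powr N = ((1 + A) * (1 + norm z)) powr (2 * N)"
            using A by simp
          then show ?thesis using A y
            by (simp add: powr_divide powr_mult powr_minus) (simp add: divide_inverse)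
        qed
        finally show ?thesis by (simp add: mult_ac)
      qed
      then have "norm (conv A (D k) u z) \<le> C * (1 + A) powr (2 * N) * (1 + norm z) powr (2 * N) * Im z powr (- N) * I"
        unfolding I_def by (rule conv_bound[OF hor u Dc z])
      also have "\<dots> = C2 * (1 + norm z) powr (2 * N) * Im z powr (- N)" by (simp add: C2_def mult_ac)
      also have "\<dots> \<le> (\<bar>C1\<bar> + C2) * (1 + norm z) powr (2 * N) * (1 + Im z powr (- N))"
        using C20 by (intro mult_mono) auto
      finally show ?thesis .
    qed
  qed
  then show ?thesis by blast
qed

section \<open>Integrals over horizontal lines\<close>

lemma integrable_inverse_1_plus_sq: "integrable lborel (\<lambda>x::real. 1 / (1 + x\<^sup>2))"
proof -
  have "set_integrable lborel (einterval (-\<infinity>) \<infinity>) (\<lambda>x. 1 / (1 + x\<^sup>2))"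
  proof (rule interval_integral_FTC_nonneg[where F = arctan and A = "- (pi / 2)" and B = "pi / 2"])
    show "DERIV arctan x :> 1 / (1 + x\<^sup>2)" for x
      using DERIV_arctan[of x] by (simp add: inverse_eq_divide)
    show "isCont (\<lambda>x. 1 / (1 + x\<^sup>2)) x" for x :: real
      using sum_power2_gt_zero_iff[of 1 x] by (intro continuous_intros) auto
    show "((arctan \<circ> real_of_ereal) \<longlongrightarrow> - (pi / 2)) (at_right (- \<infinity>))"
      using tendsto_arctan_at_bot by (simp add: ereal_tendsto_simps)
    show "((arctan \<circ> real_of_ereal) \<longlongrightarrow> pi / 2) (at_left \<infinity>)"
      using tendsto_arctan_at_top by (simp add: ereal_tendsto_simps)
  qed (auto intro!: AE_I2)
  then show ?thesis by (simp add: set_integrable_def einterval_def)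
qed

text \<open>The substitution r = t / (1 + t) turns this weight into r^\<alpha> dr on (0, 1), which
  yields an elementary primitive. It majorises t^\<alpha> (1 + t)^(-\<alpha>-1-k) for all k \<ge>
  1.\<close>

abbreviation beta_weight :: "real \<Rightarrow> real \<Rightarrow> real" where
  "beta_weight \<alpha> t \<equiv> t powr \<alpha> * (1 + t) powr (- \<alpha> - 2)"

lemma integrable_beta_weight:
  assumes "\<alpha> > (-1::real)"
  shows "set_integrable lborel {0<..} (\<lambda>t. beta_weight \<alpha> t)"
proof -
  have e: "einterval 0 \<infinity> = {0<..}" by (auto simp: einterval_def)
  have lim: "((\<lambda>t. (t / (1 + t)) powr (\<alpha> + 1) / (\<alpha> + 1)) \<longlongrightarrow> 1 powr (\<alpha> + 1) / (\<alpha> + 1)) at_top"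
    using assms by (intro tendsto_intros) (real_asymp | simp)+
  have lim0: "((\<lambda>t. (t / (1 + t)) powr (\<alpha> + 1) / (\<alpha> + 1)) \<longlongrightarrow> 0 / (\<alpha> + 1)) (at_right 0)"
  proof (intro tendsto_divide)
    have "((\<lambda>t::real. t / (1 + t)) \<longlongrightarrow> 0 / (1 + 0)) (at_right 0)"
      by (intro tendsto_intros) auto
    then have "((\<lambda>t::real. (t / (1 + t)) powr (\<alpha> + 1)) \<longlongrightarrow> 0 powr (\<alpha> + 1)) (at_right 0)"
      using assms by (intro tendsto_powr'[OF _ tendsto_const]) (auto simp: eventually_at_filter)
    then show "((\<lambda>t::real. (t / (1 + t)) powr (\<alpha> + 1)) \<longlongrightarrow> 0) (at_right 0)" by simp
  qed (use assms in auto)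
  have "set_integrable lborel (einterval 0 \<infinity>) (\<lambda>t. beta_weight \<alpha> t)"
  proof (rule interval_integral_FTC_nonneg[where F = "\<lambda>t. (t / (1 + t)) powr (\<alpha> + 1) / (\<alpha> + 1)"
        and A = "0 / (\<alpha> + 1)" and B = "1 powr (\<alpha> + 1) / (\<alpha> + 1)"])
    fix t :: real assume "0 < ereal t"
    then have t: "t > 0" by simp
    have d: "((\<lambda>t. t / (1 + t)) has_real_derivative 1 / (1 + t)\<^sup>2) (at t)"
      using t by (auto intro!: derivative_eq_intros simp: field_simps power2_eq_square)
    have "((\<lambda>t. (t / (1 + t)) powr (\<alpha> + 1)) has_real_derivative (\<alpha> + 1) * (t / (1 + t)) powr (\<alpha> + 1 - 1) * (1 / (1 + t)\<^sup>2)) (at t)"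
      using t by (intro DERIV_chain2[OF has_real_derivative_powr d]) auto
    then have "((\<lambda>t. (t / (1 + t)) powr (\<alpha> + 1) / (\<alpha> + 1)) has_real_derivative
       (\<alpha> + 1) * (t / (1 + t)) powr (\<alpha> + 1 - 1) * (1 / (1 + t)\<^sup>2) / (\<alpha> + 1)) (at t)"
      by (rule DERIV_cdivide)
    moreover have "(\<alpha> + 1) * (t / (1 + t)) powr (\<alpha> + 1 - 1) * (1 / (1 + t)\<^sup>2) / (\<alpha> + 1) = beta_weight \<alpha> t"
    proof -
      have A: "(1 + t) powr (- \<alpha> - 2) = inverse ((1 + t) powr \<alpha>) * inverse ((1 + t)\<^sup>2)"
        using t by (simp add: powr_diff powr_minus powr_numeral divide_inverse)
      have B: "(t / (1 + t)) powr (\<alpha> + 1 - 1) = t powr \<alpha> * inverse ((1 + t) powr \<alpha>)"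
        using t by (simp add: powr_divide inverse_eq_divide)
      show ?thesis unfolding A B mult.assoc using assms by (simp add: inverse_eq_divide)
    qed
    ultimately show "((\<lambda>t. (t / (1 + t)) powr (\<alpha> + 1) / (\<alpha> + 1)) has_real_derivative beta_weight \<alpha> t) (at t)"
      by simp
    show "isCont (\<lambda>t. beta_weight \<alpha> t) t"
      using t by (intro continuous_intros) auto
  next
    show "(((\<lambda>t. (t / (1 + t)) powr (\<alpha> + 1) / (\<alpha> + 1)) \<circ> real_of_ereal) \<longlongrightarrow> 0 / (\<alpha> + 1)) (at_right 0)"
      using lim0 by (simp add: ereal_tendsto_simps zero_ereal_def)
    show "(((\<lambda>t. (t / (1 + t)) powr (\<alpha> + 1) / (\<alpha> + 1)) \<circ> real_of_ereal) \<longlongrightarrow> 1 powr (\<alpha> + 1) / (\<alpha> + 1)) (at_left \<infinity>)"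
      using lim by (simp add: ereal_tendsto_simps)
  qed (auto intro!: AE_I2)
  then show ?thesis unfolding e .
qed

lemma integrable_line:
  fixes g :: "real \<Rightarrow> complex"
  assumes "continuous_on UNIV g" "\<And>x. norm (g x) \<le> C / (1 + x\<^sup>2)"
  shows "integrable lborel g"
proof (rule Bochner_Integration.integrable_bound)
  show "integrable lborel (\<lambda>x. C * (1 / (1 + x\<^sup>2)))"
    by (intro integrable_mult_right integrable_inverse_1_plus_sq)
  show "g \<in> borel_measurable lborel"
    using borel_measurable_continuous_onI[OF assms(1)] by simp
  show "AE x in lborel. norm (g x) \<le> norm (C * (1 / (1 + x\<^sup>2)))"
  proof (rule AE_I2)
    fix x
    show "norm (g x) \<le> norm (C * (1 / (1 + x\<^sup>2)))"
      using order_trans[OF assms(2)[of x] abs_ge_self] by simp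
  qed
qed

text \<open>The bound depends on g through C alone, so truncation is uniform over a family of lines
  that share the constant.\<close>

lemma truncation_error:
  fixes g :: "real \<Rightarrow> complex"
  assumes g: "continuous_on UNIV g" "\<And>x. norm (g x) \<le> C / (1 + x\<^sup>2)"
  shows "norm (integral {-X..X} g - (\<integral>x. g x \<partial>lborel)) \<le> C * (\<integral>x. indicator (- {-X..X}) x * (1 / (1 + x\<^sup>2)) \<partial>lborel)"
proof -
  note gi = integrable_line[OF g]
  have si: "set_integrable lborel {-X..X} g"
    by (intro borel_integrable_atLeastAtMost' continuous_on_subset[OF g(1)]) auto
  have ii: "integrable lborel (\<lambda>x::real. indicator (- {-X..X}) x * (1 / (1 + x\<^sup>2)))"
    using integrable_real_mult_indicator[OF _ integrable_inverse_1_plus_sq, of "- {-X..X}"]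
    by (simp add: mult.commute)
  have "integral {-X..X} g = (LINT x:{-X..X}|lborel. g x)"
    using set_borel_integral_eq_integral(2)[OF si] by simp
  then have "integral {-X..X} g - (\<integral>x. g x \<partial>lborel) = (\<integral>x. indicator {-X..X} x *\<^sub>R g x - g x \<partial>lborel)"
    using si gi by (simp add: set_lebesgue_integral_def set_integrable_def Bochner_Integration.integral_diff)
  also have "norm \<dots> \<le> (\<integral>x. C * (indicator (- {-X..X}) x * (1 / (1 + x\<^sup>2))) \<partial>lborel)"
  proof (rule order_trans[OF integral_norm_bound integral_mono])
    show "integrable lborel (\<lambda>x. norm (indicator {-X..X} x *\<^sub>R g x - g x))"
      using si gi by (simp add: set_integrable_def)
    show "integrable lborel (\<lambda>x. C * (indicator (- {-X..X}) x * (1 / (1 + x\<^sup>2))))"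
      using ii by (rule integrable_mult_right)
    show "norm (indicator {-X..X} x *\<^sub>R g x - g x) \<le> C * (indicator (- {-X..X}) x * (1 / (1 + x\<^sup>2)))" for x
      using g(2)[of x] by (cases "x \<in> {-X..X}") auto
  qed
  also have "\<dots> = C * (\<integral>x. indicator (- {-X..X}) x * (1 / (1 + x\<^sup>2)) \<partial>lborel)"
    by (rule integral_mult_right_zero)
  finally show ?thesis .
qed

lemma truncation_error_tendsto_0:
  "(\<lambda>n. \<integral>x. indicator (- {- real n..real n}) x * (1 / (1 + x\<^sup>2)) \<partial>lborel) \<longlonglongrightarrow> (0::real)"
proof -
  have "(\<lambda>n. \<integral>x. indicator (- {- real n..real n}) x * (1 / (1 + x\<^sup>2)) \<partial>lborel) \<longlonglongrightarrow> integral\<^sup>L lborel (\<lambda>x::real. 0::real)"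
  proof (rule Bochner_Integration.integral_dominated_convergence[where w = "\<lambda>x. 1 / (1 + x\<^sup>2)"])
    show "AE x in lborel. (\<lambda>n. indicator (- {- real n..real n}) x * (1 / (1 + x\<^sup>2))) \<longlonglongrightarrow> (0::real)"
    proof (rule AE_I2)
      fix x :: real
      obtain N :: nat where N: "\<bar>x\<bar> \<le> N" using real_arch_simple by blast
      have "indicator (- {- real n..real n}) x * (1 / (1 + x\<^sup>2)) = (0::real)" if "n \<ge> N" for n
        using N that by (auto simp: indicator_def abs_le_iff)
      then show "(\<lambda>n. indicator (- {- real n..real n}) x * (1 / (1 + x\<^sup>2))) \<longlonglongrightarrow> (0::real)"
        by (intro tendsto_eventually) (auto simp: eventually_sequentially)
    qed
    show "AE x in lborel. norm (indicator (- {- real n..real n}) x * (1 / (1 + x\<^sup>2))) \<le> 1 / (1 + x\<^sup>2)" for n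
      by (intro AE_I2) (auto simp: indicator_def)
  qed (use integrable_inverse_1_plus_sq in auto)
  then show ?thesis by simp
qed

lemma truncated_integral_tendsto:
  fixes g :: "real \<Rightarrow> complex"
  assumes g: "continuous_on UNIV g" "\<And>x. norm (g x) \<le> C / (1 + x\<^sup>2)"
  shows "(\<lambda>n. integral {- real n..real n} g) \<longlonglongrightarrow> (\<integral>x. g x \<partial>lborel)"
proof -
  have "(\<lambda>n. integral {- real n..real n} g - (\<integral>x. g x \<partial>lborel)) \<longlonglongrightarrow> 0"
    using tendsto_mult_right_zero[OF truncation_error_tendsto_0, of C]
    by (rule Lim_null_comparison[rotated]) (intro always_eventually allI truncation_error[OF g])
  then show ?thesis by (simp add: LIM_zero_iff)
qed

section \<open>Green's formula in a strip\<close>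

lemma continuous_on_line:
  fixes f :: "complex \<Rightarrow> complex"
  assumes "continuous_on {z. y1 \<le> Im z \<and> Im z \<le> y2} f" "y1 \<le> y" "y \<le> y2"
  shows "continuous_on S (\<lambda>x. f (Complex x y))"
  by (rule continuous_on_compose2[OF assms(1)])
     (use assms(2,3) in \<open>auto simp: Complex_eq intro!: continuous_intros\<close>)

text \<open>Green's formula for f_y = p_x + q on the rectangles [-n, n] by [y1, y2], where the decay
  of p removes the vertical sides as n grows. Keeping p and q apart covers both a holomorphic
  integrand, with q = 0, and the product of the kernel with U, where q carries the flux.\<close>

lemma green_strip:
  fixes f fy p q :: "complex \<Rightarrow> complex"
  defines "S y1 y2 \<equiv> {z. y1 \<le> Im z \<and> Im z \<le> y2}"
  assumes y: "y1 < y2"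
    and f: "continuous_on (S y1 y2) f" and fyc: "continuous_on (S y1 y2) fy" and q: "continuous_on (S y1 y2) q"
    and dy: "\<And>x y. y1 \<le> y \<Longrightarrow> y \<le> y2 \<Longrightarrow> ((\<lambda>t. f (Complex x t)) has_vector_derivative fy (Complex x y)) (at y)"
    and dx: "\<And>x y. y1 \<le> y \<Longrightarrow> y \<le> y2 \<Longrightarrow>
       ((\<lambda>s. p (Complex s y)) has_vector_derivative fy (Complex x y) - q (Complex x y)) (at x)"
    and bf: "\<And>z. z \<in> S y1 y2 \<Longrightarrow> norm (f z) \<le> C / (1 + (Re z)\<^sup>2)"
    and bp: "\<And>z. z \<in> S y1 y2 \<Longrightarrow> norm (p z) \<le> C / (1 + (Re z)\<^sup>2)"
    and bq: "\<And>z. z \<in> S y1 y2 \<Longrightarrow> norm (q z) \<le> C / (1 + (Re z)\<^sup>2)"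
  shows "((\<lambda>y. \<integral>x. q (Complex x y) \<partial>lborel) has_integral
     ((\<integral>x. f (Complex x y2) \<partial>lborel) - (\<integral>x. f (Complex x y1) \<partial>lborel))) {y1..y2}"
proof -
  have in_S: "Complex x y \<in> S y1 y2 \<longleftrightarrow> y1 \<le> y \<and> y \<le> y2" for x y by (simp add: S_def)
  have qc: "continuous_on T (\<lambda>x. q (Complex x y))" and fc: "continuous_on T (\<lambda>x. f (Complex x y))"
    if "y1 \<le> y" "y \<le> y2" for y T
    using continuous_on_line[OF q[unfolded S_def] that] continuous_on_line[OF f[unfolded S_def] that] by auto
  have two: "continuous_on ({y1..y2} \<times> cbox a b) (\<lambda>(y, x). g (Complex x y))"
    if "continuous_on (S y1 y2) g" for g :: "complex \<Rightarrow> complex" and a b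
    unfolding case_prod_beta
    by (rule continuous_on_compose2[OF that]) (auto simp: S_def Complex_eq intro!: continuous_intros)
  define Q where "Q n y = integral {- real n..real n} (\<lambda>x. q (Complex x y))" for n y
  define E where "E n y = p (Complex (real n) y) - p (Complex (- real n) y)" for n y
  define M where "M n y = integral {- real n..real n} (\<lambda>x. f (Complex x y))" for n y
  have EQ: "integral {- real n..real n} (\<lambda>x. fy (Complex x y)) = E n y + Q n y" if yy: "y1 \<le> y" "y \<le> y2" for n y
  proof -
    have "((\<lambda>x. fy (Complex x y) - q (Complex x y)) has_integral E n y) {- real n..real n}"
      unfolding E_def
      by (rule fundamental_theorem_of_calculus) (simp, rule has_vector_derivative_at_within[OF dx[OF yy]])
    moreover have "(\<lambda>x. q (Complex x y)) integrable_on {- real n..real n}"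
      by (rule integrable_continuous_interval[OF qc[OF yy]])
    ultimately have "((\<lambda>x. (fy (Complex x y) - q (Complex x y)) + q (Complex x y)) has_integral E n y + Q n y) {- real n..real n}"
      unfolding Q_def by (intro has_integral_add integrable_integral)
    then show ?thesis by (simp add: integral_unique)
  qed
  have M': "(M n has_vector_derivative (E n y + Q n y)) (at y within {y1..y2})" if yy: "y \<in> {y1..y2}" for n y
  proof -
    have "((\<lambda>y. integral (cbox (- real n) (real n)) (\<lambda>x. f (Complex x y))) has_vector_derivative
        integral (cbox (- real n) (real n)) (\<lambda>x. fy (Complex x y))) (at y within {y1..y2})"
      by (rule leibniz_rule_vector_derivative)
         (use yy in \<open>auto intro!: has_vector_derivative_at_within[OF dy] two[OF fyc, unfolded box_real] integrable_continuous_interval fc\<close>)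
    then show ?thesis using EQ[of y n] yy by (simp add: M_def[abs_def])
  qed
  have FTC: "((\<lambda>y. E n y + Q n y) has_integral (M n y2 - M n y1)) {y1..y2}" for n
    by (rule fundamental_theorem_of_calculus) (use y M' in auto)
  have "norm (q (Complex x y)) \<le> C / (1 + x\<^sup>2)" "norm (f (Complex x y)) \<le> C / (1 + x\<^sup>2)" "norm (p (Complex x y)) \<le> C / (1 + x\<^sup>2)"
    if "y1 \<le> y" "y \<le> y2" for x y
    using bq[of "Complex x y"] bf[of "Complex x y"] bp[of "Complex x y"] that by (auto simp: in_S)
  note b = this
  \<comment> \<open>One error for all heights: the first summand comes from the two vertical sides,
    the second from the truncated tails of q. Uniformity in y lets the limit pass under the integral
    over [y1, y2].\<close>
  define err where "err n = 2 * C * (1 / (1 + (real n)\<^sup>2)) + C * (\<integral>x. indicator (- {- real n..real n}) x * (1 / (1 + x\<^sup>2)) \<partial>lborel)" for n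
  have "(\<lambda>n. 1 / (1 + (real n)\<^sup>2)) \<longlonglongrightarrow> 0" by real_asymp
  then have "err \<longlonglongrightarrow> 2 * C * 0 + C * 0"
    unfolding err_def by (intro tendsto_intros truncation_error_tendsto_0)
  then have err0: "err \<longlonglongrightarrow> 0" by simp
  have ub: "norm (E n y + Q n y - (\<integral>x. q (Complex x y) \<partial>lborel)) \<le> err n" if yy: "y1 \<le> y" "y \<le> y2" for n y
  proof -
    have "norm (E n y) \<le> C / (1 + (real n)\<^sup>2) + C / (1 + (- real n)\<^sup>2)"
      unfolding E_def by (intro order_trans[OF norm_triangle_ineq4] add_mono b yy)
    moreover have "norm (Q n y - (\<integral>x. q (Complex x y) \<partial>lborel)) \<le> C * (\<integral>x. indicator (- {- real n..real n}) x * (1 / (1 + x\<^sup>2)) \<partial>lborel)"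
      unfolding Q_def by (intro truncation_error qc b yy)
    ultimately show ?thesis
      using norm_triangle_ineq[of "E n y" "Q n y - (\<integral>x. q (Complex x y) \<partial>lborel)"] by (simp add: err_def add_diff_eq)
  qed
  have "uniform_limit (cbox y1 y2) (\<lambda>n y. E n y + Q n y) (\<lambda>y. \<integral>x. q (Complex x y) \<partial>lborel) sequentially"
  proof (rule uniform_limitI)
    fix e :: real assume "e > 0"
    have "\<forall>\<^sub>F n in sequentially. err n < e"
      using order_tendstoD(2)[OF err0 \<open>e > 0\<close>] .
    then show "\<forall>\<^sub>F n in sequentially. \<forall>y\<in>cbox y1 y2. dist (E n y + Q n y) (\<integral>x. q (Complex x y) \<partial>lborel) < e"
    proof (rule eventually_mono, intro ballI)
      fix n y assume "err n < e" "y \<in> cbox y1 y2"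
      then show "dist (E n y + Q n y) (\<integral>x. q (Complex x y) \<partial>lborel) < e"
        using ub[of y n] by (simp add: dist_norm)
    qed
  qed
  then obtain I J where I: "\<And>n. ((\<lambda>y. E n y + Q n y) has_integral I n) (cbox y1 y2)"
      "((\<lambda>y. \<integral>x. q (Complex x y) \<partial>lborel) has_integral J) (cbox y1 y2)" "I \<longlonglongrightarrow> J"
  proof (rule uniform_limit_integral_cbox)
    show "continuous_on (cbox y1 y2) (\<lambda>y. E n y + Q n y)" for n
    proof -
      have "continuous_on {y1..y2} (\<lambda>y. integral (cbox (- real n) (real n)) (\<lambda>x. fy (Complex x y)))"
        by (rule integral_continuous_on_param[OF two[OF fyc]])
      then show ?thesis unfolding box_real by (rule continuous_on_eq) (use EQ in auto)
    qed
  qed auto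
  have In: "I n = M n y2 - M n y1" for n
    using has_integral_unique[OF I(1)[of n]] FTC[of n] by simp
  have "(\<lambda>n. M n y2 - M n y1) \<longlonglongrightarrow> (\<integral>x. f (Complex x y2) \<partial>lborel) - (\<integral>x. f (Complex x y1) \<partial>lborel)"
    unfolding M_def using y by (intro tendsto_diff truncated_integral_tendsto[OF fc b(2)]) auto
  then have "J = (\<integral>x. f (Complex x y2) \<partial>lborel) - (\<integral>x. f (Complex x y1) \<partial>lborel)"
    by (rule LIMSEQ_unique[OF I(3)[unfolded In[abs_def]]])
  then show ?thesis using I(2) by simp
qed

section \<open>Two kernel integrals\<close>

lemma norm_shift_lower_bound:
  fixes z a :: complex
  assumes "\<eta> > 0" "\<eta> \<le> Im z - Im a"
  shows "1 + norm z \<le> ((1 + norm a) / \<eta> + 1) * norm (z - a)"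
proof -
  have "\<eta> \<le> norm (z - a)" using assms abs_Im_le_cmod[of "z - a"] by auto
  then have "(1 + norm a) / \<eta> * \<eta> \<le> (1 + norm a) / \<eta> * norm (z - a)"
    using assms(1) by (intro mult_left_mono) auto
  then have "1 + norm a \<le> (1 + norm a) / \<eta> * norm (z - a)" using assms(1) by simp
  moreover have "norm z \<le> norm (z - a) + norm a" using norm_triangle_ineq[of "z - a" a] by simp
  ultimately show ?thesis by (simp add: algebra_simps)
qed

lemma norm_powr_of_real: "z \<noteq> 0 \<Longrightarrow> norm (z powr of_real r) = norm z powr r"
  for z :: complex
  by (simp add: norm_powr_real_powr')

lemma power_kernel_bound:
  fixes z a :: complex
  assumes \<eta>: "\<eta> > 0" "\<eta> \<le> Im z - Im a" and "s \<ge> 0"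
  shows "norm ((z - a) powr of_real (- s)) \<le> ((1 + norm a) / \<eta> + 1) powr s * (1 + norm z) powr (- s)"
proof -
  have nz: "z - a \<noteq> 0" using \<eta> by auto
  define c where "c = (1 + norm a) / \<eta> + 1"
  have c: "c > 0" using \<eta> by (simp add: c_def add_pos_nonneg add_nonneg_pos)
  have "(1 + norm z) powr s \<le> (c * norm (z - a)) powr s"
    unfolding c_def using norm_shift_lower_bound[OF \<eta>] \<open>s \<ge> 0\<close>
    by (intro powr_mono2) auto
  also have "\<dots> = c powr s * norm (z - a) powr s" using c by (simp add: powr_mult)
  finally have le: "(1 + norm z) powr s \<le> c powr s * norm (z - a) powr s" .
  have "1 + norm z > 0" using norm_ge_zero[of z] by linarith
  then have p: "norm (z - a) powr s > 0" "(1 + norm z) powr s > 0" using nz by auto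
  have "norm ((z - a) powr of_real (- s)) = inverse (norm (z - a) powr s)"
    using norm_powr_of_real[OF nz, of "- s"] by (simp add: powr_minus)
  also have "\<dots> \<le> c powr s * inverse ((1 + norm z) powr s)"
    using le p by (simp add: field_simps)
  finally show ?thesis by (simp add: c_def powr_minus)
qed

lemma growth_power_le_line:
  assumes "norm f \<le> C * (1 + norm z) powr (- q)" "q \<ge> 2" "C \<ge> 0"
  shows "norm (f :: complex) \<le> C / (1 + (Re z)\<^sup>2)"
proof -
  have "1 + (Re z)\<^sup>2 \<le> (1 + norm z) powr 2"
  proof -
    have "(Re z)\<^sup>2 \<le> (norm z)\<^sup>2" using abs_Re_le_cmod[of z] by (simp add: abs_le_square_iff[symmetric])
    then have "1 + (Re z)\<^sup>2 \<le> (1 + norm z)\<^sup>2"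
      unfolding power2_sum by (simp add: add_increasing2)
    then show ?thesis using norm_ge_zero[of z] by (subst powr_numeral) auto
  qed
  also have "\<dots> \<le> (1 + norm z) powr q" using assms(2) by (intro powr_mono) auto
  finally have "C * (1 + norm z) powr (- q) \<le> C * inverse (1 + (Re z)\<^sup>2)"
    unfolding powr_minus using assms(3) sum_power2_gt_zero_iff[of 1 "Re z"]
    by (intro mult_left_mono le_imp_inverse_le) auto
  then show ?thesis using assms(1) by (simp add: divide_inverse)
qed

text \<open>If \<zeta> = cnj z and t = Im z, then z - a = \<tau> + 2\<i>t with \<tau> = \<zeta> - a.
  This is the kernel in the variable in which the flux is holomorphic, with the weight t^\<alpha>
  included.\<close>

definition ray_kernel :: "real \<Rightarrow> nat \<Rightarrow> complex \<Rightarrow> real \<Rightarrow> complex" where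
  "ray_kernel \<alpha> k \<tau> t = of_real (t powr \<alpha>) * (\<tau> + 2 * \<i> * of_real t) powr of_real (- (\<alpha> + 1 + real k))"

lemma ray_lower_bound:
  assumes "t \<ge> 0" "Im \<tau> > 0"
  shows "min (Im \<tau>) 2 * (1 + t) \<le> norm (\<tau> + 2 * \<i> * of_real t)"
proof -
  have "min (Im \<tau>) 2 * (1 + t) \<le> Im \<tau> + 2 * t"
    using assms mult_right_mono[of "min (Im \<tau>) 2" 2 t] by (simp add: algebra_simps)
  also have "\<dots> \<le> norm (\<tau> + 2 * \<i> * of_real t)"
    using abs_Im_le_cmod[of "\<tau> + 2 * \<i> * of_real t"] by simp
  finally show ?thesis .
qed

lemma ray_kernel_bound:
  assumes t: "t > 0" and \<tau>: "Im \<tau> > 0" and k: "k \<ge> 1" and \<alpha>: "\<alpha> > -1"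
  shows "norm (ray_kernel \<alpha> k \<tau> t) \<le> min (Im \<tau>) 2 powr (- (\<alpha> + 1 + real k)) * beta_weight \<alpha> t"
proof -
  define m where "m = min (Im \<tau>) 2"
  have m: "m > 0" using \<tau> by (simp add: m_def)
  have nz: "\<tau> + 2 * \<i> * of_real t \<noteq> 0"
  proof
    assume "\<tau> + 2 * \<i> * of_real t = 0"
    then have "Im (\<tau> + 2 * \<i> * of_real t) = 0" by simp
    then show False using t \<tau> by simp
  qed
  have "norm ((\<tau> + 2 * \<i> * of_real t) powr of_real (- (\<alpha> + 1 + real k)))
      = norm (\<tau> + 2 * \<i> * of_real t) powr (- (\<alpha> + 1 + real k))"
    by (rule norm_powr_of_real[OF nz])
  also have "\<dots> \<le> (m * (1 + t)) powr (- (\<alpha> + 1 + real k))"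
    using ray_lower_bound[of t \<tau>] t \<tau> m \<alpha> by (intro powr_mono2') (auto simp: m_def)
  also have "\<dots> = m powr (- (\<alpha> + 1 + real k)) * (1 + t) powr (- (\<alpha> + 1 + real k))"
    using m t by (simp add: powr_mult)
  also have "\<dots> \<le> m powr (- (\<alpha> + 1 + real k)) * (1 + t) powr (- \<alpha> - 2)"
    using t k by (intro mult_left_mono powr_mono) auto
  finally have "t powr \<alpha> * norm ((\<tau> + 2 * \<i> * of_real t) powr of_real (- (\<alpha> + 1 + real k)))
     \<le> t powr \<alpha> * (m powr (- (\<alpha> + 1 + real k)) * (1 + t) powr (- \<alpha> - 2))"
    by (intro mult_left_mono) auto
  then show ?thesis by (simp add: ray_kernel_def norm_mult m_def mult_ac)
qed

lemma ray_not_nonpos_Reals: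
  assumes "t \<ge> 0" "Im \<tau> > 0"
  shows "\<tau> + 2 * \<i> * of_real t \<notin> \<real>\<^sub>\<le>\<^sub>0"
  using assms by (auto simp: complex_nonpos_Reals_iff)

lemma ray_kernel_isCont:
  assumes "t > 0" "Im \<tau> > 0"
  shows "isCont (ray_kernel \<alpha> k \<tau>) t"
  unfolding ray_kernel_def using assms ray_not_nonpos_Reals[of t \<tau>]
  by (intro continuous_intros) auto

lemma ray_kernel_integrable:
  assumes \<tau>: "Im \<tau> > 0" and k: "k \<ge> 1" and \<alpha>: "\<alpha> > -1"
  shows "set_integrable lborel {0<..} (ray_kernel \<alpha> k \<tau>)"
  unfolding set_integrable_def
proof (rule Bochner_Integration.integrable_bound)
  show "integrable lborel (\<lambda>t. min (Im \<tau>) 2 powr (- (\<alpha> + 1 + real k)) *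
      (indicator {0<..} t *\<^sub>R beta_weight \<alpha> t))"
    using integrable_beta_weight[OF \<alpha>] unfolding set_integrable_def by (rule integrable_mult_right)
  have "continuous_on {0<..} (ray_kernel \<alpha> k \<tau>)"
    using ray_kernel_isCont[OF _ \<tau>] by (intro continuous_at_imp_continuous_on) auto
  then show "(\<lambda>t. indicator {0<..} t *\<^sub>R ray_kernel \<alpha> k \<tau> t) \<in> borel_measurable lborel"
    using borel_measurable_continuous_on_indicator[of "{0<..}" "ray_kernel \<alpha> k \<tau>"] by simp
  show "AE t in lborel. norm (indicator {0<..} t *\<^sub>R ray_kernel \<alpha> k \<tau> t) \<le>
      norm (min (Im \<tau>) 2 powr (- (\<alpha> + 1 + real k)) * (indicator {0<..} t *\<^sub>R beta_weight \<alpha> t))"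
    using ray_kernel_bound[OF _ assms] by (intro AE_I2) (auto simp: indicator_def)
qed

text \<open>The recursion in \<open>k\<close> comes from integrating the derivative of
  \<open>t^(\<alpha>+1) (\<tau> + 2\<i>t)^(-\<alpha>-1-k)\<close>; for \<open>k = 0\<close> this function has a nonzero limit at infinity.\<close>

lemma ray_primitive:
  assumes t: "t > 0" and \<tau>: "Im \<tau> > 0"
  shows "((\<lambda>t. of_real (t powr (\<alpha> + 1)) * (\<tau> + 2 * \<i> * of_real t) powr of_real (- (\<alpha> + 1 + real k))) has_vector_derivative
     of_real (\<alpha> + 1 + real k) * \<tau> * ray_kernel \<alpha> (Suc k) \<tau> t - of_real (real k) * ray_kernel \<alpha> k \<tau> t) (at t)"
proof -
  define v where "v = \<tau> + 2 * \<i> * of_real t"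
  define s where "s = \<alpha> + 1 + real k"
  have v: "v \<notin> \<real>\<^sub>\<le>\<^sub>0" "v \<noteq> 0" using ray_not_nonpos_Reals[of t \<tau>] t \<tau> by (auto simp: v_def)
  have d1: "((\<lambda>t. complex_of_real (t powr (\<alpha> + 1))) has_vector_derivative of_real ((\<alpha> + 1) * t powr \<alpha>)) (at t)"
    using has_real_derivative_powr[OF t, of "\<alpha> + 1"] by (intro has_vector_derivative_of_real) simp
  have "((\<lambda>t. \<tau> + 2 * \<i> * of_real t) has_vector_derivative 2 * \<i>) (at t)"
    by (auto intro!: derivative_eq_intros simp: has_vector_derivative_def scaleR_conv_of_real)
  moreover have "((\<lambda>w. w powr of_real (- s)) has_field_derivative of_real (- s) * v powr (of_real (- s) - 1)) (at (\<tau> + 2 * \<i> * of_real t))"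
    unfolding v_def[symmetric] by (rule has_field_derivative_powr[OF v(1)])
  ultimately have d2: "((\<lambda>t. (\<tau> + 2 * \<i> * of_real t) powr of_real (- s)) has_vector_derivative 2 * \<i> * (of_real (- s) * v powr (of_real (- s) - 1))) (at t)"
    using field_vector_diff_chain_at by (fastforce simp: o_def)
  have e1: "v powr (of_real (- s) - 1) = v powr of_real (- (\<alpha> + 1 + real (Suc k)))"
    by (rule arg_cong[where f = "\<lambda>p. v powr p"]) (simp add: s_def)
  have e2: "v powr of_real (- s) = v * v powr of_real (- (\<alpha> + 1 + real (Suc k)))"
  proof -
    have "v powr of_real (- s) = v powr (1 + of_real (- (\<alpha> + 1 + real (Suc k))))"
      by (rule arg_cong[where f = "\<lambda>p. v powr p"]) (simp add: s_def)
    also have "\<dots> = v * v powr of_real (- (\<alpha> + 1 + real (Suc k)))"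
      using v(2) by (simp only: powr_add powr_to_1)
    finally show ?thesis .
  qed
  have e3: "t powr (\<alpha> + 1) = t powr \<alpha> * t" using t by (simp add: powr_add)
  define r where "r = v powr of_real (- (\<alpha> + 1 + real (Suc k)))"
  have "((\<lambda>t. of_real (t powr (\<alpha> + 1)) * (\<tau> + 2 * \<i> * of_real t) powr of_real (- s)) has_vector_derivative
     of_real (t powr (\<alpha> + 1)) * (2 * \<i> * (of_real (- s) * v powr (of_real (- s) - 1)))
      + of_real ((\<alpha> + 1) * t powr \<alpha>) * v powr of_real (- s)) (at t)"
    using has_vector_derivative_mult[OF d1 d2] by (simp add: v_def)
  also have "of_real (t powr (\<alpha> + 1)) * (2 * \<i> * (of_real (- s) * v powr (of_real (- s) - 1)))
      + of_real ((\<alpha> + 1) * t powr \<alpha>) * v powr of_real (- s)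
     = of_real s * \<tau> * (of_real (t powr \<alpha>) * r) - of_real (real k) * (of_real (t powr \<alpha>) * (v * r))"
    unfolding e1 e2 e3 r_def[symmetric] by (simp add: v_def s_def algebra_simps)
  also have "\<dots> = of_real (\<alpha> + 1 + real k) * \<tau> * ray_kernel \<alpha> (Suc k) \<tau> t - of_real (real k) * ray_kernel \<alpha> k \<tau> t"
    unfolding ray_kernel_def v_def[symmetric] s_def[symmetric] e2 r_def by (simp only:)
  finally show ?thesis by (simp only: s_def)
qed

lemma ray_kernel_recursion:
  assumes \<tau>: "Im \<tau> > 0" and \<alpha>: "\<alpha> > -1" and k: "k \<ge> 1"
  shows "of_real (\<alpha> + 1 + real k) * \<tau> * (LINT t:{0<..}|lborel. ray_kernel \<alpha> (Suc k) \<tau> t)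
    = of_real (real k) * (LINT t:{0<..}|lborel. ray_kernel \<alpha> k \<tau> t)" (is ?A)
    and "of_real (\<alpha> + 1) * \<tau> * (LINT t:{0<..}|lborel. ray_kernel \<alpha> 1 \<tau> t) = (2 * \<i>) powr of_real (- (\<alpha> + 1))" (is ?B)
proof -
  have e: "einterval 0 \<infinity> = {0<..}" by (auto simp: einterval_def)
  define F where "F k t = of_real (t powr (\<alpha> + 1)) * (\<tau> + 2 * \<i> * of_real t) powr of_real (- (\<alpha> + 1 + real k))" for k t
  define f where "f k t = of_real (\<alpha> + 1 + real k) * \<tau> * ray_kernel \<alpha> (Suc k) \<tau> t - of_real (real k) * ray_kernel \<alpha> k \<tau> t" for k t
  \<comment> \<open>The kernel of index 0 decays only like 1/t, but for k = 0 it enters with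
    coefficient 0; hence the separate case.\<close>
  have fi: "set_integrable lborel {0<..} (f k)" for k
  proof (cases "k = 0")
    case True
    then show ?thesis unfolding f_def
      using ray_kernel_integrable[OF \<tau> _ \<alpha>, of 1] by simp
  next
    case False
    then show ?thesis unfolding f_def
      using ray_kernel_integrable[OF \<tau> _ \<alpha>, of "Suc k"] ray_kernel_integrable[OF \<tau> _ \<alpha>, of k]
      by (intro set_integral_diff set_integrable_mult_right) auto
  qed
  have F0: "(F k \<longlongrightarrow> 0) (at_right 0)" for k
  proof -
    have "((\<lambda>t. complex_of_real (t powr (\<alpha> + 1))) \<longlongrightarrow> of_real (0 powr (\<alpha> + 1))) (at_right 0)"
      using \<alpha> by (intro tendsto_of_real tendsto_powr'[OF tendsto_ident_at tendsto_const]) (auto simp: eventually_at_filter)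
    moreover have "((\<lambda>t. (\<tau> + 2 * \<i> * of_real t) powr of_real (- (\<alpha> + 1 + real k))) \<longlongrightarrow>
        (\<tau> + 2 * \<i> * of_real 0) powr of_real (- (\<alpha> + 1 + real k))) (at_right 0)"
      using ray_not_nonpos_Reals[of 0 \<tau>] \<tau> by (intro tendsto_intros) auto
    ultimately show ?thesis
      unfolding F_def by (auto intro: tendsto_eq_intros)
  qed
  have main: "(LINT t:{0<..}|lborel. f k t) = L" if "(F k \<longlongrightarrow> L) at_top" for k L
  proof -
    have "(LBINT t=0..\<infinity>. f k t) = L - 0"
    proof (rule interval_integral_FTC_integrable[where F = "F k"])
      show "(F k has_vector_derivative f k t) (at t)" if "0 < ereal t" for t
        unfolding F_def f_def using that by (intro ray_primitive \<tau>) auto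
      show "isCont (f k) t" if "0 < ereal t" for t
        unfolding f_def using that by (intro continuous_intros ray_kernel_isCont \<tau>) auto
      show "set_integrable lborel (einterval 0 \<infinity>) (f k)" unfolding e by (rule fi)
      show "((F k \<circ> real_of_ereal) \<longlongrightarrow> 0) (at_right 0)"
        using F0[of k] by (simp add: ereal_tendsto_simps zero_ereal_def)
      show "((F k \<circ> real_of_ereal) \<longlongrightarrow> L) (at_left \<infinity>)"
        using that by (simp add: ereal_tendsto_simps)
    qed auto
    then show ?thesis by (simp add: interval_lebesgue_integral_def e)
  qed
  have Flim: "(F k \<longlongrightarrow> 0) at_top" if "k \<ge> 1" for k
  proof (rule Lim_null_comparison)
    have "\<forall>\<^sub>F t in at_top. (t::real) > 0" by (rule eventually_gt_at_top)
    then show "\<forall>\<^sub>F t in at_top. norm (F k t) \<le> min (Im \<tau>) 2 powr (- (\<alpha> + 1 + real k)) * (t powr (\<alpha> + 1) * (1 + t) powr (- \<alpha> - 2))"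
    proof eventually_elim
      case (elim t)
      have "norm (F k t) = t * norm (ray_kernel \<alpha> k \<tau> t)"
        using elim by (simp add: F_def ray_kernel_def norm_mult powr_add)
      also have "\<dots> \<le> t * (min (Im \<tau>) 2 powr (- (\<alpha> + 1 + real k)) * beta_weight \<alpha> t)"
        using elim ray_kernel_bound[OF elim \<tau> that \<alpha>] by (intro mult_left_mono) auto
      also have "\<dots> = min (Im \<tau>) 2 powr (- (\<alpha> + 1 + real k)) * (t powr (\<alpha> + 1) * (1 + t) powr (- \<alpha> - 2))"
        using elim by (simp add: powr_add)
      finally show ?case .
    qed
    have "((\<lambda>t. t powr (\<alpha> + 1) * (1 + t) powr (- \<alpha> - 2)) \<longlongrightarrow> 0) at_top"
      using \<alpha> by real_asymp
    then show "((\<lambda>t. min (Im \<tau>) 2 powr (- (\<alpha> + 1 + real k)) * (t powr (\<alpha> + 1) * (1 + t) powr (- \<alpha> - 2))) \<longlongrightarrow> 0) at_top"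
      by (rule tendsto_mult_right_zero)
  qed
  have "(LINT t:{0<..}|lborel. f k t) = 0" using main[OF Flim[OF k]] .
  moreover have "(LINT t:{0<..}|lborel. f k t) = of_real (\<alpha> + 1 + real k) * \<tau> * (LINT t:{0<..}|lborel. ray_kernel \<alpha> (Suc k) \<tau> t)
    - of_real (real k) * (LINT t:{0<..}|lborel. ray_kernel \<alpha> k \<tau> t)"
    unfolding f_def
    using ray_kernel_integrable[OF \<tau> _ \<alpha>, of "Suc k"] ray_kernel_integrable[OF \<tau> k \<alpha>]
    by (subst set_integral_diff) auto
  ultimately show ?A by simp
  \<comment> \<open>Pulling t out of the power turns F 0 into (\<tau>/t + 2\<i>)^(-\<alpha>-1),
    which makes the limit at infinity visible.\<close>
  have "((\<lambda>t. (\<tau> * of_real (1 / t) + 2 * \<i>) powr of_real (- (\<alpha> + 1))) \<longlongrightarrow> (\<tau> * of_real 0 + 2 * \<i>) powr of_real (- (\<alpha> + 1))) at_top"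
    by (intro tendsto_intros tendsto_divide_0[OF tendsto_const] filterlim_at_top_imp_at_infinity filterlim_ident)
       (auto simp: complex_nonpos_Reals_iff)
  then have "((\<lambda>t. (\<tau> * of_real (1 / t) + 2 * \<i>) powr of_real (- (\<alpha> + 1))) \<longlongrightarrow> (2 * \<i>) powr of_real (- (\<alpha> + 1))) at_top"
    by simp
  then have "(F 0 \<longlongrightarrow> (2 * \<i>) powr of_real (- (\<alpha> + 1))) at_top"
  proof (rule Lim_transform_eventually)
    have "\<forall>\<^sub>F t in at_top. (t::real) > 0" by (rule eventually_gt_at_top)
    then show "\<forall>\<^sub>F t in at_top. (\<tau> * of_real (1 / t) + 2 * \<i>) powr of_real (- (\<alpha> + 1)) = F 0 t"
    proof eventually_elim
      case (elim t)
      have "(\<tau> + 2 * \<i> * of_real t) = of_real t * (\<tau> * of_real (1 / t) + 2 * \<i>)"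
        using elim by (simp add: field_simps)
      then have "(\<tau> + 2 * \<i> * of_real t) powr of_real (- (\<alpha> + 1))
         = (of_real t * (\<tau> * of_real (1 / t) + 2 * \<i>)) powr of_real (- (\<alpha> + 1))"
        by (rule arg_cong)
      also have "\<dots> = of_real t powr of_real (- (\<alpha> + 1)) * (\<tau> * of_real (1 / t) + 2 * \<i>) powr of_real (- (\<alpha> + 1))"
        using elim by (intro powr_times_real_left) auto
      finally have "(\<tau> + 2 * \<i> * of_real t) powr of_real (- (\<alpha> + 1))
         = of_real t powr of_real (- (\<alpha> + 1)) * (\<tau> * of_real (1 / t) + 2 * \<i>) powr of_real (- (\<alpha> + 1))" .
      moreover have "of_real (t powr (\<alpha> + 1)) * (of_real t powr of_real (- (\<alpha> + 1))) = (1::complex)"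
        using elim by (simp only: powr_of_real[symmetric] of_real_mult[symmetric] powr_add[symmetric]) simp
      ultimately show ?case by (simp add: F_def mult.assoc[symmetric])
    qed
  qed
  from main[OF this] show ?B
    unfolding f_def by simp
qed

text \<open>Formally t = \<tau>s gives \<tau>^(-k) by homogeneity, but this substitution rotates the
  path of integration; the recursion from k = 1 upwards reaches the same result on the real ray.
  That \<kappa> is nonzero is what later isolates the Cauchy integral.\<close>

lemma ray_kernel_integral:
  assumes \<alpha>: "\<alpha> > -1" and k: "k \<ge> 1"
  obtains \<kappa> where "\<kappa> \<noteq> 0" "\<And>\<tau>. Im \<tau> > 0 \<Longrightarrow> (LINT t:{0<..}|lborel. ray_kernel \<alpha> k \<tau> t) = \<kappa> / \<tau> ^ k"
proof -
  have "\<exists>\<kappa>. \<kappa> \<noteq> 0 \<and> (\<forall>\<tau>. Im \<tau> > 0 \<longrightarrow> (LINT t:{0<..}|lborel. ray_kernel \<alpha> k \<tau> t) = \<kappa> / \<tau> ^ k)"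
    using k
  proof (induction k rule: dec_induct)
    case base
    define \<kappa> where "\<kappa> = (2 * \<i>) powr of_real (- (\<alpha> + 1)) / of_real (\<alpha> + 1)"
    have a: "complex_of_real (\<alpha> + 1) \<noteq> 0" using \<alpha> by (simp only: of_real_eq_0_iff)
    have "(LINT t:{0<..}|lborel. ray_kernel \<alpha> 1 \<tau> t) = \<kappa> / \<tau> ^ 1" if "Im \<tau> > 0" for \<tau>
    proof -
      have "\<tau> \<noteq> 0" using that by auto
      then have "(LINT t:{0<..}|lborel. ray_kernel \<alpha> 1 \<tau> t) = (2 * \<i>) powr of_real (- (\<alpha> + 1)) / (of_real (\<alpha> + 1) * \<tau>)"
        using ray_kernel_recursion(2)[OF that \<alpha>, of 1] a
        by (intro eq_divide_imp) (simp_all only: mult_eq_0_iff simp_thms mult.commute)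
      then show ?thesis by (simp only: \<kappa>_def power_one_right divide_divide_eq_left)
    qed
    moreover have "\<kappa> \<noteq> 0" using a by (simp add: \<kappa>_def)
    ultimately show ?case by blast
  next
    case (step k)
    then obtain \<kappa> where \<kappa>: "\<kappa> \<noteq> 0" "\<And>\<tau>. Im \<tau> > 0 \<Longrightarrow> (LINT t:{0<..}|lborel. ray_kernel \<alpha> k \<tau> t) = \<kappa> / \<tau> ^ k"
      by blast
    have a: "complex_of_real (\<alpha> + 1 + real k) \<noteq> 0" using \<alpha> step(1) by (simp only: of_real_eq_0_iff)
    define \<kappa>' where "\<kappa>' = of_real (real k) * \<kappa> / of_real (\<alpha> + 1 + real k)"
    have "(LINT t:{0<..}|lborel. ray_kernel \<alpha> (Suc k) \<tau> t) = \<kappa>' / \<tau> ^ Suc k" if t: "Im \<tau> > 0" for \<tau>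
    proof -
      have nz: "\<tau> \<noteq> 0" using that by auto
      have "of_real (\<alpha> + 1 + real k) * \<tau> * (LINT t:{0<..}|lborel. ray_kernel \<alpha> (Suc k) \<tau> t) = of_real (real k) * (\<kappa> / \<tau> ^ k)"
        using ray_kernel_recursion(1)[OF t \<alpha> step(1)] \<kappa>(2)[OF t] by simp
      then have "(LINT t:{0<..}|lborel. ray_kernel \<alpha> (Suc k) \<tau> t) = of_real (real k) * (\<kappa> / \<tau> ^ k) / (of_real (\<alpha> + 1 + real k) * \<tau>)"
        using a nz by (metis mult_eq_0_iff nonzero_mult_div_cancel_left)
      then show ?thesis by (simp add: \<kappa>'_def mult_ac)
    qed
    moreover have "\<kappa>' \<noteq> 0" using a \<kappa>(1) step(1) by (simp add: \<kappa>'_def)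
    ultimately show ?case by blast
  qed
  then show thesis using that by blast
qed

section \<open>Holomorphic functions on half-planes\<close>

lemma quotient_growth:
  fixes z a g :: complex
  assumes "norm g \<le> C * (1 + norm z) powr Q" "1 + norm z \<le> c * norm (z - a)" "c > 0"
  shows "norm (g / (z - a) ^ n) \<le> C * c ^ n * (1 + norm z) powr (- (real n - Q))"
proof -
  have p: "1 + norm z > 0" using norm_ge_zero[of z] by linarith
  then have pos: "norm (z - a) > 0" using assms(2) by auto
  have "(1 + norm z) ^ n \<le> c ^ n * norm (z - a) ^ n"
    using power_mono[OF assms(2)] p by (simp add: power_mult_distrib)
  then have "inverse (norm (z - a) ^ n) \<le> c ^ n * inverse ((1 + norm z) ^ n)"
    using p pos by (simp add: field_simps)
  then have "norm g * inverse (norm (z - a) ^ n) \<le> (C * (1 + norm z) powr Q) * (c ^ n * inverse ((1 + norm z) ^ n))"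
    using assms(1) by (intro mult_mono) (auto intro: order_trans[OF norm_ge_zero])
  also have "\<dots> = C * c ^ n * ((1 + norm z) powr Q * inverse ((1 + norm z) ^ n))" by simp
  also have "(1 + norm z) powr Q * inverse ((1 + norm z) ^ n) = (1 + norm z) powr (- (real n - Q))"
    using p by (simp add: powr_diff powr_realpow divide_inverse)
  finally show ?thesis by (simp only: norm_divide norm_power) (simp only: divide_inverse)
qed

lemma contour_integral_horizontal:
  assumes X: "X > 0" and c: "continuous_on {-X..X} (\<lambda>x. f (Complex x y))"
  shows "contour_integral (linepath (Complex (-X) y) (Complex X y)) f = integral {-X..X} (\<lambda>x. f (Complex x y))"
proof -
  define g where "g t = - X + 2 * X * t" for t
  have line: "linepath (Complex (-X) y) (Complex X y) t = Complex (g t) y" for t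
    by (simp add: linepath_def g_def complex_eq_iff algebra_simps)
  have "((\<lambda>t. (2 * X) *\<^sub>R f (Complex (g t) y)) has_integral (integral {g 0..g 1} (\<lambda>x. f (Complex x y)))) {0..1}"
  proof (rule has_integral_substitution)
    show "g ` {0..1} \<subseteq> {-X..X}"
    proof
      fix s assume "s \<in> g ` {0..1}"
      then obtain t where t: "0 \<le> t" "t \<le> 1" "s = g t" by auto
      have "2 * X * t \<le> 2 * X * 1" "0 \<le> 2 * X * t" using t X by (auto intro: mult_left_mono)
      then show "s \<in> {-X..X}" using t by (auto simp: g_def)
    qed
    show "(g has_real_derivative 2 * X) (at t within {0..1})" for t
      unfolding g_def by (auto intro!: derivative_eq_intros)
  qed (use X c in \<open>auto simp: g_def\<close>)
  then have "((\<lambda>t. f (linepath (Complex (-X) y) (Complex X y) t) * (Complex X y - Complex (-X) y)) has_integral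
     integral {-X..X} (\<lambda>x. f (Complex x y))) {0..1}"
  proof -
    have "Complex X y - Complex (-X) y = of_real (2 * X)" by (simp add: complex_eq_iff)
    then show ?thesis using \<open>((\<lambda>t. (2 * X) *\<^sub>R f (Complex (g t) y)) has_integral _) _\<close>
      unfolding line by (simp add: g_def scaleR_conv_of_real mult.commute)
  qed
  then show ?thesis
    by (intro contour_integral_unique) (simp add: has_contour_integral_linepath)
qed

text \<open>Rectangles with top side on Im \<zeta> = -\<delta> grow downwards and sideways. On the
  top side the integral tends to 0 by \<open>zero\<close>; on the other sides the integrand is
  O(X^(-2)) at distance at least X from the origin. So the residue at a vanishes, and it is the m-th
  derivative of G at a divided by m factorial.\<close>

lemma half_plane_cauchy:
  assumes G: "G holomorphic_on \<L>" and \<delta>: "\<delta> > 0" and a: "Im a < - \<delta>"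
    and b: "\<And>\<zeta>. Im \<zeta> \<le> - \<delta> \<Longrightarrow> norm (G \<zeta>) \<le> C * (1 + norm \<zeta>) powr Q"
    and C: "C \<ge> 0" and k: "real (Suc m) \<ge> Q + 2"
    and zero: "(\<integral>x. G (Complex x (- \<delta>)) / (Complex x (- \<delta>) - a) ^ Suc m \<partial>lborel) = 0"
  shows "(deriv ^^ m) G a = 0"
proof -
  define f where "f \<zeta> = G \<zeta> / (\<zeta> - a) ^ Suc m" for \<zeta>
  have aS: "a \<in> \<L>" using a \<delta> by (simp add: lower_half_plane_def)
  have fh: "f holomorphic_on \<L> - {a}"
    unfolding f_def by (intro holomorphic_intros holomorphic_on_subset[OF G]) auto
  define c where "c = (1 + norm a) / (- \<delta> - Im a) + 1"
  have c: "c > 0" using a by (simp add: c_def add_nonneg_pos)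
  have top: "norm (f (Complex x (- \<delta>))) \<le> C * c ^ Suc m / (1 + x\<^sup>2)" for x
  proof -
    let ?z = "Complex x (- \<delta>)"
    have "norm (f ?z) \<le> C * c ^ Suc m * (1 + norm ?z) powr (- (real (Suc m) - Q))"
      unfolding f_def using a
      by (intro quotient_growth b c) (auto simp: c_def intro!: norm_shift_lower_bound)
    then have "norm (f ?z) \<le> C * c ^ Suc m / (1 + (Re ?z)\<^sup>2)"
      by (rule growth_power_le_line) (use k C c in auto)
    then show ?thesis by simp
  qed
  have topc: "continuous_on T (\<lambda>x. f (Complex x (- \<delta>)))" for T
    by (rule continuous_on_compose2[OF holomorphic_on_imp_continuous_on[OF fh]])
      (use a \<delta> in \<open>auto simp: lower_half_plane_def Complex_eq intro!: continuous_intros\<close>)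
  define K where "K = C * 4 ^ Suc m"
  have K: "K \<ge> 0" using C by (simp add: K_def)
  have far: "norm (f \<zeta>) \<le> K / X\<^sup>2" if "Im \<zeta> \<le> - \<delta>" "norm \<zeta> \<ge> X" "X \<ge> 1 + 2 * norm a" for \<zeta> X
  proof -
    have X0: "X > 0" using that(3) norm_ge_zero[of a] by linarith
    have "norm \<zeta> - norm a \<le> norm (\<zeta> - a)" by (rule norm_triangle_ineq2)
    then have "1 + norm \<zeta> \<le> 4 * norm (\<zeta> - a)" using that norm_ge_zero[of a] by linarith
    then have "norm (f \<zeta>) \<le> C * 4 ^ Suc m * (1 + norm \<zeta>) powr (- (real (Suc m) - Q))"
      unfolding f_def using that by (intro quotient_growth b) auto
    also have "\<dots> \<le> C * 4 ^ Suc m * X powr (-2)"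
    proof (intro mult_left_mono)
      have "(1 + norm \<zeta>) powr (- (real (Suc m) - Q)) \<le> (1 + norm \<zeta>) powr (-2)"
        using k by (intro powr_mono) auto
      also have "\<dots> \<le> X powr (-2)" using that X0 by (intro powr_mono2') auto
      finally show "(1 + norm \<zeta>) powr (- (real (Suc m) - Q)) \<le> X powr (-2)" .
    qed (use C in auto)
    also have "X powr (-2) = inverse (X\<^sup>2)" using X0 by (simp add: powr_minus powr_numeral)
    finally show ?thesis by (simp add: K_def divide_inverse)
  qed
  define r where "r = 2 * of_real pi * \<i> * ((deriv ^^ m) G a / fact m)"
  \<comment> \<open>Three far sides of length at most 2X, with the integrand at most K / X^2 on
    each, give 6 K / X. The top side is traversed from right to left, a sign that the norm
    absorbs.\<close>
  have est: "norm r \<le> 6 * K / X + norm (integral {-X..X} (\<lambda>x. f (Complex x (- \<delta>))))"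
    if X: "X \<ge> 1 + 2 * norm a + \<delta>" for X
  proof -
    have X0: "X > 0" "X > \<delta>" "X \<ge> 1 + 2 * norm a" using X \<delta> norm_ge_zero[of a] by linarith+
    define a1 a2 a3 a4 where "a1 = Complex (-X) (-X)" and "a2 = Complex X (-X)" and "a3 = Complex X (- \<delta>)"
      and "a4 = Complex (-X) (- \<delta>)"
    have inbox: "a \<in> box a1 a3"
      using X0 a abs_Re_le_cmod[of a] abs_Im_le_cmod[of a] norm_ge_zero[of a]
      by (auto simp: in_box_complex_iff a1_def a3_def)
    have sub: "cbox a1 a3 \<subseteq> \<L>"
      using \<delta> by (auto simp: in_cbox_complex_iff a1_def a3_def lower_half_plane_def)
    have im: "path_image (rectpath a1 a3) = cbox a1 a3 - box a1 a3"
      using X0 by (intro path_image_rectpath_cbox_minus_box) (auto simp: a1_def a3_def)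
    have pim: "path_image (rectpath a1 a3) \<subseteq> \<L> - {a}"
      using im sub inbox by auto
    have "contour_integral (rectpath a1 a3) f = 2 * pi * \<i> * (\<Sum>p\<in>{a}. winding_number (rectpath a1 a3) p * residue f p)"
    proof (rule Residue_theorem)
      show "connected \<L>" unfolding lower_half_plane_def
        by (intro convex_connected convex_halfspace_Im_lt)
      show "\<forall>z. z \<notin> \<L> \<longrightarrow> winding_number (rectpath a1 a3) z = 0"
      proof (intro allI impI winding_number_rectpath_outside)
        fix z assume "z \<notin> \<L>"
        then show "z \<notin> cbox a1 a3" using sub by auto
      qed (use X0 in \<open>auto simp: a1_def a3_def\<close>)
    qed (use fh pim open_half_planes in auto)
    also have "residue f a = (deriv ^^ m) G a / fact m"
      unfolding f_def by (rule residue_holomorphic_over_power[OF open_half_planes(2) aS G])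
    then have "2 * pi * \<i> * (\<Sum>p\<in>{a}. winding_number (rectpath a1 a3) p * residue f p) = r"
      using winding_number_rectpath[OF inbox] by (simp add: r_def)
    finally have r: "contour_integral (rectpath a1 a3) f = r" .
    have rp: "rectpath a1 a3 = linepath a1 a2 +++ linepath a2 a3 +++ linepath a3 a4 +++ linepath a4 a1"
      by (simp add: rectpath_def Let_def a1_def a2_def a3_def a4_def)
    have segs: "closed_segment a1 a2 \<subseteq> path_image (rectpath a1 a3)" "closed_segment a2 a3 \<subseteq> path_image (rectpath a1 a3)"
       "closed_segment a3 a4 \<subseteq> path_image (rectpath a1 a3)" "closed_segment a4 a1 \<subseteq> path_image (rectpath a1 a3)"
      unfolding rp by (auto simp: path_image_join)
    have ci: "f contour_integrable_on linepath p q" if "closed_segment p q \<subseteq> path_image (rectpath a1 a3)" for p q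
      by (rule contour_integrable_continuous_linepath[OF continuous_on_subset[OF holomorphic_on_imp_continuous_on[OF fh]]])
         (use that pim in auto)
    have split: "r = contour_integral (linepath a1 a2) f + contour_integral (linepath a2 a3) f
        + contour_integral (linepath a3 a4) f + contour_integral (linepath a4 a1) f"
      using r ci segs unfolding rp by (simp add: contour_integrable_joinI valid_path_join add.assoc)
    have side: "norm (contour_integral (linepath p q) f) \<le> K / X\<^sup>2 * (2 * X)"
      if s: "closed_segment p q \<subseteq> path_image (rectpath a1 a3)" and l: "norm (q - p) \<le> 2 * X"
        and R: "\<And>\<zeta>. \<zeta> \<in> closed_segment p q \<Longrightarrow> norm \<zeta> \<ge> X" for p q
    proof -
      have "norm (contour_integral (linepath p q) f) \<le> K / X\<^sup>2 * norm (q - p)"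
      proof (rule contour_integral_bound_linepath[OF ci[OF s]])
        fix \<zeta> assume z: "\<zeta> \<in> closed_segment p q"
        then have "\<zeta> \<in> cbox a1 a3" using s im by auto
        then have "Im \<zeta> \<le> - \<delta>" by (auto simp: in_cbox_complex_iff a3_def)
        then show "norm (f \<zeta>) \<le> K / X\<^sup>2" using far R[OF z] X0 by blast
      qed (use K in auto)
      also have "\<dots> \<le> K / X\<^sup>2 * (2 * X)" using l K by (intro mult_left_mono) auto
      finally show ?thesis .
    qed
    have s12: "norm (contour_integral (linepath a1 a2) f) \<le> K / X\<^sup>2 * (2 * X)"
    proof (rule side[OF segs(1)])
      have "a2 - a1 = of_real (2 * X)" by (simp add: a1_def a2_def complex_eq_iff)
      then show "norm (a2 - a1) \<le> 2 * X" using X0 by (simp only: norm_of_real)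
      fix \<zeta> assume "\<zeta> \<in> closed_segment a1 a2"
      then have "Im \<zeta> = - X" using X0 by (auto simp: closed_segment_same_Im a1_def a2_def)
      then show "X \<le> norm \<zeta>" using abs_Im_le_cmod[of \<zeta>] X0 by auto
    qed
    have s23: "norm (contour_integral (linepath a2 a3) f) \<le> K / X\<^sup>2 * (2 * X)"
    proof (rule side[OF segs(2)])
      have "a3 - a2 = \<i> * of_real (X - \<delta>)" by (simp add: a3_def a2_def complex_eq_iff)
      then have "norm (a3 - a2) = \<bar>X - \<delta>\<bar>" by (simp only: norm_mult norm_ii norm_of_real mult_1)
      then show "norm (a3 - a2) \<le> 2 * X" using X0 \<delta> by simp
      fix \<zeta> assume "\<zeta> \<in> closed_segment a2 a3"
      then have "Re \<zeta> = X" using X0 by (auto simp: closed_segment_same_Re a3_def a2_def)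
      then show "X \<le> norm \<zeta>" using abs_Re_le_cmod[of \<zeta>] X0 by auto
    qed
    have s41: "norm (contour_integral (linepath a4 a1) f) \<le> K / X\<^sup>2 * (2 * X)"
    proof (rule side[OF segs(4)])
      have "a1 - a4 = \<i> * of_real (\<delta> - X)" by (simp add: a1_def a4_def complex_eq_iff)
      then have "norm (a1 - a4) = \<bar>\<delta> - X\<bar>" by (simp only: norm_mult norm_ii norm_of_real mult_1)
      then show "norm (a1 - a4) \<le> 2 * X" using X0 \<delta> by simp
      fix \<zeta> assume "\<zeta> \<in> closed_segment a4 a1"
      then have "Re \<zeta> = - X" using X0 by (auto simp: closed_segment_same_Re a1_def a4_def)
      then show "X \<le> norm \<zeta>" using abs_Re_le_cmod[of \<zeta>] X0 by auto
    qed
    have "contour_integral (linepath a3 a4) f = - contour_integral (linepath a4 a3) f"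
      using ci[OF segs(3)] contour_integral_reversepath[of "linepath a4 a3" f] by simp
    also have "contour_integral (linepath a4 a3) f = integral {-X..X} (\<lambda>x. f (Complex x (- \<delta>)))"
      unfolding a3_def a4_def by (rule contour_integral_horizontal[OF X0(1) topc])
    finally have s34: "norm (contour_integral (linepath a3 a4) f) = norm (integral {-X..X} (\<lambda>x. f (Complex x (- \<delta>))))"
      by simp
    have tri: "norm (p + q + u + v) \<le> norm p + norm q + norm u + norm v" for p q u v :: complex
      by (intro norm_triangle_mono order_refl norm_triangle_ineq)
    have "norm r \<le> 3 * (K / X\<^sup>2 * (2 * X)) + norm (integral {-X..X} (\<lambda>x. f (Complex x (- \<delta>))))"
      unfolding split using s12 s23 s34 s41
      by (intro order_trans[OF tri]) linarith
    also have "3 * (K / X\<^sup>2 * (2 * X)) = 6 * K / X" using X0 by (simp add: power2_eq_square field_simps)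
    finally show ?thesis .
  qed
  have lim: "(\<lambda>n. 6 * K / real n + norm (integral {- real n..real n} (\<lambda>x. f (Complex x (- \<delta>))))) \<longlonglongrightarrow> 0 + norm (0 :: complex)"
  proof (intro tendsto_add tendsto_norm)
    show "(\<lambda>n. 6 * K / real n) \<longlonglongrightarrow> 0" by real_asymp
    show "(\<lambda>n. integral {- real n..real n} (\<lambda>x. f (Complex x (- \<delta>)))) \<longlonglongrightarrow> 0"
      using truncated_integral_tendsto[OF topc top] zero by (simp add: f_def)
  qed
  obtain N :: nat where N: "1 + 2 * norm a + \<delta> \<le> real N" using real_arch_simple by blast
  have "norm r \<le> 0 + norm (0 :: complex)"
  proof (rule LIMSEQ_le_const[OF lim], intro exI allI impI)
    fix n assume "N \<le> n"
    then show "norm r \<le> 6 * K / real n + norm (integral {- real n..real n} (\<lambda>x. f (Complex x (- \<delta>))))"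
      using N by (intro est) linarith
  qed
  then show ?thesis by (simp add: r_def)
qed

lemma polynomial_if_higher_deriv_zero:
  assumes S: "open S" "convex S" and "f holomorphic_on S" "\<And>z. z \<in> S \<Longrightarrow> (deriv ^^ m) f z = 0"
  shows "\<exists>c. \<forall>z\<in>S. f z = (\<Sum>j<m. c j * z ^ j)"
  using assms(3,4)
proof (induction m arbitrary: f)
  case 0
  then show ?case by simp
next
  case (Suc m)
  have "(deriv ^^ m) (deriv f) z = 0" if "z \<in> S" for z
    using Suc.prems(2)[OF that] by (simp add: funpow_swap1)
  from Suc.IH[OF holomorphic_deriv[OF Suc.prems(1) S(1)] this]
  obtain c where c: "\<And>z. z \<in> S \<Longrightarrow> deriv f z = (\<Sum>j<m. c j * z ^ j)" by blast
  define g where "g z = f z - (\<Sum>j<m. c j / of_nat (Suc j) * z ^ Suc j)" for z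
  have "(g has_field_derivative 0) (at z within S)" if "z \<in> S" for z
  proof -
    have "((\<lambda>z. \<Sum>j<m. c j / of_nat (Suc j) * z ^ Suc j) has_field_derivative (\<Sum>j<m. c j / of_nat (Suc j) * (of_nat (Suc j) * z ^ j))) (at z)"
    proof (intro DERIV_sum DERIV_cmult)
      show "((\<lambda>z. z ^ Suc j) has_field_derivative of_nat (Suc j) * z ^ j) (at z)" for j
        using DERIV_power[OF DERIV_ident, of "Suc j" z UNIV] by simp
    qed
    moreover have "(\<Sum>j<m. c j / of_nat (Suc j) * (of_nat (Suc j) * z ^ j)) = deriv f z"
      unfolding c[OF that] by (intro sum.cong refl) (simp del: of_nat_Suc)
    moreover have "(f has_field_derivative deriv f z) (at z)"
      using holomorphic_derivI[OF Suc.prems(1) S(1) that] .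
    ultimately have "(g has_field_derivative deriv f z - deriv f z) (at z)"
      unfolding g_def by (intro DERIV_diff) auto
    then show ?thesis by (simp add: has_field_derivative_at_within)
  qed
  then obtain d where d: "\<And>z. z \<in> S \<Longrightarrow> g z = d"
    using has_field_derivative_zero_constant[OF S(2), of g] by blast
  define c' where "c' j = (case j of 0 \<Rightarrow> d | Suc i \<Rightarrow> c i / of_nat (Suc i))" for j
  have "f z = (\<Sum>j<Suc m. c' j * z ^ j)" if "z \<in> S" for z
  proof -
    have "f z = d + (\<Sum>j<m. c j / of_nat (Suc j) * z ^ Suc j)" using d[OF that] by (simp add: g_def algebra_simps)
    then show ?thesis by (subst sum.lessThan_Suc_shift) (simp add: c'_def)
  qed
  then show ?case by blast
qed

section \<open>Convolution of holomorphic functions and removal of the mollifier\<close>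

lemma conv_holomorphic:
  assumes S: "horizontal S" "convex S" and f: "f holomorphic_on S" and \<phi>: "continuous_on {-A..A} \<phi>"
  shows "conv A \<phi> f holomorphic_on S" "\<And>z. z \<in> S \<Longrightarrow> deriv (conv A \<phi> f) z = conv A \<phi> (deriv f) z"
proof -
  have o: "open S" using S by (simp add: horizontal_def)
  have fc: "continuous_on S f" using f by (rule holomorphic_on_imp_continuous_on)
  have f'c: "continuous_on S (deriv f)" by (rule holomorphic_on_imp_continuous_on[OF holomorphic_deriv[OF f o]])
  have d: "(f has_field_derivative deriv f z) (at z)" if "z \<in> S" for z
    using holomorphic_derivI[OF f o that] .
  have "(\<lambda>z. integral (cbox (-A) A) (\<lambda>t. f (z - of_real t) * \<phi> t)) holomorphic_on S"
  proof (rule leibniz_rule_holomorphic[where fx = "\<lambda>z t. deriv f (z - of_real t) * \<phi> t"])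
    fix z t assume z: "z \<in> S"
    have zt: "z - of_real t \<in> S" using S(1) z by (simp add: horizontal_def)
    have "((\<lambda>z. z - of_real t) has_field_derivative 1) (at z)" by (auto intro!: derivative_eq_intros)
    from DERIV_chain2[OF d[OF zt] this]
    have "((\<lambda>z. f (z - of_real t)) has_field_derivative deriv f (z - of_real t)) (at z)" by simp
    then show "((\<lambda>z. f (z - of_real t) * \<phi> t) has_field_derivative deriv f (z - of_real t) * \<phi> t) (at z within S)"
      by (rule DERIV_cmult_right[OF has_field_derivative_at_within])
  next
    show "(\<lambda>t. f (z - of_real t) * \<phi> t) integrable_on cbox (-A) A" if "z \<in> S" for z
      using conv_integrable[OF S(1) fc \<phi> that] by simp
    have "continuous_on (S \<times> cbox (-A) A) (\<lambda>p. deriv f (fst p - of_real (snd p)) * \<phi> (snd p))"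
      using S(1) by (intro continuous_on_mult continuous_on_compose2[OF f'c]
        continuous_on_compose2[OF \<phi>] continuous_intros) (auto simp: horizontal_def)
    then show "continuous_on (S \<times> cbox (-A) A) (\<lambda>(z, t). deriv f (z - of_real t) * \<phi> t)"
      by (simp add: case_prod_beta)
  qed (rule S(2))
  then show h: "conv A \<phi> f holomorphic_on S" by (simp add: conv_def[abs_def])
  fix z assume z: "z \<in> S"
  \<comment> \<open>The complex derivative is identified through its horizontal direction, where
    \<open>conv_dir_deriv\<close> supplies a value and derivatives along a line are unique.\<close>
  have dir: "dir_deriv 1 g g' w" if "(g has_field_derivative g') (at w)" for g g' w
  proof -
    have "((\<lambda>s. w + of_real s * 1) has_vector_derivative 1) (at 0)"
      by (auto intro!: derivative_eq_intros simp: has_vector_derivative_def scaleR_conv_of_real)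
    from field_vector_diff_chain_at[OF this, of g g'] that
    show ?thesis by (simp add: dir_deriv_def o_def)
  qed
  have "dir_deriv 1 (conv A \<phi> f) (conv A \<phi> (deriv f) z) z"
    by (rule conv_dir_deriv[OF S(1) fc f'c \<phi> dir[OF d] z])
  moreover have "dir_deriv 1 (conv A \<phi> f) (deriv (conv A \<phi> f) z) z"
    by (rule dir[OF holomorphic_derivI[OF h o z]])
  ultimately show "deriv (conv A \<phi> f) z = conv A \<phi> (deriv f) z"
    unfolding dir_deriv_def by (rule vector_derivative_unique_at[rotated])
qed

lemma conv_higher_deriv:
  assumes S: "horizontal S" "convex S" and f: "f holomorphic_on S" and \<phi>: "continuous_on {-A..A} \<phi>" and z: "z \<in> S"
  shows "(deriv ^^ m) (conv A \<phi> f) z = conv A \<phi> ((deriv ^^ m) f) z"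
  using f z
proof (induction m arbitrary: f z)
  case (Suc m)
  have o: "open S" using S by (simp add: horizontal_def)
  have ev: "\<forall>\<^sub>F w in nhds z. deriv (conv A \<phi> f) w = conv A \<phi> (deriv f) w"
    using eventually_nhds_in_open[OF o Suc.prems(2)]
    by eventually_elim (rule conv_holomorphic(2)[OF S Suc.prems(1) \<phi>])
  have "(deriv ^^ Suc m) (conv A \<phi> f) z = (deriv ^^ m) (deriv (conv A \<phi> f)) z"
    by (simp add: funpow_swap1)
  also have "\<dots> = (deriv ^^ m) (conv A \<phi> (deriv f)) z"
    by (rule higher_deriv_cong_ev[OF ev refl])
  also have "\<dots> = conv A \<phi> ((deriv ^^ m) (deriv f)) z"
    by (rule Suc.IH[OF holomorphic_deriv[OF Suc.prems(1) o] Suc.prems(2)])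
  finally show ?case by (simp add: funpow_swap1)
qed simp

text \<open>A single mollifier decides: on its support f varies by less than |f z| / 2, and total
  mass 1 then forces |f z| \<le> |f z| / 2.\<close>

lemma zero_if_conv_zero:
  assumes S: "horizontal S" and f: "continuous_on S f" and z: "z \<in> S"
    and conv0: "\<And>A D. test_tower A D \<Longrightarrow> conv A (D 0) f z = 0"
  shows "f z = 0"
proof (rule ccontr)
  assume "f z \<noteq> 0"
  then have e: "norm (f z) / 2 > 0" by simp
  have "isCont f z" using S f z by (simp add: horizontal_def continuous_on_eq_continuous_at)
  then obtain d where d: "d > 0" "\<And>w. dist w z < d \<Longrightarrow> dist (f w) (f z) < norm (f z) / 2"
    unfolding continuous_at_eps_delta using e by blast
  obtain D where D: "test_tower (d / 2) D" "integral {- (d / 2)..d / 2} (D 0) = 1"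
    "\<And>t. D 0 t = of_real (norm (D 0 t))"
    using mollifier[of "d / 2"] d(1) by auto
  let ?I = "{- (d / 2)..d / 2}"
  have Dc: "continuous_on ?I (D 0)" by (rule test_tower_continuous[OF D(1)])
  have D1: "(D 0 has_integral 1) ?I"
    using integrable_integral[OF integrable_continuous_interval[OF Dc]] D(2) by simp
  have Dn: "((\<lambda>t. norm (D 0 t)) has_integral 1) ?I"
  proof -
    have "((\<lambda>t. Re (D 0 t)) has_integral Re 1) ?I"
      using has_integral_linear[OF D1 bounded_linear_Re] by (simp add: o_def)
    moreover have "Re (D 0 t) = norm (D 0 t)" for t
      by (subst D(3)) simp
    ultimately show ?thesis by simp
  qed
  have "((\<lambda>t. f (z - of_real t) * D 0 t) has_integral conv (d / 2) (D 0) f z) ?I"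
    unfolding conv_def using conv_integrable[OF S f Dc z] by (rule integrable_integral)
  moreover have "((\<lambda>t. f z * D 0 t) has_integral f z * 1) ?I"
    by (rule has_integral_mult_right[OF D1])
  ultimately have "((\<lambda>t. f (z - of_real t) * D 0 t - f z * D 0 t) has_integral (conv (d / 2) (D 0) f z - f z * 1)) ?I"
    by (rule has_integral_diff)
  then have i: "((\<lambda>t. (f (z - of_real t) - f z) * D 0 t) has_integral - f z) ?I"
    using conv0[OF D(1)] by (simp add: algebra_simps)
  have "norm (integral ?I (\<lambda>t. (f (z - of_real t) - f z) * D 0 t)) \<le> integral ?I (\<lambda>t. norm (f z) / 2 * norm (D 0 t))"
  proof (rule integral_norm_bound_integral)
    show "(\<lambda>t. (f (z - of_real t) - f z) * D 0 t) integrable_on ?I" using i by blast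
    show "(\<lambda>t. norm (f z) / 2 * norm (D 0 t)) integrable_on ?I"
      using has_integral_mult_right[OF Dn] by blast
    fix t assume t: "t \<in> ?I"
    have "dist (z - of_real t) z < d" using t d(1) by (auto simp: dist_norm abs_le_iff intro: le_less_trans)
    from d(2)[OF this] have "norm (f (z - of_real t) - f z) \<le> norm (f z) / 2" by (simp add: dist_norm)
    then show "norm ((f (z - of_real t) - f z) * D 0 t) \<le> norm (f z) / 2 * norm (D 0 t)"
      unfolding norm_mult by (intro mult_right_mono) auto
  qed
  then have "norm (f z) \<le> norm (f z) / 2"
    using integral_unique[OF i] integral_unique[OF Dn] by simp
  then show False using e by simp
qed

text \<open>After mollification the boundary value is attained continuously. The derivative
  \<open>U 1\<close> is bounded near each bounded piece of the axis, and with the limit 0 on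
  vertical lines this gives |U 0| \<le> C y there. The extension by 0 is therefore continuous, its
  reflection is entire, and it vanishes on the real line.\<close>

lemma holomorphic_zero_boundary_value:
  assumes h: "h holomorphic_on \<H>" and z0: "zero_distributional_boundary_value h"
    and z: "z \<in> \<H>"
  shows "h z = 0"
proof (rule zero_if_conv_zero[OF horizontal_upper_half_plane holomorphic_on_imp_continuous_on[OF h] z])
  fix A D assume T: "test_tower A D"
  note hc = holomorphic_on_imp_continuous_on[OF h] and Dc = test_tower_continuous[OF T]
  have cv: "convex \<H>" unfolding upper_half_plane_def by (rule convex_halfspace_Im_gt)
  define U where "U k = conv A (D k) h" for k
  have Uh: "U k holomorphic_on \<H>" for k
    unfolding U_def by (rule conv_holomorphic(1)[OF horizontal_upper_half_plane cv h Dc])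
  have hd: "(h has_field_derivative deriv h w) (at w)" if "w \<in> \<H>" for w
    by (rule holomorphic_derivI[OF h open_half_planes(1) that])
  have dirh: "dir_deriv e h (e * deriv h w) w" if "w \<in> \<H>" for e w
  proof -
    have "((\<lambda>s. w + of_real s * e) has_vector_derivative e) (at 0)"
      by (auto intro!: derivative_eq_intros simp: has_vector_derivative_def scaleR_conv_of_real)
    from field_vector_diff_chain_at[OF this, of h "deriv h w"] hd[OF that]
    show ?thesis by (simp add: dir_deriv_def o_def)
  qed
  have h'c: "continuous_on \<H> (deriv h)"
    by (rule holomorphic_on_imp_continuous_on[OF holomorphic_deriv[OF h open_half_planes(1)]])
  have dy: "((\<lambda>t. U 0 (Complex x t)) has_vector_derivative \<i> * U 1 (Complex x y)) (at y)" if "y > 0" for x y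
  proof (rule dir_deriv_vertical)
    have w: "Complex x y \<in> \<H>" using that by (simp add: upper_half_plane_def)
    have "dir_deriv \<i> (conv A (D 0) h) (conv A (D 0) (\<lambda>w. \<i> * deriv h w) (Complex x y)) (Complex x y)"
      by (rule conv_dir_deriv[OF horizontal_upper_half_plane hc _ Dc dirh w])
         (intro continuous_on_mult_left h'c)
    also have "conv A (D 0) (\<lambda>w. \<i> * deriv h w) (Complex x y)
        = \<i> * conv A (D 0) (deriv h) (Complex x y) + 0 * conv A (D 0) (deriv h) (Complex x y)"
      by (rule conv_cong_add[OF horizontal_upper_half_plane h'c h'c Dc w]) simp
    also have "conv A (D 0) (deriv h) (Complex x y) = conv A (D (Suc 0)) h (Complex x y)"
      using dirh[of _ 1] by (intro conv_by_parts[OF T horizontal_upper_half_plane hc h'c _ w]) simp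
    finally show "dir_deriv \<i> (U 0) (\<i> * U 1 (Complex x y)) (Complex x y)"
      by (simp add: U_def)
  qed
  have U0: "((\<lambda>y. U 0 (Complex x y)) \<longlongrightarrow> 0) (at_right 0)" for x
    unfolding U_def by (rule conv_tendsto_0[OF T hc z0])
  \<comment> \<open>Limits along the individual vertical lines need not be uniform in x; this linear
    bound is, and it gives joint continuity at the axis.\<close>
  have lip: "\<exists>C\<ge>0. \<forall>x y. \<bar>x\<bar> \<le> R \<longrightarrow> 0 < y \<longrightarrow> y \<le> 1 \<longrightarrow> norm (U 0 (Complex x y)) \<le> C * y" for R
  proof -
    obtain C where C: "\<And>x y. \<bar>x\<bar> \<le> R \<Longrightarrow> 0 < y \<Longrightarrow> y \<le> 1 \<Longrightarrow> norm (U 1 (Complex x y)) \<le> C"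
      using boundary_bounded[OF test_tower_shift[OF T, of 1] hc z0, of R 1] by (auto simp: U_def)
    have "norm (U 0 (Complex x y)) \<le> \<bar>C\<bar> * y" if x: "\<bar>x\<bar> \<le> R" and y: "0 < y" "y \<le> 1" for x y
    proof -
      have le: "norm (U 0 (Complex x y) - U 0 (Complex x \<epsilon>)) \<le> \<bar>C\<bar> * y" if \<epsilon>: "0 < \<epsilon>" "\<epsilon> < y" for \<epsilon>
      proof -
        have "norm (U 0 (Complex x y) - U 0 (Complex x \<epsilon>)) \<le> \<bar>C\<bar> * y - \<bar>C\<bar> * \<epsilon>"
        proof (rule differentiable_bound_general[OF \<epsilon>(2), where f' = "\<lambda>t. \<i> * U 1 (Complex x t)"])
          show "continuous_on {\<epsilon>..y} (\<lambda>t. U 0 (Complex x t))"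
            using \<epsilon> by (intro continuous_at_imp_continuous_on ballI has_vector_derivative_continuous[OF dy]) auto
          show "((\<lambda>t. \<bar>C\<bar> * t) has_vector_derivative \<bar>C\<bar>) (at t)" for t
            by (auto intro!: derivative_eq_intros simp: has_real_derivative_iff_has_vector_derivative[symmetric])
          show "norm (\<i> * U 1 (Complex x t)) \<le> \<bar>C\<bar>" if "\<epsilon> < t" "t < y" for t
            using C[OF x, of t] that \<epsilon> y by (simp add: norm_mult)
        qed (use \<epsilon> dy in \<open>auto intro!: continuous_intros\<close>)
        also have "\<dots> \<le> \<bar>C\<bar> * y" using \<epsilon> by simp
        finally show ?thesis .
      qed
      have "((\<lambda>\<epsilon>. norm (U 0 (Complex x y) - U 0 (Complex x \<epsilon>))) \<longlongrightarrow> norm (U 0 (Complex x y) - 0)) (at_right 0)"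
        by (intro tendsto_intros U0)
      moreover have "\<forall>\<^sub>F \<epsilon> in at_right 0. norm (U 0 (Complex x y) - U 0 (Complex x \<epsilon>)) \<le> \<bar>C\<bar> * y"
        using le y unfolding eventually_at_right_field by blast
      ultimately have "norm (U 0 (Complex x y) - 0) \<le> \<bar>C\<bar> * y"
        by (rule tendsto_upperbound) simp
      then show ?thesis by simp
    qed
    then show ?thesis by (intro exI[of _ "\<bar>C\<bar>"]) auto
  qed
  define g where "g w = (if Im w > 0 then U 0 w else 0)" for w
  have gc: "continuous_on {w. 0 \<le> Im w} g"
    unfolding continuous_on_eq_continuous_within
  proof
    fix w assume w: "w \<in> {w. 0 \<le> Im w}"
    show "continuous (at w within {w. 0 \<le> Im w}) g"
    proof (cases "Im w > 0")
      case True
      then have wu: "w \<in> \<H>" by (simp add: upper_half_plane_def)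
      have "isCont (U 0) w"
        using holomorphic_on_imp_continuous_on[OF Uh] wu open_half_planes(1) continuous_on_eq_continuous_at by blast
      moreover have "\<forall>\<^sub>F v in nhds w. U 0 v = g v"
        using eventually_nhds_in_open[OF open_half_planes(1) wu]
        by eventually_elim (simp add: g_def upper_half_plane_def)
      ultimately have "isCont g w" using isCont_cong by blast
      then show ?thesis by (rule continuous_at_imp_continuous_at_within)
    next
      case False
      then have w0: "Im w = 0" using w by simp
      obtain C where C: "C \<ge> 0" "\<And>x y. \<bar>x\<bar> \<le> \<bar>Re w\<bar> + 1 \<Longrightarrow> 0 < y \<Longrightarrow> y \<le> 1 \<Longrightarrow> norm (U 0 (Complex x y)) \<le> C * y"
        using lip[of "\<bar>Re w\<bar> + 1"] by auto
      have "(g \<longlongrightarrow> 0) (at w within {w. 0 \<le> Im w})"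
      proof (rule Lim_null_comparison)
        show "\<forall>\<^sub>F v in at w within {w. 0 \<le> Im w}. norm (g v) \<le> C * \<bar>Im v\<bar>"
          unfolding eventually_at
        proof (intro exI[of _ 1] conjI ballI impI)
          fix v assume "v \<noteq> w \<and> dist v w < 1"
          then have v: "\<bar>Re v - Re w\<bar> < 1" "\<bar>Im v - Im w\<bar> < 1"
            using abs_Re_le_cmod[of "v - w"] abs_Im_le_cmod[of "v - w"] by (auto simp: dist_norm)
          show "norm (g v) \<le> C * \<bar>Im v\<bar>"
          proof (cases "Im v > 0")
            case True
            then show ?thesis using C(2)[of "Re v" "Im v"] v w0 by (auto simp: g_def)
          next
            case False
            then have "g v = 0" by (simp add: g_def)
            then show ?thesis
              using mult_nonneg_nonneg[OF C(1) abs_ge_zero[of "Im v"]] by (simp only: norm_zero)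
          qed
        qed auto
        have "((\<lambda>v. C * \<bar>Im v\<bar>) \<longlongrightarrow> C * \<bar>Im w\<bar>) (at w within {w. 0 \<le> Im w})"
          by (intro tendsto_intros)
        then show "((\<lambda>v. C * \<bar>Im v\<bar>) \<longlongrightarrow> 0) (at w within {w. 0 \<le> Im w})" using w0 by simp
      qed
      then show ?thesis using w0 by (simp add: continuous_within g_def)
    qed
  qed
  define F where "F w = (if 0 \<le> Im w then g w else cnj (g (cnj w)))" for w
  have Fh: "F holomorphic_on UNIV"
    unfolding F_def
  proof (rule Schwarz_reflection)
    have "g holomorphic_on \<H>"
      by (rule holomorphic_transform[OF Uh]) (simp add: g_def upper_half_plane_def)
    then show "g holomorphic_on UNIV \<inter> {w. 0 < Im w}" by (simp add: upper_half_plane_def)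
    show "continuous_on (UNIV \<inter> {w. 0 \<le> Im w}) g" using gc by simp
    show "g w \<in> \<real>" if "w \<in> \<real>" for w using that by (auto simp: g_def Reals_def)
  qed auto
  have "F z = 0"
  proof (rule analytic_continuation[OF Fh open_UNIV connected_UNIV subset_UNIV UNIV_I])
    show "(0::complex) islimpt \<real>"
      unfolding islimpt_approachable
    proof (intro allI impI)
      fix e :: real assume "e > 0"
      then show "\<exists>x'\<in>\<real>. x' \<noteq> 0 \<and> dist x' (0::complex) < e"
        by (intro bexI[of _ "of_real (e / 2)"]) auto
    qed
    show "F w = 0" if "w \<in> \<real>" for w using that by (auto simp: F_def g_def Reals_def)
  qed auto
  then show "conv A (D 0) h z = 0"
    using z by (simp add: F_def g_def U_def upper_half_plane_def)
qed

section \<open>Vanishing of high derivatives of the flux\<close>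

lemma holomorphic_partials:
  assumes "(f has_field_derivative f') (at (Complex x y))"
  shows "((\<lambda>t. f (Complex x t)) has_vector_derivative \<i> * f') (at y)"
    and "((\<lambda>s. f (Complex s y)) has_vector_derivative f') (at x)"
proof -
  have "((\<lambda>t. Complex x t) has_vector_derivative \<i>) (at y)" "((\<lambda>s. Complex s y) has_vector_derivative 1) (at x)"
    unfolding Complex_eq
    by (auto intro!: derivative_eq_intros simp: has_vector_derivative_def scaleR_conv_of_real)
  from this[THEN field_vector_diff_chain_at, of f f'] assms
  show "((\<lambda>t. f (Complex x t)) has_vector_derivative \<i> * f') (at y)"
    and "((\<lambda>s. f (Complex s y)) has_vector_derivative f') (at x)"
    by (auto simp: o_def)
qed

text \<open>This is Cauchy's theorem in a strip, obtained from Green's formula with q = 0, since the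
  vertical derivative \<i> f' of f is the horizontal derivative of \<i> f.\<close>

lemma line_shift:
  assumes T: "open T" and f: "f holomorphic_on T" and y: "y1 < y2"
    and sub: "{z. y1 \<le> Im z \<and> Im z \<le> y2} \<subseteq> T"
    and b: "\<And>z. y1 \<le> Im z \<Longrightarrow> Im z \<le> y2 \<Longrightarrow> norm (f z) \<le> C / (1 + (Re z)\<^sup>2)"
  shows "(\<integral>x. f (Complex x y1) \<partial>lborel) = (\<integral>x. f (Complex x y2) \<partial>lborel)"
proof -
  have d: "(f has_field_derivative deriv f z) (at z)" if "y1 \<le> Im z" "Im z \<le> y2" for z
    using holomorphic_derivI[OF f T] sub that by auto
  have b0: "0 \<le> C / (1 + (Re z)\<^sup>2)" if "y1 \<le> Im z" "Im z \<le> y2" for z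
    using b[OF that] norm_ge_zero order_trans by blast
  have "((\<lambda>y. integral\<^sup>L lborel (\<lambda>x::real. 0)) has_integral ((\<integral>x. f (Complex x y2) \<partial>lborel) - (\<integral>x. f (Complex x y1) \<partial>lborel))) {y1..y2}"
  proof (rule green_strip[OF y, where fy = "\<lambda>z. \<i> * deriv f z" and p = "\<lambda>z. \<i> * f z" and q = "\<lambda>z. 0" and C = C])
    show "continuous_on {z. y1 \<le> Im z \<and> Im z \<le> y2} f"
      by (rule continuous_on_subset[OF holomorphic_on_imp_continuous_on[OF f] sub])
    show "continuous_on {z. y1 \<le> Im z \<and> Im z \<le> y2} (\<lambda>z. \<i> * deriv f z)"
      by (intro continuous_on_mult_left continuous_on_subset[OF holomorphic_on_imp_continuous_on[OF holomorphic_deriv[OF f T]] sub])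
    show "((\<lambda>t. f (Complex x t)) has_vector_derivative \<i> * deriv f (Complex x y)) (at y)" if "y1 \<le> y" "y \<le> y2" for x y
      by (rule holomorphic_partials(1)[OF d]) (use that in auto)
    show "((\<lambda>s. \<i> * f (Complex s y)) has_vector_derivative \<i> * deriv f (Complex x y) - 0) (at x)" if "y1 \<le> y" "y \<le> y2" for x y
      unfolding diff_0_right
      by (rule has_vector_derivative_mult_right[OF holomorphic_partials(2)[OF d]]) (use that in auto)
  qed (use b b0 in \<open>auto simp: norm_mult\<close>)
  then have "(\<integral>x. f (Complex x y2) \<partial>lborel) - (\<integral>x. f (Complex x y1) \<partial>lborel) = 0"
    by (intro has_integral_unique[OF _ has_integral_0]) simp
  then show ?thesis by simp
qed

text \<open>For Im a < Im z the base z - a lies in the upper half-plane, away from the cut of the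
  principal branch.\<close>

lemma power_kernel_deriv:
  assumes "Im a < Im z"
  shows "((\<lambda>z. (z - a) powr of_real s) has_field_derivative of_real s * (z - a) powr (of_real s - 1)) (at z)"
proof -
  have "z - a \<notin> \<real>\<^sub>\<le>\<^sub>0" using assms by (auto simp: complex_nonpos_Reals_iff)
  then have "((\<lambda>w. w powr of_real s) has_field_derivative of_real s * (z - a) powr (of_real s - 1)) (at (z - a))"
    by (rule has_field_derivative_powr)
  moreover have "((\<lambda>z. z - a) has_field_derivative 1) (at z)"
    by (auto intro!: derivative_eq_intros)
  ultimately show ?thesis using DERIV_chain2 by fastforce
qed

lemma continuous_on_powr_Im_pos:
  assumes f: "continuous_on A f" and pos: "\<And>x. x \<in> A \<Longrightarrow> Im (f x) > 0"
  shows "continuous_on A (\<lambda>x. f x powr p)"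
proof (rule continuous_on_powr_complex[OF _ _ f continuous_on_const])
  show "A \<subseteq> {x. 0 \<le> Re (f x) \<or> Im (f x) \<noteq> 0}" using pos by force
  show "0 < Re p" if "x \<in> A" "f x = 0" for x using pos[OF that(1)] that(2) by simp
qed

lemma power_kernel_continuous:
  assumes "\<And>z. z \<in> S \<Longrightarrow> Im a < Im z"
  shows "continuous_on S (\<lambda>z. (z - a) powr p)"
  using assms by (intro continuous_on_powr_Im_pos continuous_intros) simp

lemma powr_times_growth:
  fixes f g :: complex
  assumes "norm f \<le> K * (1 + r) powr (- s)" "norm g \<le> C * (1 + r) powr P" "r \<ge> 0"
  shows "norm (f * g) \<le> K * C * (1 + r) powr (- (s - P))"
proof -
  have "norm (f * g) \<le> (K * (1 + r) powr (- s)) * (C * (1 + r) powr P)"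
    unfolding norm_mult using assms by (intro mult_mono) (auto intro: order_trans[OF norm_ge_zero])
  also have "\<dots> = K * C * ((1 + r) powr (- s) * (1 + r) powr P)" by simp
  also have "(1 + r) powr (- s) * (1 + r) powr P = (1 + r) powr (- (s - P))"
    unfolding powr_add[symmetric] by (rule arg_cong[where f = "\<lambda>p. (1 + r) powr p"]) simp
  finally show ?thesis .
qed

text \<open>Here U and W come from the mollified \<open>u\<close> and its flux, G is the mollified
  holomorphic function, and m + 1 is the order of the pole. With m + 1 \<ge> Q + 3 the kernel has
  three powers of |z| to spare: two make the line integrals converge and the third gives decay as y
  grows. In the double integral, where \<alpha> + 2 powers are spent on t, still m - Q \<ge> 2
  remain.\<close>

context
  fixes \<alpha> P Q :: real and U W :: "nat \<Rightarrow> complex \<Rightarrow> complex" and G :: "complex \<Rightarrow> complex"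
    and a :: complex and m :: nat
  assumes \<alpha>: "\<alpha> > -1" and P: "P \<ge> 0" and Q: "Q \<ge> P"
    and H: "harmonic_tower \<alpha> U W"
    and Ub: "\<exists>C. \<forall>z\<in>\<H>. norm (U 0 z) \<le> C * (1 + norm z) powr P"
    and Wb: "\<And>\<eta>. \<eta> > 0 \<Longrightarrow> \<exists>C\<ge>0. \<forall>z. Im z \<ge> \<eta> \<longrightarrow> norm (W 0 z) \<le> C * (1 + norm z) powr Q"
    and U0: "\<And>x. ((\<lambda>y. U 0 (Complex x y)) \<longlongrightarrow> 0) (at_right 0)"
    and G: "G holomorphic_on \<L>"
    and WG: "\<And>z. z \<in> \<H> \<Longrightarrow> W 0 z = G (cnj z)"
    and a: "Im a < 0" and m: "real (Suc m) \<ge> Q + 3"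
begin

section \<open>Line integrals of the kernel against U and W\<close>

definition "kexp = \<alpha> + 1 + real (Suc m)"

definition "kern z = (z - a) powr of_real (- kexp)"

definition "lineU y = (\<integral>x. kern (Complex x y) * U 0 (Complex x y) \<partial>lborel)"

definition "lineW y = (\<integral>x. kern (Complex x y) * W 0 (Complex x y) \<partial>lborel)"

lemma kexp: "kexp \<ge> Q + 3" "kexp \<ge> P + 3" "kexp \<ge> 0"
  using m \<alpha> Q P by (auto simp: kexp_def)

lemma kern_U_bound:
  obtains C where "C \<ge> 0" "\<And>z. z \<in> \<H> \<Longrightarrow> norm (kern z * U 0 z) \<le> C * (1 + norm z) powr (- (kexp - P))"
proof -
  obtain C where C: "\<And>z. z \<in> \<H> \<Longrightarrow> norm (U 0 z) \<le> C * (1 + norm z) powr P"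
    using Ub by auto
  define K where "K = ((1 + norm a) / (- Im a) + 1) powr kexp"
  have "norm (kern z * U 0 z) \<le> K * \<bar>C\<bar> * (1 + norm z) powr (- (kexp - P))" if z: "z \<in> \<H>" for z
  proof (rule powr_times_growth)
    show "norm (kern z) \<le> K * (1 + norm z) powr (- kexp)"
      unfolding kern_def K_def using a z kexp(3) by (intro power_kernel_bound) (auto simp: upper_half_plane_def)
    show "norm (U 0 z) \<le> \<bar>C\<bar> * (1 + norm z) powr P"
      by (rule order_trans[OF C[OF z]]) (auto intro!: mult_right_mono)
  qed auto
  then show thesis by (intro that[of "K * \<bar>C\<bar>"]) (auto simp: K_def)
qed

lemma line_continuous:
  assumes "continuous_on \<H> f" "y > 0"
  shows "continuous_on UNIV (\<lambda>x. kern (Complex x y) * f (Complex x y))"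
proof -
  have "continuous_on \<H> (\<lambda>z. kern z * f z)"
    unfolding kern_def using a by (intro continuous_on_mult power_kernel_continuous assms(1)) (auto simp: upper_half_plane_def)
  then show ?thesis
    by (rule continuous_on_compose2) (use assms(2) in \<open>auto simp: upper_half_plane_def Complex_eq intro!: continuous_intros\<close>)
qed

text \<open>At the axis, dominated convergence combines the limit of U on vertical lines with the
  bound on U that is uniform in y. At infinity one spare power of 1 + |z| \<ge> y becomes a factor
  1/y.\<close>

lemma lineU_tendsto_0: "(\<lambda>n. lineU (1 / real (Suc n))) \<longlonglongrightarrow> 0" "(\<lambda>n. lineU (real (Suc n))) \<longlonglongrightarrow> 0"
proof -
  obtain C where C: "C \<ge> 0" "\<And>z. z \<in> \<H> \<Longrightarrow> norm (kern z * U 0 z) \<le> C * (1 + norm z) powr (- (kexp - P))"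
    by (rule kern_U_bound) (rule that)
  have b: "norm (kern (Complex x y) * U 0 (Complex x y)) \<le> C / (1 + x\<^sup>2)" if "y > 0" for x y
    using growth_power_le_line[OF C(2), of "Complex x y"] that C(1) kexp(2) by (simp add: upper_half_plane_def)
  have b2: "norm (kern (Complex x y) * U 0 (Complex x y)) \<le> C / y / (1 + x\<^sup>2)" if y: "y > 0" for x y
  proof -
    let ?z = "Complex x y"
    have "norm (kern ?z * U 0 ?z) \<le> C * (1 + norm ?z) powr (- (kexp - P))"
      using that by (intro C) (simp add: upper_half_plane_def)
    also have "\<dots> \<le> C * (1 / y * (1 + norm ?z) powr (- (kexp - P - 1)))"
    proof (intro mult_left_mono C)
      have "(1 + norm ?z) powr (- (kexp - P)) = (1 + norm ?z) powr (-1) * (1 + norm ?z) powr (- (kexp - P - 1))"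
        unfolding powr_add[symmetric] by (rule arg_cong[where f = "\<lambda>p. (1 + norm ?z) powr p"]) simp
      also have "\<dots> \<le> 1 / y * (1 + norm ?z) powr (- (kexp - P - 1))"
      proof (intro mult_right_mono)
        have "y \<le> 1 + norm ?z" using abs_Im_le_cmod[of ?z] by simp
        then show "(1 + norm ?z) powr (-1) \<le> 1 / y"
          using y by (simp add: powr_minus divide_inverse)
      qed auto
      finally show "(1 + norm ?z) powr (- (kexp - P)) \<le> 1 / y * (1 + norm ?z) powr (- (kexp - P - 1))" .
    qed
    finally have "norm (kern ?z * U 0 ?z) \<le> C / y * (1 + norm ?z) powr (- (kexp - P - 1))" by simp
    then have "norm (kern ?z * U 0 ?z) \<le> C / y / (1 + (Re ?z)\<^sup>2)"
      by (rule growth_power_le_line) (use kexp(2) C(1) y in auto)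
    then show ?thesis by simp
  qed
  note Uc = harmonic_towerD(1)[OF H, of 0]
  have meas: "(\<lambda>x. kern (Complex x y) * U 0 (Complex x y)) \<in> borel_measurable lborel" if "y > 0" for y
    using borel_measurable_continuous_onI[OF line_continuous[OF Uc that]] by simp
  have seq: "filterlim (\<lambda>n. 1 / real (Suc n)) (at_right 0) sequentially"
    by real_asymp
  have "(\<lambda>n. \<integral>x. kern (Complex x (1 / real (Suc n))) * U 0 (Complex x (1 / real (Suc n))) \<partial>lborel)
      \<longlonglongrightarrow> integral\<^sup>L lborel (\<lambda>x::real. 0)"
  proof (rule Bochner_Integration.integral_dominated_convergence[where w = "\<lambda>x. C * (1 / (1 + x\<^sup>2))"])
    show "AE x in lborel. (\<lambda>n. kern (Complex x (1 / real (Suc n))) * U 0 (Complex x (1 / real (Suc n)))) \<longlonglongrightarrow> 0"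
    proof (rule AE_I2)
      fix x :: real
      have "isCont (\<lambda>z. (z - a) powr of_real (- kexp)) (of_real x)"
        using a by (intro DERIV_isCont[OF power_kernel_deriv]) simp
      moreover have "(\<lambda>n. Complex x (1 / real (Suc n))) \<longlonglongrightarrow> of_real x"
      proof -
        have "(\<lambda>n. 1 / real (Suc n)) \<longlonglongrightarrow> 0" by real_asymp
        then have "(\<lambda>n. of_real x + \<i> * of_real (1 / real (Suc n))) \<longlonglongrightarrow> of_real x + \<i> * of_real 0"
          by (intro tendsto_intros)
        then show ?thesis unfolding Complex_eq by simp
      qed
      ultimately have "(\<lambda>n. kern (Complex x (1 / real (Suc n)))) \<longlonglongrightarrow> (of_real x - a) powr of_real (- kexp)"
        unfolding kern_def by (rule isCont_tendsto_compose)
      then have "(\<lambda>n. kern (Complex x (1 / real (Suc n))) * U 0 (Complex x (1 / real (Suc n))))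
         \<longlonglongrightarrow> (of_real x - a) powr of_real (- kexp) * 0"
        by (intro tendsto_mult filterlim_compose[OF U0 seq])
      then show "(\<lambda>n. kern (Complex x (1 / real (Suc n))) * U 0 (Complex x (1 / real (Suc n)))) \<longlonglongrightarrow> 0" by simp
    qed
    show "integrable lborel (\<lambda>x. C * (1 / (1 + x\<^sup>2)))" by (intro integrable_mult_right integrable_inverse_1_plus_sq)
    show "AE x in lborel. norm (kern (Complex x (1 / real (Suc n))) * U 0 (Complex x (1 / real (Suc n)))) \<le> C * (1 / (1 + x\<^sup>2))" for n
    proof (rule AE_I2)
      fix x show "norm (kern (Complex x (1 / real (Suc n))) * U 0 (Complex x (1 / real (Suc n)))) \<le> C * (1 / (1 + x\<^sup>2))"
        using b[of "1 / real (Suc n)" x] by simp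
    qed
    show "(\<lambda>x. kern (Complex x (1 / real (Suc n))) * U 0 (Complex x (1 / real (Suc n)))) \<in> borel_measurable lborel" for n
      by (rule meas) simp
  qed auto
  then show "(\<lambda>n. lineU (1 / real (Suc n))) \<longlonglongrightarrow> 0" unfolding lineU_def by simp
  define I where "I = integral\<^sup>L lborel (\<lambda>x::real. 1 / (1 + x\<^sup>2))"
  show "(\<lambda>n. lineU (real (Suc n))) \<longlonglongrightarrow> 0"
  proof (rule Lim_null_comparison)
    show "\<forall>\<^sub>F n in sequentially. norm (lineU (real (Suc n))) \<le> C / real (Suc n) * I"
    proof (intro always_eventually allI)
      fix n
      let ?y = "real (Suc n)"
      have "norm (lineU ?y) \<le> (\<integral>x. norm (kern (Complex x ?y) * U 0 (Complex x ?y)) \<partial>lborel)"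
        unfolding lineU_def by (rule integral_norm_bound)
      also have "\<dots> \<le> (\<integral>x. C / ?y * (1 / (1 + x\<^sup>2)) \<partial>lborel)"
      proof (rule integral_mono)
        show "integrable lborel (\<lambda>x. norm (kern (Complex x ?y) * U 0 (Complex x ?y)))"
          by (intro integrable_norm integrable_line[OF line_continuous[OF Uc] b]) auto
        show "integrable lborel (\<lambda>x. C / ?y * (1 / (1 + x\<^sup>2)))"
          by (intro integrable_mult_right integrable_inverse_1_plus_sq)
        show "norm (kern (Complex x ?y) * U 0 (Complex x ?y)) \<le> C / ?y * (1 / (1 + x\<^sup>2))" for x
          using b2[of ?y x] by simp
      qed
      also have "\<dots> = C / ?y * I" unfolding I_def by (rule integral_mult_right_zero)
      finally show "norm (lineU ?y) \<le> C / ?y * I" .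
    qed
    have "(\<lambda>n. C / real (Suc n)) \<longlonglongrightarrow> 0" by real_asymp
    then show "(\<lambda>n. C / real (Suc n) * I) \<longlonglongrightarrow> 0" by (rule tendsto_mult_left_zero)
  qed
qed

text \<open>For f = kern U and p = \<i> kern U, holomorphy of the kernel leaves f_y - p_x = kern
  (U_y - \<i> U_x), and this is -2\<i> y^\<alpha> kern W. Multiplication by \<i>/2 removes the
  constant.\<close>

lemma lineU_difference:
  assumes y: "0 < y1" "y1 < y2"
  shows "((\<lambda>y. of_real (y powr \<alpha>) * lineW y) has_integral (\<i> / 2 * (lineU y2 - lineU y1))) {y1..y2}"
proof -
  let ?S = "{z. y1 \<le> Im z \<and> Im z \<le> y2}"
  have sub: "?S \<subseteq> \<H>" using y by (auto simp: upper_half_plane_def)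
  define q where "q z = - 2 * \<i> * of_real (Im z powr \<alpha>) * (kern z * W 0 z)" for z
  define kern' where "kern' z = of_real (- kexp) * (z - a) powr (of_real (- kexp) - 1)" for z
  define fy where "fy z = kern z * (\<i> * U 1 z - 2 * \<i> * of_real (Im z powr \<alpha>) * W 0 z) + \<i> * kern' z * U 0 z" for z
  obtain C where C: "C \<ge> 0" "\<And>z. z \<in> \<H> \<Longrightarrow> norm (kern z * U 0 z) \<le> C * (1 + norm z) powr (- (kexp - P))"
    by (rule kern_U_bound) (rule that)
  obtain CW where CW: "CW \<ge> 0" "\<And>z. Im z \<ge> y1 \<Longrightarrow> norm (W 0 z) \<le> CW * (1 + norm z) powr Q"
    using Wb[OF y(1)] by auto
  define K where "K = ((1 + norm a) / (- Im a) + 1) powr kexp"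
  define B where "B = y1 powr \<alpha> + y2 powr \<alpha>"
  have yB: "y powr \<alpha> \<le> B" if "y1 \<le> y" "y \<le> y2" for y
  proof (cases "\<alpha> \<ge> 0")
    case True
    then have "y powr \<alpha> \<le> y2 powr \<alpha>" using y that by (intro powr_mono2) auto
    then show ?thesis by (simp add: B_def add_increasing)
  next
    case False
    then have "y powr \<alpha> \<le> y1 powr \<alpha>" using y that by (intro powr_mono2') auto
    then show ?thesis by (simp add: B_def add_increasing2)
  qed
  define E where "E = C + 2 * B * (K * CW)"
  have E: "C \<le> E" "2 * B * (K * CW) \<le> E" "E \<ge> 0"
    using C(1) CW(1) by (auto simp: E_def B_def K_def)
  have kernc: "continuous_on ?S kern" "continuous_on ?S kern'"
    unfolding kern_def[abs_def] kern'_def using y a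
    by (intro continuous_intros power_kernel_continuous; auto)+
  have UWc: "continuous_on ?S (U k)" "continuous_on ?S (W k)" for k
    using harmonic_towerD(1,2)[OF H, of k] continuous_on_subset[OF _ sub] by auto
  have yc: "continuous_on ?S (\<lambda>z. complex_of_real (Im z powr \<alpha>))"
    using y by (intro continuous_intros) auto
  have kd: "(kern has_field_derivative kern' z) (at z)" if "z \<in> ?S" for z
    unfolding kern_def[abs_def] kern'_def using that y a by (intro power_kernel_deriv) auto
  have "((\<lambda>y. \<integral>x. q (Complex x y) \<partial>lborel) has_integral
     ((\<integral>x. kern (Complex x y2) * U 0 (Complex x y2) \<partial>lborel) - (\<integral>x. kern (Complex x y1) * U 0 (Complex x y1) \<partial>lborel))) {y1..y2}"
  proof (rule green_strip[OF y(2), where f = "\<lambda>z. kern z * U 0 z" and p = "\<lambda>z. \<i> * (kern z * U 0 z)" and q = q and fy = fy and C = E])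
    show "continuous_on ?S (\<lambda>z. kern z * U 0 z)" "continuous_on ?S fy" "continuous_on ?S q"
      unfolding fy_def q_def by (intro continuous_intros kernc UWc yc)+
    fix x y assume yy: "y1 \<le> y" "y \<le> y2"
    let ?z = "Complex x y"
    have zS: "?z \<in> ?S" using yy by simp
    then have z: "?z \<in> \<H>" using sub by blast
    have dU: "((\<lambda>t. U 0 (Complex x t)) has_vector_derivative (\<i> * U 1 ?z - 2 * \<i> * of_real (y powr \<alpha>) * W 0 ?z)) (at y)"
      using harmonic_towerD(4)[OF H z, of 0] by (intro dir_deriv_vertical) simp
    have dx: "((\<lambda>s. U 0 (Complex s y)) has_vector_derivative U 1 ?z) (at x)"
      using harmonic_towerD(3)[OF H z, of 0] by (intro dir_deriv_horizontal) simp
    have "((\<lambda>t. kern (Complex x t) * U 0 (Complex x t)) has_vector_derivative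
        kern ?z * (\<i> * U 1 ?z - 2 * \<i> * of_real (y powr \<alpha>) * W 0 ?z) + (\<i> * kern' ?z) * U 0 ?z) (at y)"
      by (rule has_vector_derivative_mult[OF holomorphic_partials(1)[OF kd[OF zS]] dU])
    then show "((\<lambda>t. kern (Complex x t) * U 0 (Complex x t)) has_vector_derivative fy ?z) (at y)"
      by (simp add: fy_def)
    have "((\<lambda>s. \<i> * (kern (Complex s y) * U 0 (Complex s y))) has_vector_derivative
        \<i> * (kern ?z * U 1 ?z + kern' ?z * U 0 ?z)) (at x)"
      by (intro has_vector_derivative_mult_right has_vector_derivative_mult[OF holomorphic_partials(2)[OF kd[OF zS]] dx])
    then show "((\<lambda>s. \<i> * (kern (Complex s y) * U 0 (Complex s y))) has_vector_derivative fy ?z - q ?z) (at x)"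
      by (simp add: fy_def q_def algebra_simps)
  next
    fix z assume zS: "z \<in> ?S"
    then have z: "z \<in> \<H>" using sub by blast
    have "norm (kern z * U 0 z) \<le> C / (1 + (Re z)\<^sup>2)"
      using growth_power_le_line[OF C(2)[OF z]] C(1) kexp(2) by simp
    also have "\<dots> \<le> E / (1 + (Re z)\<^sup>2)" by (intro divide_right_mono E) auto
    finally show "norm (kern z * U 0 z) \<le> E / (1 + (Re z)\<^sup>2)" "norm (\<i> * (kern z * U 0 z)) \<le> E / (1 + (Re z)\<^sup>2)"
      by (simp_all add: norm_mult)
    have "norm (kern z) \<le> K * (1 + norm z) powr (- kexp)"
      unfolding kern_def K_def using a z kexp(3) by (intro power_kernel_bound) (auto simp: upper_half_plane_def)
    then have kw: "norm (kern z * W 0 z) \<le> K * CW * (1 + norm z) powr (- (kexp - Q))"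
      using CW(2)[of z] zS by (intro powr_times_growth) auto
    have "norm (q z) = 2 * (Im z powr \<alpha> * norm (kern z * W 0 z))" by (simp add: q_def norm_mult)
    also have "\<dots> \<le> 2 * (B * (K * CW * (1 + norm z) powr (- (kexp - Q))))"
      using yB[of "Im z"] zS kw by (intro mult_left_mono mult_mono) (auto simp: B_def)
    also have "\<dots> = 2 * B * (K * CW) * (1 + norm z) powr (- (kexp - Q))" by simp
    also have "\<dots> \<le> E * (1 + norm z) powr (- (kexp - Q))" by (intro mult_right_mono E) auto
    finally show "norm (q z) \<le> E / (1 + (Re z)\<^sup>2)"
      by (rule growth_power_le_line) (use kexp(1) E in auto)
  qed
  then have "((\<lambda>y. \<integral>x. q (Complex x y) \<partial>lborel) has_integral (lineU y2 - lineU y1)) {y1..y2}"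
    by (simp add: lineU_def)
  moreover have "(\<integral>x. q (Complex x y) \<partial>lborel) = - 2 * \<i> * (of_real (y powr \<alpha>) * lineW y)" for y
    unfolding q_def lineW_def by (simp add: mult.assoc)
  ultimately have "((\<lambda>y. - 2 * \<i> * (of_real (y powr \<alpha>) * lineW y)) has_integral (lineU y2 - lineU y1)) {y1..y2}"
    by simp
  from has_integral_mult_right[OF this, of "\<i> / 2"] show ?thesis
    by (simp add: mult.assoc[symmetric])
qed

text \<open>Half the distance of a from the real axis: the line Im \<zeta> = -\<open>depth\<close>
  runs strictly between them, away from the pole at a and from the boundary.\<close>

definition "depth = - Im a / 2"

lemma depth: "depth > 0" "Im a = - 2 * depth"
  using a by (auto simp: depth_def)

text \<open>On Im z = t put \<zeta> = cnj z. Then W becomes G \<zeta> and z - a becomes \<zeta> - a'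
  with a' = a - 2\<i>t. For fixed t the integrand is holomorphic in \<zeta>, so the line can be
  moved from height -t to -\<open>depth\<close>.\<close>

lemma lineW_shift:
  assumes t: "t > 0"
  shows "lineW t = (\<integral>x. (Complex x (- depth) - a + 2 * \<i> * of_real t) powr of_real (- kexp) * G (Complex x (- depth)) \<partial>lborel)"
proof -
  define a' where "a' = a - 2 * \<i> * of_real t"
  define \<Phi> where "\<Phi> \<zeta> = (\<zeta> - a') powr of_real (- kexp) * G \<zeta>" for \<zeta>
  define T where "T = {\<zeta>. Im a' < Im \<zeta>} \<inter> \<L>"
  have oT: "open T" unfolding T_def by (intro open_Int open_halfspace_Im_gt open_half_planes)
  have Ima': "Im a' = - 2 * depth - 2 * t" by (simp add: a'_def depth(2))
  have hol: "\<Phi> holomorphic_on T"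
    unfolding \<Phi>_def
  proof (intro holomorphic_on_mult holomorphic_on_subset[OF G])
    have "((\<lambda>\<zeta>. (\<zeta> - a') powr of_real (- kexp)) has_field_derivative
        of_real (- kexp) * (\<zeta> - a') powr (of_real (- kexp) - 1)) (at \<zeta>)" if "\<zeta> \<in> T" for \<zeta>
      using that by (intro power_kernel_deriv) (simp add: T_def)
    then show "(\<lambda>\<zeta>. (\<zeta> - a') powr of_real (- kexp)) holomorphic_on T"
      using holomorphic_on_open[OF oT] by blast
  qed (auto simp: T_def)
  \<comment> \<open>Either of t and \<open>depth\<close> may be the larger one, so the strip is
    given by the ordered pair; its lower edge stays at least \<open>depth\<close> above the branch
    point a'.\<close>
  define lo hi where "lo = - max t depth" and "hi = - min t depth"
  have lohi: "hi < 0" "lo \<le> hi" "Im a' + depth \<le> lo"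
    using t depth by (auto simp: lo_def hi_def Ima' max_def min_def)
  have shift: "(\<integral>x. \<Phi> (Complex x lo) \<partial>lborel) = (\<integral>x. \<Phi> (Complex x hi) \<partial>lborel)"
  proof (cases "lo = hi")
    case False
    obtain CW where CW: "CW \<ge> 0" "\<And>z. Im z \<ge> - hi \<Longrightarrow> norm (W 0 z) \<le> CW * (1 + norm z) powr Q"
      using Wb[of "- hi"] lohi by auto
    define K where "K = ((1 + norm a') / depth + 1) powr kexp"
    show ?thesis
    proof (rule line_shift[OF oT hol, where C = "K * CW"])
      show "lo < hi" using False lohi by simp
      show "{z. lo \<le> Im z \<and> Im z \<le> hi} \<subseteq> T" using lohi depth by (auto simp: T_def lower_half_plane_def)
      fix \<zeta> assume z: "lo \<le> Im \<zeta>" "Im \<zeta> \<le> hi"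
      have "norm (\<Phi> \<zeta>) \<le> K * CW * (1 + norm \<zeta>) powr (- (kexp - Q))"
        unfolding \<Phi>_def
      proof (rule powr_times_growth)
        show "norm ((\<zeta> - a') powr of_real (- kexp)) \<le> K * (1 + norm \<zeta>) powr (- kexp)"
          unfolding K_def using z lohi depth(1) kexp(3) by (intro power_kernel_bound) auto
        have "G \<zeta> = W 0 (cnj \<zeta>)" using WG[of "cnj \<zeta>"] z lohi by (simp add: upper_half_plane_def)
        then show "norm (G \<zeta>) \<le> CW * (1 + norm \<zeta>) powr Q" using CW(2)[of "cnj \<zeta>"] z by simp
      qed auto
      then show "norm (\<Phi> \<zeta>) \<le> K * CW / (1 + (Re \<zeta>)\<^sup>2)"
        by (rule growth_power_le_line) (use kexp(1) CW(1) in \<open>auto simp: K_def\<close>)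
    qed
  qed simp
  then have eq: "(\<integral>x. \<Phi> (Complex x (- t)) \<partial>lborel) = (\<integral>x. \<Phi> (Complex x (- depth)) \<partial>lborel)"
    by (cases "t \<le> depth") (simp_all add: lo_def hi_def max_def min_def)
  have "kern (Complex x t) * W 0 (Complex x t) = \<Phi> (Complex x (- t))" for x
  proof -
    have "W 0 (Complex x t) = G (Complex x (- t))"
      using WG[of "Complex x t"] t by (simp add: upper_half_plane_def complex_cnj)
    moreover have "Complex x t - a = Complex x (- t) - a'" by (simp add: a'_def complex_eq_iff)
    ultimately show ?thesis by (simp add: \<Phi>_def kern_def)
  qed
  moreover have "\<Phi> (Complex x (- depth)) = (Complex x (- depth) - a + 2 * \<i> * of_real t) powr of_real (- kexp) * G (Complex x (- depth))" for x
    by (simp add: \<Phi>_def a'_def algebra_simps)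
  ultimately show ?thesis using eq by (simp add: lineW_def)
qed

definition "joint x t = indicator {0<..} t *\<^sub>R (ray_kernel \<alpha> (Suc m) (Complex x (- depth) - a) t * G (Complex x (- depth)))"

text \<open>The exponent splits as \<open>kexp\<close> = m + (\<alpha> + 2). With v = \<tau> +
  2\<i>t, m powers of |v| are compared with 1 + |z| and beat the growth of G, the remaining \<alpha>
  + 2 are compared with 1 + t. The majorant is a product of integrable functions of x and of
  t.\<close>

lemma joint_bound:
  obtains C where "\<And>x t. norm (joint x t) \<le> norm (C / (1 + x\<^sup>2) * (indicator {0<..} t *\<^sub>R beta_weight \<alpha> t))"
proof -
  obtain CW where CW: "CW \<ge> 0" "\<And>z. Im z \<ge> depth \<Longrightarrow> norm (W 0 z) \<le> CW * (1 + norm z) powr Q"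
    using Wb[OF depth(1)] by auto
  define c where "c = (1 + norm a) / depth + 1"
  have c: "c > 0" using depth by (simp add: c_def add_nonneg_pos)
  define mm where "mm = min depth 2"
  have mm: "mm > 0" using depth by (simp add: mm_def)
  define C where "C = c powr real m * mm powr (- (\<alpha> + 2)) * CW"
  have C0: "C \<ge> 0" using CW by (simp add: C_def)
  have main: "norm (joint x t) \<le> C / (1 + x\<^sup>2) * beta_weight \<alpha> t" if t: "t > 0" for x t
  proof -
    let ?z = "Complex x (- depth)"
    define v where "v = ?z - a + 2 * \<i> * of_real t"
    have v1: "1 + norm ?z \<le> c * norm v"
    proof -
      have "1 + norm ?z \<le> ((1 + norm a) / depth + 1) * norm (?z - a)"
        using depth by (intro norm_shift_lower_bound) auto
      also have "norm (?z - a) \<le> norm v"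
        unfolding v_def cmod_def using t depth by (intro real_sqrt_le_mono add_left_mono power_mono) auto
      finally show ?thesis using c by (simp add: c_def mult_left_mono)
    qed
    have v2: "mm * (1 + t) \<le> norm v"
      using ray_lower_bound[of t "?z - a"] t depth by (simp add: v_def mm_def)
    have vp: "norm v > 0"
    proof -
      have "0 < mm * (1 + t)" using mm t by simp
      then show ?thesis using v2 by linarith
    qed
    have zp: "1 + norm ?z > 0" using norm_ge_zero[of ?z] by linarith
    have "norm (v powr of_real (- kexp)) = norm v powr (- real m) * norm v powr (- (\<alpha> + 2))"
    proof -
      have "norm (v powr of_real (- kexp)) = norm v powr (- kexp)"
        using vp by (intro norm_powr_of_real) auto
      also have "\<dots> = norm v powr (- real m) * norm v powr (- (\<alpha> + 2))"
        unfolding powr_add[symmetric] by (rule arg_cong[where f = "\<lambda>p. norm v powr p"]) (simp add: kexp_def)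
      finally show ?thesis .
    qed
    also have "\<dots> \<le> (c powr real m * (1 + norm ?z) powr (- real m)) * (mm powr (- (\<alpha> + 2)) * (1 + t) powr (- \<alpha> - 2))"
    proof (intro mult_mono)
      have "norm v powr (- real m) \<le> ((1 + norm ?z) / c) powr (- real m)"
        using v1 c zp by (intro powr_mono2') (auto simp: field_simps)
      also have "\<dots> = c powr real m * (1 + norm ?z) powr (- real m)"
        using c zp by (simp add: powr_divide powr_minus field_simps)
      finally show "norm v powr (- real m) \<le> c powr real m * (1 + norm ?z) powr (- real m)" .
      have "norm v powr (- (\<alpha> + 2)) \<le> (mm * (1 + t)) powr (- (\<alpha> + 2))"
        using v2 mm t \<alpha> by (intro powr_mono2') auto
      also have "\<dots> = mm powr (- (\<alpha> + 2)) * (1 + t) powr (- \<alpha> - 2)"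
        using mm t by (simp add: powr_mult)
      finally show "norm v powr (- (\<alpha> + 2)) \<le> mm powr (- (\<alpha> + 2)) * (1 + t) powr (- \<alpha> - 2)" .
    qed auto
    finally have vb: "norm (v powr of_real (- kexp)) \<le>
       (c powr real m * mm powr (- (\<alpha> + 2)) * (1 + t) powr (- \<alpha> - 2)) * (1 + norm ?z) powr (- real m)"
      by (simp add: mult_ac)
    have "G ?z = W 0 (cnj ?z)" using WG[of "cnj ?z"] depth by (simp add: upper_half_plane_def)
    then have "norm (G ?z) \<le> CW * (1 + norm ?z) powr Q" using CW(2)[of "cnj ?z"] by simp
    from powr_times_growth[OF vb this]
    have "norm (v powr of_real (- kexp) * G ?z) \<le> C * (1 + t) powr (- \<alpha> - 2) * (1 + norm ?z) powr (- (real m - Q))"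
      by (simp add: C_def mult_ac)
    then have "norm (v powr of_real (- kexp) * G ?z) \<le> C * (1 + t) powr (- \<alpha> - 2) / (1 + (Re ?z)\<^sup>2)"
      by (rule growth_power_le_line) (use m C0 in auto)
    then have "t powr \<alpha> * norm (v powr of_real (- kexp) * G ?z) \<le> t powr \<alpha> * (C * (1 + t) powr (- \<alpha> - 2) / (1 + x\<^sup>2))"
      by (intro mult_left_mono) auto
    moreover have "norm (joint x t) = t powr \<alpha> * norm (v powr of_real (- kexp) * G ?z)"
      using t by (simp add: joint_def ray_kernel_def v_def kexp_def norm_mult)
    ultimately show ?thesis by (simp add: mult_ac)
  qed
  show thesis
  proof (rule that[of C])
    fix x t
    show "norm (joint x t) \<le> norm (C / (1 + x\<^sup>2) * (indicator {0<..} t *\<^sub>R beta_weight \<alpha> t))"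
    proof (cases "t > 0")
      case True
      show ?thesis using order_trans[OF main[OF True] abs_ge_self] True by simp
    qed (simp add: joint_def)
  qed
qed

lemma joint_integrable: "integrable (lborel \<Otimes>\<^sub>M lborel) (\<lambda>(x, t). joint x t)"
proof -
  obtain C where C: "\<And>x t. norm (joint x t) \<le> norm (C / (1 + x\<^sup>2) * (indicator {0<..} t *\<^sub>R beta_weight \<alpha> t))"
    by (rule joint_bound) blast
  have meas: "(\<lambda>(x, t). joint x t) \<in> borel_measurable (lborel \<Otimes>\<^sub>M lborel)"
  proof -
    let ?f = "\<lambda>p. ray_kernel \<alpha> (Suc m) (Complex (fst p) (- depth) - a) (snd p) * G (Complex (fst p) (- depth))"
    let ?A = "UNIV \<times> {0<..} :: (real \<times> real) set"
    have Gc: "continuous_on ?A (\<lambda>p. G (Complex (fst p) (- depth)))"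
      by (rule continuous_on_compose2[OF holomorphic_on_imp_continuous_on[OF G]])
        (use depth in \<open>auto simp: Complex_eq lower_half_plane_def intro!: continuous_intros\<close>)
    have Cc: "continuous_on ?A (\<lambda>p. Complex (fst p) (- depth))"
      unfolding Complex_eq by (intro continuous_intros)
    have "continuous_on ?A (\<lambda>p. complex_of_real (snd p powr \<alpha>))"
      by (intro continuous_intros) auto
    moreover have "continuous_on ?A (\<lambda>p. (Complex (fst p) (- depth) - a + 2 * \<i> * of_real (snd p)) powr of_real (- (\<alpha> + 1 + real (Suc m))))"
      using depth by (intro continuous_on_powr_Im_pos continuous_intros Cc) auto
    ultimately have "continuous_on ?A ?f"
      unfolding ray_kernel_def by (intro continuous_on_mult Gc)
    moreover have "?A \<in> sets borel" by (intro borel_open open_Times) auto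
    ultimately have "(\<lambda>p. indicator ?A p *\<^sub>R ?f p) \<in> borel_measurable borel"
      using borel_measurable_continuous_on_indicator by blast
    moreover have "(\<lambda>p. indicator ?A p *\<^sub>R ?f p) = (\<lambda>(x, t). joint x t)"
      by (auto simp: joint_def indicator_def fun_eq_iff)
    ultimately show ?thesis unfolding lborel_prod by simp
  qed
  have gi: "integrable lborel (\<lambda>x::real. C / (1 + x\<^sup>2))"
    using integrable_mult_right[OF integrable_inverse_1_plus_sq, of C] by simp
  have hi: "integrable lborel (\<lambda>t. indicator {0<..} t *\<^sub>R beta_weight \<alpha> t)"
    using integrable_beta_weight[OF \<alpha>] unfolding set_integrable_def .
  have "integrable (lborel \<Otimes>\<^sub>M lborel) (\<lambda>(x, t). C / (1 + x\<^sup>2) * (indicator {0<..} t *\<^sub>R beta_weight \<alpha> t))"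
  proof (rule lborel_pair.Fubini_integrable)
    show "(\<lambda>(x, t). C / (1 + x\<^sup>2) * (indicator {0<..} t *\<^sub>R beta_weight \<alpha> t)) \<in> borel_measurable (lborel \<Otimes>\<^sub>M lborel)"
      using borel_measurable_integrable[OF gi] borel_measurable_integrable[OF hi] by measurable
    show "AE x in lborel. integrable lborel (\<lambda>t. case (x, t) of (x, t) \<Rightarrow> C / (1 + x\<^sup>2) * (indicator {0<..} t *\<^sub>R beta_weight \<alpha> t))"
      using hi by (auto intro!: AE_I2 integrable_mult_right)
    have "integrable lborel (\<lambda>x. norm (C / (1 + x\<^sup>2)) * (\<integral>t. norm (indicator {0<..} t *\<^sub>R beta_weight \<alpha> t) \<partial>lborel))"
      using gi by (intro integrable_mult_left integrable_norm)
    then show "integrable lborel (\<lambda>x. \<integral>t. norm (case (x, t) of (x, t) \<Rightarrow> C / (1 + x\<^sup>2) * (indicator {0<..} t *\<^sub>R beta_weight \<alpha> t)) \<partial>lborel)"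
      unfolding prod.case norm_mult integral_mult_right_zero .
  qed
  then show ?thesis
    by (rule Bochner_Integration.integrable_bound[OF _ meas]) (use C in \<open>auto intro!: AE_I2\<close>)
qed

text \<open>Integrating first in x gives the integral of t^\<alpha> \<open>lineW t\<close>, by
  \<open>lineU_difference\<close> a limit of differences of \<open>lineU\<close>, hence 0.
  Integrating first in t gives \<kappa> times the Cauchy integral of G over the line at
  \<open>depth\<close>. Fubini equates the two.\<close>

lemma flux_deriv_zero: "(deriv ^^ m) G a = 0"
proof -
  define \<phi> where "\<phi> t = (\<integral>x. joint x t \<partial>lborel)" for t
  have \<phi>: "\<phi> t = of_real (t powr \<alpha>) * lineW t" if "t > 0" for t
    using that by (simp add: \<phi>_def joint_def ray_kernel_def lineW_shift kexp_def mult.assoc)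
  have \<phi>i: "integrable lborel \<phi>"
    unfolding \<phi>_def using lborel_pair.integrable_snd[OF joint_integrable] by simp
  have swap: "(\<integral>t. \<phi> t \<partial>lborel) = (\<integral>x. (\<integral>t. joint x t \<partial>lborel) \<partial>lborel)"
    unfolding \<phi>_def by (rule lborel_pair.Fubini_integral[OF joint_integrable])
  \<comment> \<open>The index n + 2 keeps the endpoints distinct: with n + 1 the first interval
    would shrink to the point 1, while \<open>lineU_difference\<close> asks for y1 < y2.\<close>
  define J where "J n = {1 / real (Suc (Suc n))..real (Suc (Suc n))}" for n
  have JU: "(\<integral>t. indicator (J n) t *\<^sub>R \<phi> t \<partial>lborel) = \<i> / 2 * (lineU (real (Suc (Suc n))) - lineU (1 / real (Suc (Suc n))))" for n
  proof -
    have lt: "1 / real (Suc (Suc n)) < real (Suc (Suc n))" by (simp add: field_simps add_strict_increasing)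
    have si: "set_integrable lborel (J n) \<phi>"
      unfolding set_integrable_def J_def by (intro integrable_mult_indicator \<phi>i) auto
    have "((\<lambda>y. of_real (y powr \<alpha>) * lineW y) has_integral (\<i> / 2 * (lineU (real (Suc (Suc n))) - lineU (1 / real (Suc (Suc n)))))) (J n)"
      unfolding J_def by (rule lineU_difference) (use lt in auto)
    then have "(\<phi> has_integral (\<i> / 2 * (lineU (real (Suc (Suc n))) - lineU (1 / real (Suc (Suc n)))))) (J n)"
    proof (rule has_integral_eq[rotated])
      fix y assume "y \<in> J n"
      then have "0 < y" unfolding J_def using less_le_trans[of 0 "1 / real (Suc (Suc n))" y] by simp
      then show "of_real (y powr \<alpha>) * lineW y = \<phi> y" by (simp add: \<phi>)
    qed
    then show ?thesis
      using set_borel_integral_eq_integral(2)[OF si]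
      unfolding set_lebesgue_integral_def by (simp only: integral_unique)
  qed
  have "(\<lambda>n. \<i> / 2 * (lineU (real (Suc (Suc n))) - lineU (1 / real (Suc (Suc n))))) \<longlonglongrightarrow> \<i> / 2 * (0 - 0)"
    by (intro tendsto_intros LIMSEQ_Suc[OF lineU_tendsto_0(1)] LIMSEQ_Suc[OF lineU_tendsto_0(2)])
  then have l1: "(\<lambda>n. \<integral>t. indicator (J n) t *\<^sub>R \<phi> t \<partial>lborel) \<longlonglongrightarrow> 0"
    unfolding JU by (simp only: diff_self mult_zero_right)
  have l2: "(\<lambda>n. \<integral>t. indicator (J n) t *\<^sub>R \<phi> t \<partial>lborel) \<longlonglongrightarrow> (\<integral>t. \<phi> t \<partial>lborel)"
  proof (rule Bochner_Integration.integral_dominated_convergence[where w = "\<lambda>t. norm (\<phi> t)"])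
    show "AE t in lborel. (\<lambda>n. indicator (J n) t *\<^sub>R \<phi> t) \<longlonglongrightarrow> \<phi> t"
    proof (rule AE_I2)
      fix t :: real
      show "(\<lambda>n. indicator (J n) t *\<^sub>R \<phi> t) \<longlonglongrightarrow> \<phi> t"
      proof (cases "t > 0")
        case True
        obtain N1 :: nat where N1: "t \<le> real N1" using real_arch_simple by blast
        obtain N2 :: nat where N2: "1 / t \<le> real N2" using real_arch_simple by blast
        have "t \<in> J n" if "n \<ge> max N1 N2" for n
        proof -
          have "1 / t \<le> real (Suc (Suc n))" using N2 that by simp
          then have "1 / real (Suc (Suc n)) \<le> t" using True by (simp add: field_simps)
          then show ?thesis using N1 that by (simp add: J_def)
        qed
        then have "\<forall>\<^sub>F n in sequentially. indicator (J n) t *\<^sub>R \<phi> t = \<phi> t"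
          unfolding eventually_sequentially by (intro exI[of _ "max N1 N2"]) simp
        then show ?thesis by (rule tendsto_eventually)
      next
        case False
        then have "joint x t = 0" for x by (simp add: joint_def)
        then have "\<phi> t = 0" by (simp add: \<phi>_def)
        then show ?thesis by simp
      qed
    qed
    show "(\<lambda>t. indicator (J n) t *\<^sub>R \<phi> t) \<in> borel_measurable lborel" for n
      using borel_measurable_integrable[OF \<phi>i] by (intro borel_measurable_scaleR borel_measurable_indicator) (auto simp: J_def)
  qed (use \<phi>i in \<open>auto intro!: AE_I2 simp: indicator_def\<close>)
  have zero: "(\<integral>x. (\<integral>t. joint x t \<partial>lborel) \<partial>lborel) = 0"
    using LIMSEQ_unique[OF l2 l1] swap by simp
  obtain \<kappa> where \<kappa>: "\<kappa> \<noteq> 0" "\<And>\<tau>. Im \<tau> > 0 \<Longrightarrow> (LINT t:{0<..}|lborel. ray_kernel \<alpha> (Suc m) \<tau> t) = \<kappa> / \<tau> ^ Suc m"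
    using ray_kernel_integral[OF \<alpha>, of "Suc m"] by auto
  have J1: "(\<integral>t. joint x t \<partial>lborel) = \<kappa> * (G (Complex x (- depth)) / (Complex x (- depth) - a) ^ Suc m)" for x
  proof -
    have "(\<integral>t. joint x t \<partial>lborel) = (\<integral>t. (indicator {0<..} t *\<^sub>R ray_kernel \<alpha> (Suc m) (Complex x (- depth) - a) t) * G (Complex x (- depth)) \<partial>lborel)"
      by (simp add: joint_def)
    also have "\<dots> = (LINT t:{0<..}|lborel. ray_kernel \<alpha> (Suc m) (Complex x (- depth) - a) t) * G (Complex x (- depth))"
      unfolding set_lebesgue_integral_def by (rule integral_mult_left_zero)
    also have "(LINT t:{0<..}|lborel. ray_kernel \<alpha> (Suc m) (Complex x (- depth) - a) t) = \<kappa> / (Complex x (- depth) - a) ^ Suc m"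
      by (rule \<kappa>(2)) (use depth in auto)
    finally show ?thesis by simp
  qed
  have z0: "(\<integral>x. G (Complex x (- depth)) / (Complex x (- depth) - a) ^ Suc m \<partial>lborel) = 0"
    using zero \<kappa>(1) unfolding J1 integral_mult_right_zero by (simp only: mult_eq_0_iff simp_thms)
  obtain CW where CW: "CW \<ge> 0" "\<And>z. Im z \<ge> depth \<Longrightarrow> norm (W 0 z) \<le> CW * (1 + norm z) powr Q"
    using Wb[OF depth(1)] by auto
  show ?thesis
  proof (rule half_plane_cauchy[OF G depth(1) _ _ CW(1) _ z0])
    fix \<zeta> assume z: "Im \<zeta> \<le> - depth"
    have "G \<zeta> = W 0 (cnj \<zeta>)" using WG[of "cnj \<zeta>"] z depth by (simp add: upper_half_plane_def)
    then show "norm (G \<zeta>) \<le> CW * (1 + norm \<zeta>) powr Q" using CW(2)[of "cnj \<zeta>"] z by simp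
  qed (use m depth in auto)
qed

end

section \<open>The functions spanning \<open>V_space\<close>\<close>

text \<open>The numbers p and q are the derivatives of f with respect to z and cnj z, read off from
  the real derivative; each obeys the usual rules for sums and products.\<close>

definition wirtinger :: "(complex \<Rightarrow> complex) \<Rightarrow> complex \<Rightarrow> complex \<Rightarrow> complex \<Rightarrow> bool" where
  "wirtinger f p q z \<longleftrightarrow> (f has_derivative (\<lambda>h. p * h + q * cnj h)) (at z)"

lemma wirtinger_delbar:
  assumes "wirtinger f p q z"
  shows "f differentiable (at z)" "delbar_z f z = q"
proof -
  have d: "(f has_derivative (\<lambda>h. p * h + q * cnj h)) (at z)" using assms by (simp add: wirtinger_def)
  then show diff: "f differentiable (at z)" by (auto simp: differentiable_def)
  have "(\<lambda>h. p * h + q * cnj h) = (\<lambda>h. of_real (Re h) * partial_x f z + of_real (Im h) * partial_y f z)"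
    by (rule has_derivative_unique[OF d differentiable_partials(3)[OF diff]])
  from fun_cong[OF this, of 1] fun_cong[OF this, of \<i>]
  have e: "partial_x f z = p + q" "partial_y f z = p * \<i> + q * (- \<i>)" by simp_all
  show "delbar_z f z = q" unfolding delbar_z_def e by (simp add: algebra_simps)
qed

lemma wirtinger_mult:
  assumes "wirtinger f p q z" "wirtinger g p' q' z"
  shows "wirtinger (\<lambda>z. f z * g z) (f z * p' + p * g z) (f z * q' + q * g z) z"
  using has_derivative_mult[OF assms[unfolded wirtinger_def]]
  unfolding wirtinger_def by (simp add: algebra_simps)

lemma wirtinger_add:
  assumes "wirtinger f p q z" "wirtinger g p' q' z"
  shows "wirtinger (\<lambda>z. f z + g z) (p + p') (q + q') z"
  using has_derivative_add[OF assms[unfolded wirtinger_def]]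
  unfolding wirtinger_def by (simp add: algebra_simps)

lemma wirtinger_cmult:
  assumes "wirtinger f p q z"
  shows "wirtinger (\<lambda>z. c * f z) (c * p) (c * q) z"
  using has_derivative_mult_right[OF assms[unfolded wirtinger_def], of c]
  unfolding wirtinger_def by (simp add: algebra_simps)

lemma wirtinger_ident: "wirtinger (\<lambda>z. z) 1 0 z"
  unfolding wirtinger_def by simp

lemma wirtinger_cnj_power: "wirtinger (\<lambda>z. cnj z ^ n) 0 (of_nat n * cnj z ^ (n - 1)) z"
proof (induction n)
  case (Suc n)
  have "wirtinger cnj 0 1 z"
    unfolding wirtinger_def using bounded_linear_imp_has_derivative[OF bounded_linear_cnj] by simp
  from wirtinger_mult[OF this Suc] show ?case
    by (cases n) (simp_all add: algebra_simps)
qed (simp add: wirtinger_def)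

lemma wirtinger_Im_powr:
  assumes "Im z > 0"
  shows "wirtinger (\<lambda>z. of_real (Im z powr r)) (- \<i> / 2 * of_real (r * Im z powr (r - 1))) (\<i> / 2 * of_real (r * Im z powr (r - 1))) z"
proof -
  have "((\<lambda>z. Im z powr r) has_derivative (\<lambda>h. r * Im z powr (r - 1) * Im h)) (at z)"
    using diff_chain_at[OF bounded_linear_imp_has_derivative[OF bounded_linear_Im]
        has_real_derivative_powr[OF assms, of r, unfolded has_field_derivative_def]]
    by (simp add: o_def)
  then have D: "((\<lambda>z. complex_of_real (Im z powr r)) has_derivative (\<lambda>h. of_real (r * Im z powr (r - 1) * Im h))) (at z)"
    by (rule has_derivative_of_real)
  have e: "complex_of_real (c * Im h) = - \<i> / 2 * of_real c * h + \<i> / 2 * of_real c * cnj h" for c h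
    by (simp add: complex_eq_iff)
  show ?thesis unfolding wirtinger_def by (rule D[unfolded e])
qed

text \<open>Every term except the one with j = k + 1 carries a factor z; the recursion drives the
  induction for the flux.\<close>

lemma p_poly_Suc:
  "p_poly (Suc k) \<alpha> z = z * p_poly k \<alpha> z + of_real (pochhammer (\<alpha> + 1) (Suc k) / fact (Suc k)) * cnj z ^ Suc k"
proof -
  have "(\<Sum>j\<le>k. of_real (pochhammer (\<alpha> + 1) j / fact j) * z ^ (Suc k - j) * cnj z ^ j)
      = z * (\<Sum>j\<le>k. of_real (pochhammer (\<alpha> + 1) j / fact j) * z ^ (k - j) * cnj z ^ j)"
    unfolding sum_distrib_left by (intro sum.cong refl) (simp add: Suc_diff_le mult_ac)
  then show ?thesis unfolding p_poly_def by simp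
qed

text \<open>By homogeneity the flux of \<open>y^(\<alpha>+1) p_poly k\<close> is a multiple of \<open>cnj z ^ k\<close>.\<close>

lemma p_poly_wirtinger:
  "\<exists>P D. wirtinger (p_poly k \<alpha>) P D z \<and>
     of_real (\<alpha> + 1) * p_poly k \<alpha> z - (z - cnj z) * D
       = of_real (pochhammer (\<alpha> + 1) (Suc k) / fact k) * cnj z ^ k"
proof (induction k)
  case 0
  have "wirtinger (p_poly 0 \<alpha>) 0 0 z" by (simp add: wirtinger_def p_poly_def[abs_def])
  then show ?case
    by (intro exI[of _ 0] conjI) (assumption, simp add: p_poly_def)
next
  case (Suc k)
  then obtain P D where PD: "wirtinger (p_poly k \<alpha>) P D z"
    and B: "of_real (\<alpha> + 1) * p_poly k \<alpha> z - (z - cnj z) * D = of_real (pochhammer (\<alpha> + 1) (Suc k) / fact k) * cnj z ^ k"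
    by blast
  define c where "c = pochhammer (\<alpha> + 1) (Suc k) / fact (Suc k)"
  have ck: "pochhammer (\<alpha> + 1) (Suc k) / fact k = real (Suc k) * c"
    by (simp add: c_def field_simps del: of_nat_Suc)
  have ck': "pochhammer (\<alpha> + 1) (Suc (Suc k)) / fact (Suc k) = (\<alpha> + 1 + real (Suc k)) * c"
    by (simp add: c_def pochhammer_Suc[of _ "Suc k"])
  define D' where "D' = z * D + of_real c * (of_nat (Suc k) * cnj z ^ k)"
  have "wirtinger (\<lambda>z. z * p_poly k \<alpha> z + of_real c * cnj z ^ Suc k) (z * P + 1 * p_poly k \<alpha> z + of_real c * 0)
      (z * D + 0 * p_poly k \<alpha> z + of_real c * (of_nat (Suc k) * cnj z ^ (Suc k - 1))) z"
    by (intro wirtinger_add wirtinger_mult wirtinger_ident PD wirtinger_cmult wirtinger_cnj_power)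
  then have W: "wirtinger (p_poly (Suc k) \<alpha>) (z * P + 1 * p_poly k \<alpha> z + of_real c * 0) D' z"
    unfolding p_poly_Suc[abs_def] c_def[symmetric] by (simp add: D'_def)
  have "of_real (\<alpha> + 1) * p_poly (Suc k) \<alpha> z - (z - cnj z) * D'
     = z * (of_real (\<alpha> + 1) * p_poly k \<alpha> z - (z - cnj z) * D) + of_real (\<alpha> + 1) * of_real c * cnj z ^ Suc k
       - (z - cnj z) * (of_real c * (of_nat (Suc k) * cnj z ^ k))"
    unfolding p_poly_Suc c_def[symmetric] D'_def by (simp add: algebra_simps)
  also have "\<dots> = of_real ((\<alpha> + 1 + real (Suc k)) * c) * cnj z ^ Suc k"
    unfolding B ck by (simp add: algebra_simps)
  finally show ?case using W ck' by metis
qed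

text \<open>Since y = (z - cnj z) / (2\<i>), the product rule for y^(\<alpha>+1) times the
  polynomial leaves y^\<alpha> \<i>/2 times the combination evaluated in
  \<open>p_poly_wirtinger\<close>.\<close>

lemma p_poly_delbar:
  assumes "Im z > 0"
  shows "\<exists>p. wirtinger (\<lambda>z. of_real (Im z powr (\<alpha> + 1)) * p_poly k \<alpha> z) p
     (\<i> / 2 * of_real (pochhammer (\<alpha> + 1) (Suc k) / fact k) * (of_real (Im z powr \<alpha>) * cnj z ^ k)) z"
proof -
  obtain P D where PD: "wirtinger (p_poly k \<alpha>) P D z"
    and B: "of_real (\<alpha> + 1) * p_poly k \<alpha> z - (z - cnj z) * D = of_real (pochhammer (\<alpha> + 1) (Suc k) / fact k) * cnj z ^ k"
    using p_poly_wirtinger by blast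
  have y: "complex_of_real (Im z powr (\<alpha> + 1)) = - (\<i> / 2) * (z - cnj z) * of_real (Im z powr \<alpha>)"
  proof -
    have "of_real (Im z) = - (\<i> / 2) * (z - cnj z)" by (simp add: complex_eq_iff)
    then show ?thesis using assms by (simp add: powr_add)
  qed
  have "of_real (Im z powr (\<alpha> + 1)) * D + \<i> / 2 * of_real ((\<alpha> + 1) * Im z powr (\<alpha> + 1 - 1)) * p_poly k \<alpha> z
     = \<i> / 2 * of_real (Im z powr \<alpha>) * (of_real (\<alpha> + 1) * p_poly k \<alpha> z - (z - cnj z) * D)"
  proof -
    have "- c * w * X * D + c * (A * X) * v = c * X * (A * v - w * D)" for c w X A v :: complex
      by (simp add: algebra_simps)
    then show ?thesis unfolding y of_real_mult by simp
  qed
  also have "\<dots> = \<i> / 2 * of_real (pochhammer (\<alpha> + 1) (Suc k) / fact k) * (of_real (Im z powr \<alpha>) * cnj z ^ k)"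
    unfolding B by simp
  finally show ?thesis
    using wirtinger_mult[OF wirtinger_Im_powr[OF assms, of "\<alpha> + 1"] PD] by metis
qed

lemma p_poly_continuous: "continuous_on S (p_poly k \<alpha>)"
  unfolding p_poly_def[abs_def] by (intro continuous_intros)

lemma wirtinger_sum:
  assumes "\<And>i. i \<in> I \<Longrightarrow> wirtinger (f i) (p i) (q i) z"
  shows "wirtinger (\<lambda>z. \<Sum>i\<in>I. f i z) (\<Sum>i\<in>I. p i) (\<Sum>i\<in>I. q i) z"
proof -
  have "((\<lambda>z. \<Sum>i\<in>I. f i z) has_derivative (\<lambda>h. \<Sum>i\<in>I. p i * h + q i * cnj h)) (at z)"
    using assms unfolding wirtinger_def by (rule has_derivative_sum)
  then show ?thesis by (simp add: wirtinger_def sum.distrib sum_distrib_right)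
qed

section \<open>Conclusion\<close>

text \<open>Convolutions of the continuous function q stay continuous up to the axis while y^r tends
  to 0, so the subtracted term has boundary value 0. An arbitrary test function is brought into
  convolution form by reflecting it and evaluating at x = 0.\<close>

lemma zero_boundary_value_diff:
  assumes u: "continuous_on \<H> u" "zero_distributional_boundary_value u"
    and q: "continuous_on UNIV q" and r: "r > 0"
  shows "zero_distributional_boundary_value (\<lambda>z. u z - of_real (Im z powr r) * q z)"
  unfolding zero_distributional_boundary_value_def
proof (intro allI impI)
  fix \<psi> assume "test_function \<psi>"
  then obtain A0 D0 where T0: "test_tower A0 D0" and D0: "D0 0 = \<psi>" using test_function_tower by blast
  define A D where "A = A0 + \<bar>0::real\<bar>" and "D n s = (-1) ^ n * D0 n (0 - s)" for n s
  have T: "test_tower A D" unfolding A_def D_def by (rule test_tower_reflect[OF T0])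
  have \<psi>: "\<psi> s = D 0 (0 - s)" for s by (simp add: D_def D0)
  note hor = horizontal_upper_half_plane and Dc = test_tower_continuous[OF T]
  have hu: "horizontal UNIV" by (simp add: horizontal_def)
  let ?h = "\<lambda>z. u z - of_real (Im z powr r) * q z"
  have qc: "continuous_on \<H> q" by (rule continuous_on_subset[OF q]) auto
  have hc: "continuous_on \<H> ?h"
    by (intro continuous_intros u(1) qc) (auto simp: upper_half_plane_def)
  have lim1: "((\<lambda>y. conv A (D 0) u (Complex 0 y)) \<longlongrightarrow> 0) (at_right 0)"
    by (rule conv_tendsto_0[OF T u])
  have "continuous_on UNIV (conv A (D 0) q)" by (rule conv_continuous[OF hu q Dc])
  then have "isCont (conv A (D 0) q) 0" by (simp add: continuous_on_eq_continuous_at)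
  moreover have "((\<lambda>y. Complex 0 y) \<longlongrightarrow> 0) (at_right 0)"
  proof -
    have "((\<lambda>y. of_real 0 + \<i> * complex_of_real y) \<longlongrightarrow> of_real 0 + \<i> * of_real 0) (at_right 0)"
      by (intro tendsto_intros)
    then show ?thesis unfolding Complex_eq by simp
  qed
  ultimately have "((\<lambda>y. conv A (D 0) q (Complex 0 y)) \<longlongrightarrow> conv A (D 0) q 0) (at_right 0)"
    by (rule isCont_tendsto_compose)
  moreover have "((\<lambda>y. complex_of_real (y powr r)) \<longlongrightarrow> of_real (0 powr r)) (at_right 0)"
    by (intro tendsto_of_real tendsto_powr'[OF tendsto_ident_at tendsto_const])
       (use r in \<open>auto simp: eventually_at_filter\<close>)
  ultimately have "((\<lambda>y. conv A (D 0) u (Complex 0 y) + (- of_real (y powr r)) * conv A (D 0) q (Complex 0 y))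
      \<longlongrightarrow> 0 + (- of_real (0 powr r)) * conv A (D 0) q 0) (at_right 0)"
    by (intro tendsto_add tendsto_mult tendsto_minus lim1)
  then have lim: "((\<lambda>y. conv A (D 0) u (Complex 0 y) + (- of_real (y powr r)) * conv A (D 0) q (Complex 0 y)) \<longlongrightarrow> 0) (at_right 0)"
    by simp
  show "((\<lambda>y. \<integral>x. ?h (Complex x y) * \<psi> x \<partial>lborel) \<longlongrightarrow> 0) (at_right 0)"
  proof (rule Lim_transform_eventually[OF lim])
    have "\<forall>\<^sub>F y in at_right (0::real). 0 < y" by (simp add: eventually_at_filter)
    then show "\<forall>\<^sub>F y in at_right 0. conv A (D 0) u (Complex 0 y) + (- of_real (y powr r)) * conv A (D 0) q (Complex 0 y)
        = (\<integral>x. ?h (Complex x y) * \<psi> x \<partial>lborel)"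
    proof eventually_elim
      case (elim y)
      have z: "Complex 0 y \<in> \<H>" using elim by (simp add: upper_half_plane_def)
      have "(\<integral>x. ?h (Complex x y) * \<psi> x \<partial>lborel) = conv A (D 0) ?h (Complex 0 y)"
        unfolding \<psi> by (rule pairing_eq_conv(2)[OF T hc elim])
      also have "\<dots> = 1 * conv A (D 0) u (Complex 0 y) + (- of_real (y powr r)) * conv A (D 0) q (Complex 0 y)"
        by (rule conv_cong_add[OF hor u(1) qc Dc z]) simp
      finally show ?case by simp
    qed
  qed
qed

theorem theorem5p7:
  fixes \<alpha> :: real and u :: "complex \<Rightarrow> complex"
  assumes "\<alpha> > -1"
    and "alpha_harmonic \<alpha> u"
    and "temperate_growth_at_infinity u"
    and "zero_distributional_boundary_value u"
  shows "u \<in> V_space \<alpha>"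
proof -
  note \<alpha> = assms(1) and z0 = assms(4)
  have C1: "C1_on \<H> u" using assms(2) by (simp add: alpha_harmonic_def C2_on_def)
  then have ud: "u differentiable (at z)" if "z \<in> \<H>" for z using that by (simp add: C1_on_def)
  then have uc: "continuous_on \<H> u"
    by (intro continuous_at_imp_continuous_on ballI differentiable_imp_continuous_within)
  obtain G where G: "G holomorphic_on \<L>"
    and eq: "\<And>z. z \<in> \<H> \<Longrightarrow> delbar_z u z = of_real (Im z powr \<alpha>) * G (cnj z)"
    using alpha_harmonic_flux[OF assms(2)] by blast
  obtain C R N where CRN: "C > 0" "R > 0" "N > 0"
    and tg: "\<And>z. z \<in> \<H> \<Longrightarrow> norm z > R \<Longrightarrow> norm (u z) \<le> C * ((norm z)\<^sup>2 / Im z) powr N"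
    using assms(3) unfolding temperate_growth_at_infinity_def by blast
  \<comment> \<open>P is the exponent of |z| in the temperate growth condition, Q the one that
    \<open>harmonic_tower_flux_growth\<close> yields for the flux. Both are fixed before any
    mollifier is chosen, so a single m serves all of them.\<close>
  define P Q where "P = 2 * N" and "Q = P + \<bar>\<alpha>\<bar> + 1"
  obtain m :: nat where "Q + 3 \<le> real m" using real_arch_simple by blast
  then have m: "real (Suc m) \<ge> Q + 3" by simp
  have cl: "convex \<L>" unfolding lower_half_plane_def by (rule convex_halfspace_Im_lt)
  \<comment> \<open>For every mollifier the mollified G has vanishing m-th derivative at a;
    convolution commutes with differentiation, and varying the mollifier removes it.\<close>
  have Gm: "(deriv ^^ m) G a = 0" if a: "a \<in> \<L>" for a
  proof (rule zero_if_conv_zero[OF horizontal_lower_half_plane _ a])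
    show "continuous_on \<L> ((deriv ^^ m) G)"
      by (intro holomorphic_on_imp_continuous_on holomorphic_higher_deriv G open_half_planes)
    fix A D assume T: "test_tower A D"
    define U where "U k = conv A (D k) u" for k
    define W where "W k = conv A (D k) (\<lambda>z. G (cnj z))" for k
    note Dc = test_tower_continuous[OF T]
    have H: "harmonic_tower \<alpha> U W"
      unfolding U_def[abs_def] W_def[abs_def] by (rule mollified_harmonic_tower[OF T C1 G eq])
    have "\<exists>C. \<forall>z\<in>\<H>. norm (U k z) \<le> C * (1 + norm z) powr P * (1 + Im z powr (- N))" for k
      unfolding U_def P_def by (rule mollified_growth[OF T uc z0 CRN tg])
    then have Ub: "\<exists>C. \<forall>z\<in>\<H>. norm (U k z) \<le> C * (1 + norm z) powr P" for k
      using CRN by (intro harmonic_tower_growth[OF H \<alpha>, of P N]) (auto simp: P_def)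
    have Wb: "\<exists>C\<ge>0. \<forall>z. Im z \<ge> \<eta> \<longrightarrow> norm (W 0 z) \<le> C * (1 + norm z) powr Q" if \<eta>: "\<eta> > 0" for \<eta>
    proof -
      have "P \<ge> 0" using CRN by (simp add: P_def)
      then obtain C where "C \<ge> 0" "\<And>z. Im z \<ge> \<eta> \<Longrightarrow> norm (W 0 z) \<le> C * (1 + norm z) powr (P + \<bar>\<alpha>\<bar> + 1)"
        by (rule harmonic_tower_flux_growth[OF H \<alpha> _ \<eta> Ub]) (rule that)
      then show ?thesis by (auto simp: Q_def)
    qed
    have "(deriv ^^ m) (conv A (D 0) G) a = 0"
    proof (rule flux_deriv_zero[OF \<alpha> _ _ H Ub Wb])
      show "((\<lambda>y. U 0 (Complex x y)) \<longlongrightarrow> 0) (at_right 0)" for x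
        unfolding U_def by (rule conv_tendsto_0[OF T uc z0])
      show "conv A (D 0) G holomorphic_on \<L>"
        by (rule conv_holomorphic(1)[OF horizontal_lower_half_plane cl G Dc])
      show "W 0 z = conv A (D 0) G (cnj z)" for z
        by (simp add: W_def conv_def)
      show "Im a < 0" using a by (simp add: lower_half_plane_def)
    qed (use m CRN in \<open>auto simp: P_def Q_def\<close>)
    then show "conv A (D 0) ((deriv ^^ m) G) a = 0"
      using conv_higher_deriv[OF horizontal_lower_half_plane cl G Dc a, of m] by simp
  qed
  obtain b where b: "\<And>\<zeta>. \<zeta> \<in> \<L> \<Longrightarrow> G \<zeta> = (\<Sum>j<m. b j * \<zeta> ^ j)"
    using polynomial_if_higher_deriv_zero[OF open_half_planes(2) cl G Gm] by blast
  \<comment> \<open>The factor of y^\<alpha> cnj z ^ j in the flux of the j-th spanning function. It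
    is nonzero because \<alpha> + 1 > 0, so every coefficient b j can be matched.\<close>
  define \<gamma> where "\<gamma> j = \<i> / 2 * of_real (pochhammer (\<alpha> + 1) (Suc j) / fact j)" for j
  have \<gamma>: "\<gamma> j \<noteq> 0" for j
  proof -
    have "pochhammer (\<alpha> + 1) (Suc j) > 0" using \<alpha> by (intro pochhammer_pos) auto
    then show ?thesis by (simp add: \<gamma>_def)
  qed
  define d where "d j = b j / \<gamma> j" for j
  define q where "q z = (\<Sum>j<m. d j * p_poly j \<alpha> z)" for z
  define h where "h z = u z - of_real (Im z powr (\<alpha> + 1)) * q z" for z
  have qW: "\<exists>p. wirtinger (\<lambda>z. of_real (Im z powr (\<alpha> + 1)) * q z) p (delbar_z u z) z" if z: "z \<in> \<H>" for z
  proof -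
    have y: "Im z > 0" using z by (simp add: upper_half_plane_def)
    obtain p where p: "\<And>j. wirtinger (\<lambda>z. of_real (Im z powr (\<alpha> + 1)) * p_poly j \<alpha> z) (p j) (\<gamma> j * (of_real (Im z powr \<alpha>) * cnj z ^ j)) z"
      using p_poly_delbar[OF y, of \<alpha>] unfolding \<gamma>_def by metis
    have "wirtinger (\<lambda>z. \<Sum>j<m. d j * (of_real (Im z powr (\<alpha> + 1)) * p_poly j \<alpha> z)) (\<Sum>j<m. d j * p j)
       (\<Sum>j<m. d j * (\<gamma> j * (of_real (Im z powr \<alpha>) * cnj z ^ j))) z"
      by (intro wirtinger_sum wirtinger_cmult p)
    moreover have "(\<Sum>j<m. d j * (\<gamma> j * (of_real (Im z powr \<alpha>) * cnj z ^ j))) = delbar_z u z"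
    proof -
      have "cnj z \<in> \<L>" using y by (simp add: lower_half_plane_def)
      then have "delbar_z u z = of_real (Im z powr \<alpha>) * (\<Sum>j<m. b j * cnj z ^ j)"
        using eq[OF z] b by simp
      then show ?thesis
        by (simp add: sum_distrib_left d_def \<gamma> mult_ac)
    qed
    moreover have "(\<lambda>z. \<Sum>j<m. d j * (of_real (Im z powr (\<alpha> + 1)) * p_poly j \<alpha> z)) = (\<lambda>z. of_real (Im z powr (\<alpha> + 1)) * q z)"
      by (simp add: q_def sum_distrib_left mult_ac)
    ultimately show ?thesis by auto
  qed
  have hh: "h holomorphic_on \<H>"
  proof (rule holomorphic_if_delbar_zero[OF open_half_planes(1)])
    fix z assume z: "z \<in> \<H>"
    obtain p where p: "wirtinger (\<lambda>z. of_real (Im z powr (\<alpha> + 1)) * q z) p (delbar_z u z) z" using qW[OF z] by blast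
    have "wirtinger u (partial_x u z - delbar_z u z) (delbar_z u z) z"
    proof -
      have "of_real (Re v) * partial_x u z + of_real (Im v) * partial_y u z
          = (partial_x u z - delbar_z u z) * v + delbar_z u z * cnj v" for v
        unfolding delbar_z_def by (subst (3 4) complex_eq[of v]) (simp add: field_simps)
      then show ?thesis using differentiable_partials(3)[OF ud[OF z]] by (simp add: wirtinger_def)
    qed
    from wirtinger_add[OF this wirtinger_cmult[OF p, of "-1"]]
    have hW: "wirtinger h (partial_x u z - delbar_z u z - p) 0 z" by (simp add: h_def[abs_def])
    show "h differentiable at z" "delbar_z h z = 0" using wirtinger_delbar[OF hW] by blast+
  qed
  have "continuous_on UNIV q"
    unfolding q_def by (intro continuous_intros p_poly_continuous)
  then have "zero_distributional_boundary_value h"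
    unfolding h_def[abs_def] using \<alpha> by (intro zero_boundary_value_diff uc z0) auto
  then have "h z = 0" if "z \<in> \<H>" for z
    by (rule holomorphic_zero_boundary_value[OF hh _ that])
  then have u: "u z = of_real (Im z powr (\<alpha> + 1)) * q z" if "z \<in> \<H>" for z
    using that by (simp add: h_def)
  \<comment> \<open>\<open>V_space\<close> sums up to and including n, so the sum over k < m is
    padded with a zero coefficient at k = m; this also covers m = 0.\<close>
  have "u z = (\<Sum>k\<le>m. (if k < m then d k else 0) * of_real (Im z powr (\<alpha> + 1)) * p_poly k \<alpha> z)"
    if "z \<in> \<H>" for z
  proof -
    have "(\<Sum>k\<le>m. (if k < m then d k else 0) * of_real (Im z powr (\<alpha> + 1)) * p_poly k \<alpha> z)
       = (\<Sum>k<m. d k * of_real (Im z powr (\<alpha> + 1)) * p_poly k \<alpha> z)"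
      by (simp add: lessThan_Suc_atMost[symmetric])
    also have "\<dots> = of_real (Im z powr (\<alpha> + 1)) * q z"
      by (simp add: q_def sum_distrib_left mult_ac)
    finally show ?thesis using u[OF that] by simp
  qed
  then show ?thesis unfolding V_space_def mem_Collect_eq
    by (intro exI[of _ m] exI[of _ "\<lambda>k. if k < m then d k else 0"] ballI)
qed

end
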